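(* In the $\mathsf{CONGEST}$ model (connected $n$-node graph of diameter $D$, each node $v$ holding $\mathrm{val}(v)\in\{1,\dots,N\}\cup\{\mathrm{NULL}\}$), the following worst-case lower bounds hold for randomized algorithms succeeding with a sufficiently large constant probability: (1) If the Brody–Chakrabarti conjecture holds, then approximating $F_p$ (for fixed $p\neq 1$) up to a $1\pm\epsilon$ factor requires $\Omega(D+\epsilon^{-2}/\log n)$ rounds. (2) A $(1\pm 0.1)$-approximation of $F_p$, for $p>2$, requires $\Omega\big(D+(N^{1-2/p}+n^{\frac{1-2/p}{1+1/p}})/\log n\big)$ rounds. (3) Computing $F_p$ exactly, for fixed $p\neq 1$, requires $\Omega(D+n/\log n)$ rounds.
   Context: $f_i=|\{v:\mathrm{val}(v)=i\}|$, $F_p=\sum_{i=1}^N f_i^p$ for $p>0$, $F_0=|\{i:f_i>0\}|$. $\mathsf{CONGEST}$: in each synchronous round each node may send an $O(\log n)$-bit message to each neighbor and then compute locally. The Gap-Hamming-Distance problem of size $N$: Alice holds $x\in\{0,1\}^N$, Bob holds $y\in\{0,1\}^N$, with the promise that the Hamming distance of $x,y$ is either at least $N/2+\sqrt N$ or at most $N/2-\sqrt N$, and they must decide which. The Brody–Chakrabarti conjecture asserts that any randomized two-party protocol for Gap-Hamming-Distance of size $N$ (with sufficiently large constant success probability), irrespective of the number of rounds, has total communication $\Omega(N)$ bits. Lower bounds are worst case over input graphs and value assignments.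
   Formalization: Formal version assumes D≥3 in (1),(3) and D≥4 in (2); ε⁻²=O(n) and O(N) in (1); N=Ω(n) in (3); in (2) the N-term is claimed for N=O(n), the n-term for n=O(N^{1+1/p}), their sum when both hold. As literally stated the bounds fail, e.g. for N=1 or D≤2. *)

theory Defs
  imports "HOL-Probability.Probability"
begin

section \<open>Frequency moments\<close>

text \<open>A value assignment maps node \<open>v < n\<close> to \<open>Some i\<close> with \<open>i \<in> {1..N}\<close>, or to \<open>None\<close> (NULL).\<close>

type_synonym vals = "nat \<Rightarrow> nat option"

definition valid_vals :: "nat \<Rightarrow> nat \<Rightarrow> vals \<Rightarrow> bool" where
  "valid_vals n N val \<longleftrightarrow> (\<forall>v<n. \<forall>i. val v = Some i \<longrightarrow> i \<in> {1..N})"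

definition freq :: "nat \<Rightarrow> vals \<Rightarrow> nat \<Rightarrow> nat" where
  "freq n val i = card {v. v < n \<and> val v = Some i}"

definition moment :: "real \<Rightarrow> nat \<Rightarrow> nat \<Rightarrow> vals \<Rightarrow> real" where
  "moment p n N val =
     (if p = 0 then real (card {i \<in> {1..N}. freq n val i > 0})
      else (\<Sum>i=1..N. real (freq n val i) powr p))"

section \<open>Graphs\<close>

definition simple_graph :: "nat \<Rightarrow> (nat \<times> nat) set \<Rightarrow> bool" where
  "simple_graph n E \<longleftrightarrow> E \<subseteq> {..<n} \<times> {..<n} \<and> sym E \<and> irrefl E"

definition connected_graph :: "nat \<Rightarrow> (nat \<times> nat) set \<Rightarrow> bool" where
  "connected_graph n E \<longleftrightarrow> (\<forall>u<n. \<forall>v<n. (u, v) \<in> E\<^sup>*)"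

definition gdist :: "(nat \<times> nat) set \<Rightarrow> nat \<Rightarrow> nat \<Rightarrow> nat" where
  "gdist E u v = (LEAST k. (u, v) \<in> E ^^ k)"

definition diameter :: "nat \<Rightarrow> (nat \<times> nat) set \<Rightarrow> nat" where
  "diameter n E = Max {gdist E u v | u v. u < n \<and> v < n}"

section \<open>Randomized CONGEST algorithms\<close>

text \<open>
  Local computation is unrestricted, so the state of a node may be taken to be everything it has
  seen: its identifier, the identifiers of its neighbours, its value, its private random seed, and
  for each past round the message received from each node (the empty message from non-neighbours).
  An algorithm is a choice of seed distributions and of functions of this local view.
  Algorithms are not uniform: one is chosen for given \<open>n\<close>, \<open>N\<close>, \<open>D\<close>, so nodes know these parameters.
\<close>

record view =
  own_id :: nat
  nbrs :: "nat set"
  own_val :: "nat option"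
  seed :: nat
  inbox :: "(nat \<Rightarrow> bool list) list"

record congest_alg =
  coins :: "nat \<Rightarrow> nat pmf"
  message :: "view \<Rightarrow> nat \<Rightarrow> bool list"
  answer :: "view \<Rightarrow> real option"

fun view_after :: "congest_alg \<Rightarrow> (nat \<times> nat) set \<Rightarrow> vals \<Rightarrow> (nat \<Rightarrow> nat) \<Rightarrow> nat \<Rightarrow> nat \<Rightarrow> view" where
  "view_after A E val \<omega> 0 v =
     \<lparr>own_id = v, nbrs = E `` {v}, own_val = val v, seed = \<omega> v, inbox = []\<rparr>"
| "view_after A E val \<omega> (Suc r) v =
     (view_after A E val \<omega> r v)
       \<lparr>inbox := inbox (view_after A E val \<omega> r v) @
          [\<lambda>u. if (u, v) \<in> E then message A (view_after A E val \<omega> r u) v else []]\<rparr>"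

definition bandwidth_le :: "congest_alg \<Rightarrow> real \<Rightarrow> bool" where
  "bandwidth_le A b \<longleftrightarrow> (\<forall>s u. real (length (message A s u)) \<le> b)"

text \<open>
  A run of \<open>T\<close> rounds succeeds if at least one node outputs a value and every value that is output
  is correct. This covers both the convention that a single root learns the answer and the one
  that all nodes do. Nodes draw their seeds independently.
\<close>

definition success_prob ::
  "congest_alg \<Rightarrow> nat \<Rightarrow> (nat \<times> nat) set \<Rightarrow> vals \<Rightarrow> nat \<Rightarrow> (real \<Rightarrow> bool) \<Rightarrow> real" where
  "success_prob A n E val T correct =
     measure_pmf.prob (Pi_pmf {..<n} 0 (coins A))
       {\<omega>. (\<exists>v<n. answer A (view_after A E val \<omega> T v) \<noteq> None) \<and>
            (\<forall>v<n. \<forall>y. answer A (view_after A E val \<omega> T v) = Some y \<longrightarrow> correct y)}"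

text \<open>
  With messages of at most \<open>B * log 2 n\<close> bits, \<open>A\<close> succeeds within \<open>T\<close> rounds with probability at
  least \<open>q\<close> on every connected \<open>n\<close>-node graph of diameter \<open>D\<close> and every value assignment.
\<close>

definition congest_solves ::
  "real \<Rightarrow> real \<Rightarrow> nat \<Rightarrow> nat \<Rightarrow> nat \<Rightarrow> (vals \<Rightarrow> real \<Rightarrow> bool) \<Rightarrow> nat \<Rightarrow> congest_alg \<Rightarrow> bool" where
  "congest_solves B q n N D correct T A \<longleftrightarrow>
     bandwidth_le A (B * log 2 (real n)) \<and>
     (\<forall>E val. simple_graph n E \<and> connected_graph n E \<and> diameter n E = D \<and> valid_vals n N val \<longrightarrow>
        success_prob A n E val T (correct val) \<ge> q)"

definition approx_moment :: "real \<Rightarrow> real \<Rightarrow> nat \<Rightarrow> nat \<Rightarrow> vals \<Rightarrow> real \<Rightarrow> bool" where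
  "approx_moment p \<epsilon> n N val y \<longleftrightarrow>
     (1 - \<epsilon>) * moment p n N val \<le> y \<and> y \<le> (1 + \<epsilon>) * moment p n N val"

definition exact_moment :: "real \<Rightarrow> nat \<Rightarrow> nat \<Rightarrow> vals \<Rightarrow> real \<Rightarrow> bool" where
  "exact_moment p n N val y \<longleftrightarrow> y = moment p n N val"

section \<open>Two-party communication and Gap-Hamming-Distance\<close>

text \<open>
  Deterministic protocol trees: at an inner node its owner announces one bit computed from the
  owner's input. The cost is the depth. A randomized (public-coin) protocol is a distribution over
  deterministic ones; no bound is placed on the number of alternations.
\<close>

datatype ('x, 'y) protocol =
    Answer bool
  | Alice "'x \<Rightarrow> bool" "('x, 'y) protocol" "('x, 'y) protocol"
  | Bob "'y \<Rightarrow> bool" "('x, 'y) protocol" "('x, 'y) protocol"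

fun run :: "('x, 'y) protocol \<Rightarrow> 'x \<Rightarrow> 'y \<Rightarrow> bool" where
  "run (Answer b) x y = b"
| "run (Alice f P Q) x y = (if f x then run P x y else run Q x y)"
| "run (Bob g P Q) x y = (if g y then run P x y else run Q x y)"

fun cost :: "('x, 'y) protocol \<Rightarrow> nat" where
  "cost (Answer b) = 0"
| "cost (Alice f P Q) = Suc (max (cost P) (cost Q))"
| "cost (Bob g P Q) = Suc (max (cost P) (cost Q))"

definition hamming :: "bool list \<Rightarrow> bool list \<Rightarrow> nat" where
  "hamming x y = card {i. i < length x \<and> x ! i \<noteq> y ! i}"

definition solves_GHD :: "real \<Rightarrow> nat \<Rightarrow> (bool list, bool list) protocol pmf \<Rightarrow> bool" where
  "solves_GHD q N R \<longleftrightarrow>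
     (\<forall>x y. length x = N \<and> length y = N \<longrightarrow>
        (real (hamming x y) \<ge> real N / 2 + sqrt (real N) \<longrightarrow>
           measure_pmf.prob R {P. run P x y} \<ge> q) \<and>
        (real (hamming x y) \<le> real N / 2 - sqrt (real N) \<longrightarrow>
           measure_pmf.prob R {P. \<not> run P x y} \<ge> q))"

definition Brody_Chakrabarti :: bool where
  "Brody_Chakrabarti \<longleftrightarrow>
     (\<exists>q<1. \<exists>c>0. \<exists>N\<^sub>0. \<forall>N\<ge>N\<^sub>0. \<forall>R k.
        solves_GHD q N R \<and> (\<forall>P\<in>set_pmf R. cost P \<le> k) \<longrightarrow> real k \<ge> c * real N)"

end

theory Submission
  imports Defs "HOL-Combinatorics.Permutations" "HOL-Probability.Hoeffding"
begin

text \<open>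
  The term \<open>D\<close>: on a graph of diameter \<open>D > 2T\<close> no node is within distance \<open>T\<close> of both ends, so an
  algorithm cannot tell the all-NULL input from one with a single value at the far end.

  The GHD bound: split a double broom at its middle edge. Two parties simulate the halves,
  exchanging only the messages on that edge. Node \<open>i\<close> of either half holds \<open>2i + x\<^sub>i + 1\<close>, which makes
  \<open>F\<^sub>p = 2\<^sup>p (M - h) + 2h\<close> for the Hamming distance \<open>h\<close>.

  The unconditional bounds: \<open>t\<close> players hold sets that are disjoint except possibly for one element
  common to all. Under private coins transcript probabilities factorise over the players, so
  square roots of transcript distributions satisfy a cut-and-paste identity, and Jayram's Hellinger
  argument shows that the transcript of a correct protocol must reveal, for each coordinate, an
  amount of order \<open>1/t\<close> about a random owner's bit. Summing over the \<open>M\<close> coordinates with the level-one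
  inequality (in place of Shannon information) gives a total communication of order \<open>M/t\<close>.
  For \<open>p > 2\<close> the players are the \<open>t \<approx> M\<^bsup>1/p\<^esup>\<close> branches of a star, so one link carries \<open>M/t\<^sup>2\<close> bits;
  assigning the coordinates randomly lets every branch get by with \<open>O(M/t)\<close> nodes.
  For exact computation \<open>t = 2\<close>.
\<close>

section \<open>Hellinger distances and disjoint unions\<close>

text \<open>Information is measured on disjoint inputs only; intersecting inputs enter through
  correctness and through cut and paste. The owner map \<open>z\<close> is fixed before the bits are
  drawn, because only then are the players' sets independent and the averaged transcript
  probabilities still products. One node per coordinate for each of \<open>N powr (1 / p)\<close>
  players would take \<open>N powr (1 + 1 / p)\<close> nodes, which is the origin of the exponent
  \<open>1 + 1 / p\<close>. With short blocks \<open>n\<close> need only be of the order of the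
  number \<open>M\<close> of coordinates, and the term in \<open>n\<close> follows because in its
  regime \<open>n powr (1 / (1 + 1 / p))\<close> is at most of order \<open>N\<close>. An instance
  with \<open>M\<close> coordinates needs of the order of \<open>M\<close> nodes and
  \<open>M\<close> values. The parameter \<open>\<kappa>\<close> states, up to constants, when an
  instance of the size named by a bound fits. The diameter bound has a second use: with
  \<open>3 \<le> D\<close> it gives \<open>1 \<le> T\<close>, so that roundings, answer bits and
  other additive constants are absorbed by \<open>log 2 n * T\<close>.\<close>

definition sqdist :: "'a set \<Rightarrow> ('a \<Rightarrow> real) \<Rightarrow> ('a \<Rightarrow> real) \<Rightarrow> real" where
  "sqdist \<Omega> f g = (\<Sum>\<pi>\<in>\<Omega>. (f \<pi> - g \<pi>)\<^sup>2)"

lemma sum_pairwise_sq_diff_le: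
  fixes a :: "nat \<Rightarrow> real"
  shows "(\<Sum>i<m. \<Sum>j<m. (a i - a j)\<^sup>2) \<le> 2 * real m * (\<Sum>i<m. (a i)\<^sup>2)"
proof -
  have "(\<Sum>i<m. \<Sum>j<m. (a i - a j)\<^sup>2) = (\<Sum>i<m. \<Sum>j<m. (a i)\<^sup>2 + (a j)\<^sup>2 - 2 * (a i * a j))"
    by (simp add: power2_diff algebra_simps)
  also have "\<dots> = 2 * real m * (\<Sum>i<m. (a i)\<^sup>2) - 2 * (\<Sum>i<m. a i)\<^sup>2"
    by (simp add: sum.distrib sum_subtractf power2_eq_square sum_product sum_distrib_left algebra_simps)
  finally show ?thesis by simp
qed

text \<open>The pairwise sum is \<open>2 * m\<close> times the scatter about the mean, which is at
  most the scatter about any centre \<open>u\<close>. Bounding each pair by the triangle inequality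
  would cost a factor 4 per doubling in Jayram's argument, hence \<open>t^2\<close> where only
  \<open>t\<close> can be afforded.\<close>

lemma sum_pairwise_sqdist_le:
  "(\<Sum>i<m. \<Sum>j<m. sqdist \<Omega> (v i) (v j)) \<le> 2 * real m * (\<Sum>i<m. sqdist \<Omega> u (v i))"
proof -
  have "(\<Sum>i<m. \<Sum>j<m. sqdist \<Omega> (v i) (v j)) = (\<Sum>i<m. \<Sum>\<pi>\<in>\<Omega>. \<Sum>j<m. (v i \<pi> - v j \<pi>)\<^sup>2)"
    unfolding sqdist_def by (intro sum.cong refl sum.swap)
  also have "\<dots> = (\<Sum>\<pi>\<in>\<Omega>. \<Sum>i<m. \<Sum>j<m. (v i \<pi> - v j \<pi>)\<^sup>2)"
    by (rule sum.swap)
  also have "\<dots> \<le> (\<Sum>\<pi>\<in>\<Omega>. 2 * real m * (\<Sum>i<m. (u \<pi> - v i \<pi>)\<^sup>2))"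
  proof (rule sum_mono)
    fix \<pi>
    show "(\<Sum>i<m. \<Sum>j<m. (v i \<pi> - v j \<pi>)\<^sup>2) \<le> 2 * real m * (\<Sum>i<m. (u \<pi> - v i \<pi>)\<^sup>2)"
      using sum_pairwise_sq_diff_le[where a = "\<lambda>i. v i \<pi> - u \<pi>" and m = m]
      by (simp add: power2_commute)
  qed
  also have "\<dots> = 2 * real m * (\<Sum>i<m. sqdist \<Omega> u (v i))"
    unfolding sqdist_def sum_distrib_left[symmetric] by (simp add: sum.swap[of _ \<Omega>])
  finally show ?thesis .
qed

lemma ex_permutes_image:
  assumes "finite T" "A \<subseteq> T" "B \<subseteq> T" "card A = card B"
  obtains \<tau> where "\<tau> permutes T" "\<tau> ` A = B"
proof -
  have fin: "finite A" "finite B" using assms finite_subset by auto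
  obtain f where f: "bij_betw f A B"
    using finite_same_card_bij[OF fin assms(4)] by blast
  have "card (T - A) = card (T - B)"
    using assms fin by (simp add: card_Diff_subset)
  then obtain g where g: "bij_betw g (T - A) (T - B)"
    using finite_same_card_bij[of "T - A" "T - B"] assms(1) by blast
  define \<tau> where "\<tau> x = (if x \<in> A then f x else if x \<in> T then g x else x)" for x
  have 1: "bij_betw \<tau> A B"
    using f by (simp add: \<tau>_def cong: bij_betw_cong)
  have "bij_betw \<tau> (T - A) (T - B)"
    using g by (rule bij_betw_cong[THEN iffD1, rotated]) (auto simp: \<tau>_def)
  with 1 have "bij_betw \<tau> (A \<union> (T - A)) (B \<union> (T - B))"
    by (rule bij_betw_combine) blast
  then have "bij_betw \<tau> T T"
    using assms(2,3) by (simp add: Un_absorb1)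
  then have "\<tau> permutes T"
    by (rule bij_imp_permutes) (use assms in \<open>auto simp: \<tau>_def\<close>)
  moreover have "\<tau> ` A = B" using 1 by (simp add: bij_betw_def)
  ultimately show ?thesis by (rule that)
qed

text \<open>The symmetric group is transitive on the subsets of a given size, so a sum over all
  relabellings of the players depends on the size alone.\<close>

lemma sum_permutes_image:
  fixes g :: "nat set \<Rightarrow> real"
  assumes "finite T" "A \<subseteq> T" "B \<subseteq> T" "card A = card B"
  shows "(\<Sum>\<sigma> | \<sigma> permutes T. g (\<sigma> ` A)) = (\<Sum>\<sigma> | \<sigma> permutes T. g (\<sigma> ` B))"
proof -
  obtain \<tau> where \<tau>: "\<tau> permutes T" "\<tau> ` A = B"
    using ex_permutes_image[OF assms] .
  have "(\<Sum>\<sigma> | \<sigma> permutes T. g (\<sigma> ` B)) = (\<Sum>\<sigma> | \<sigma> permutes T. g ((\<sigma> \<circ> \<tau>) ` A))"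
    by (simp only: image_comp[symmetric] \<tau>)
  also have "\<dots> = (\<Sum>\<sigma> | \<sigma> permutes T. g (\<sigma> ` A))"
    using sum_permutations_compose_right[OF \<tau>(1), of "\<lambda>\<sigma>. g (\<sigma> ` A)"] by simp
  finally show ?thesis by simp
qed

text \<open>
  Jayram's inequality. Cutting and pasting gives \<open>sqdist (v A) (v B) = sqdist (v {}) (v (A \<union> B))\<close>
  for disjoint \<open>A\<close>, \<open>B\<close>; averaging the pairwise distances of \<open>m\<close> random disjoint \<open>s\<close>-sets then
  costs only a factor \<open>2m / (m - 1)\<close> in passing from size \<open>s\<close> to size \<open>2s\<close>.
\<close>

lemma hellinger_sq_le_sum_singletons:
  fixes v :: "nat set \<Rightarrow> 'a \<Rightarrow> real"
  assumes t: "t = 2 ^ k"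
    and unit: "\<And>A. A \<subseteq> {..<t} \<Longrightarrow> (\<Sum>\<pi>\<in>\<Omega>. (v A \<pi>)\<^sup>2) = 1"
    and cut: "\<And>A B \<pi>. A \<subseteq> {..<t} \<Longrightarrow> B \<subseteq> {..<t} \<Longrightarrow> A \<inter> B = {} \<Longrightarrow> \<pi> \<in> \<Omega> \<Longrightarrow>
               v A \<pi> * v B \<pi> = v {} \<pi> * v (A \<union> B) \<pi>"
  shows "sqdist \<Omega> (v {}) (v {..<t}) \<le> 4 * (\<Sum>j<t. sqdist \<Omega> (v {}) (v {j}))"
proof -
  define g where "g A = sqdist \<Omega> (v {}) (v A)" for A
  define \<Gamma> where "\<Gamma> s = (\<Sum>\<sigma> | \<sigma> permutes {..<t}. g (\<sigma> ` {..<s}))" for s :: nat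
  have g0: "g A \<ge> 0" for A by (simp add: g_def sqdist_def sum_nonneg)
  have \<Gamma>0: "\<Gamma> s \<ge> 0" for s by (simp add: \<Gamma>_def sum_nonneg g0)
  have dist: "sqdist \<Omega> (v A) (v B) = 2 - 2 * (\<Sum>\<pi>\<in>\<Omega>. v A \<pi> * v B \<pi>)"
    if "A \<subseteq> {..<t}" "B \<subseteq> {..<t}" for A B
    using unit[OF that(1)] unit[OF that(2)]
    by (simp add: sqdist_def power2_diff sum.distrib sum_subtractf sum_distrib_left mult.assoc)
  have paste: "sqdist \<Omega> (v A) (v B) = g (A \<union> B)"
    if "A \<subseteq> {..<t}" "B \<subseteq> {..<t}" "A \<inter> B = {}" for A B
  proof -
    have "(\<Sum>\<pi>\<in>\<Omega>. v A \<pi> * v B \<pi>) = (\<Sum>\<pi>\<in>\<Omega>. v {} \<pi> * v (A \<union> B) \<pi>)"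
      using that by (intro sum.cong refl cut)
    then show ?thesis using that by (simp only: g_def dist[of A B] dist[of "{}" "A \<union> B"] Un_least empty_subsetI)
  qed
  have step: "(real m - 1) * \<Gamma> (2 * s) \<le> 2 * real m * \<Gamma> s" if ms: "m * s = t" for m s
  proof -
    \<comment> \<open>A fixed family of \<open>m\<close> disjoint sets of size \<open>s\<close>; the
      sum over permutations makes it a random one.\<close>
    define blk where "blk i = {i * s..<Suc i * s}" for i
    have blk_sub: "blk i \<subseteq> {..<t}" if "i < m" for i
    proof -
      have "Suc i * s \<le> m * s" using that by (intro mult_le_mono1) simp
      then show ?thesis unfolding blk_def ms by auto
    qed
    have blk_disj: "blk i \<inter> blk j = {}" if "i \<noteq> j" for i j
    proof -
      have "Suc i * s \<le> j * s \<or> Suc j * s \<le> i * s"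
        using that by (metis Suc_leI linorder_neqE_nat mult_le_mono1)
      then show ?thesis by (auto simp: blk_def)
    qed
    have card_blk: "card (blk i) = s" for i by (simp add: blk_def)
    have sum1: "(\<Sum>\<sigma> | \<sigma> permutes {..<t}. g (\<sigma> ` blk i)) = \<Gamma> s" if "i < m" for i
    proof -
      have "s \<le> t" using that ms by (cases m) auto
      then show ?thesis unfolding \<Gamma>_def
        by (intro sum_permutes_image) (use that blk_sub card_blk in auto)
    qed
    have sum2: "(\<Sum>\<sigma> | \<sigma> permutes {..<t}. g (\<sigma> ` (blk i \<union> blk j))) = \<Gamma> (2 * s)"
      if "i < m" "j < m" "i \<noteq> j" for i j
    proof -
      have "2 \<le> m" using that by auto
      then have "2 * s \<le> t" using ms by (metis mult_le_mono1)
      moreover have "card (blk i \<union> blk j) = 2 * s"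
        using blk_disj[OF that(3)] by (subst card_Un_disjoint) (auto simp: card_blk, auto simp: blk_def)
      ultimately show ?thesis unfolding \<Gamma>_def
        by (intro sum_permutes_image) (use that blk_sub in auto)
    qed
    have "(\<Sum>i<m. \<Sum>j<m. if i = j then 0 else g (\<sigma> ` (blk i \<union> blk j)))
        \<le> 2 * real m * (\<Sum>i<m. g (\<sigma> ` blk i))" if \<sigma>: "\<sigma> permutes {..<t}" for \<sigma>
    proof -
      have sub: "\<sigma> ` blk i \<subseteq> {..<t}" if "i < m" for i
        using blk_sub[OF that] permutes_image[OF \<sigma>] by blast
      have "\<sigma> ` blk i \<inter> \<sigma> ` blk j = {}" if "i \<noteq> j" for i j
        using blk_disj[OF that] permutes_inj[OF \<sigma>] by (metis image_Int image_empty)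
      then have "(\<Sum>i<m. \<Sum>j<m. if i = j then 0 else g (\<sigma> ` (blk i \<union> blk j)))
          = (\<Sum>i<m. \<Sum>j<m. sqdist \<Omega> (v (\<sigma> ` blk i)) (v (\<sigma> ` blk j)))"
        by (intro sum.cong refl) (auto simp: paste sub image_Un, simp add: sqdist_def)
      also have "\<dots> \<le> 2 * real m * (\<Sum>i<m. g (\<sigma> ` blk i))"
        unfolding g_def by (rule sum_pairwise_sqdist_le)
      finally show ?thesis .
    qed
    then have "(\<Sum>\<sigma> | \<sigma> permutes {..<t}. \<Sum>i<m. \<Sum>j<m. if i = j then 0 else g (\<sigma> ` (blk i \<union> blk j)))
        \<le> (\<Sum>\<sigma> | \<sigma> permutes {..<t}. 2 * real m * (\<Sum>i<m. g (\<sigma> ` blk i)))"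
      by (intro sum_mono) auto
    also have "\<dots> = 2 * real m * (\<Sum>i<m. \<Gamma> s)"
      unfolding sum_distrib_left[symmetric]
      by (subst sum.swap) (simp add: sum1)
    finally have le: "(\<Sum>\<sigma> | \<sigma> permutes {..<t}. \<Sum>i<m. \<Sum>j<m. if i = j then 0 else g (\<sigma> ` (blk i \<union> blk j)))
        \<le> real m * (2 * real m * \<Gamma> s)" by simp
    have "(\<Sum>\<sigma> | \<sigma> permutes {..<t}. \<Sum>i<m. \<Sum>j<m. if i = j then 0 else g (\<sigma> ` (blk i \<union> blk j)))
       = (\<Sum>i<m. \<Sum>\<sigma> | \<sigma> permutes {..<t}. \<Sum>j<m. if i = j then 0 else g (\<sigma> ` (blk i \<union> blk j)))"
      by (rule sum.swap)
    also have "\<dots> = (\<Sum>i<m. \<Sum>j<m. \<Sum>\<sigma> | \<sigma> permutes {..<t}. if i = j then 0 else g (\<sigma> ` (blk i \<union> blk j)))"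
      by (intro sum.cong refl sum.swap)
    also have "\<dots> = (\<Sum>i<m. \<Sum>j<m. if i = j then 0 else \<Gamma> (2 * s))"
      by (intro sum.cong refl) (simp add: sum2)
    also have "\<dots> = (\<Sum>i<m. \<Sum>j<m. \<Gamma> (2 * s) - (if i = j then \<Gamma> (2 * s) else 0))"
      by (intro sum.cong refl) simp
    also have "\<dots> = real m * ((real m - 1) * \<Gamma> (2 * s))"
      by (simp add: sum_subtractf algebra_simps)
    finally have "real m * ((real m - 1) * \<Gamma> (2 * s)) \<le> real m * (2 * real m * \<Gamma> s)"
      using le by simp
    moreover have "m > 0" using ms t by (cases m) auto
    ultimately show ?thesis by simp
  qed
  \<comment> \<open>A lower bound for the product of \<open>1 - 1 / 2 ^ i\<close> over
    \<open>1 \<le> i \<le> l\<close>, whose factors are the \<open>(m - 1) / m\<close> of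
    \<open>step\<close> with \<open>m = 2 ^ i\<close>. It stays above 1/4, hence the final factor 4.
    At 0 the exact value 1 is taken: the formula would give 3/4, and the first step would
    fail.\<close>
  define c where "c l = (if l = 0 then 1 else 1 / 4 + 1 / 2 ^ Suc l :: real)" for l :: nat
  have c_Suc: "c (Suc l) \<le> (1 - 1 / 2 ^ Suc l) * c l" for l
  proof (cases l)
    case (Suc l')
    define x :: real where "x = 1 / 2 ^ Suc l"
    have x: "0 < x" "x \<le> 1 / 4"
      by (simp_all add: x_def Suc field_simps)
    have "x * x \<le> x * (1 / 4)" using x by (intro mult_left_mono) auto
    then have "1 / 4 + x / 2 \<le> (1 - x) * (1 / 4 + x)" by (simp add: field_simps)
    then show ?thesis by (simp add: c_def x_def Suc)
  qed (simp add: c_def)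
  have main: "c l * \<Gamma> (2 ^ k) \<le> 2 ^ l * \<Gamma> (2 ^ (k - l))" if "l \<le> k" for l
    using that
  proof (induction l)
    case (Suc l)
    define s :: nat where "s = 2 ^ (k - Suc l)"
    have s2: "2 ^ (k - l) = 2 * s"
      using Suc.prems by (simp add: s_def Suc_diff_le flip: power_Suc)
    have "2 ^ Suc l * s = t" using Suc.prems by (simp only: s_def t flip: power_add) simp
    from step[OF this] have st: "(1 - 1 / 2 ^ Suc l) * \<Gamma> (2 * s) \<le> 2 * \<Gamma> s"
      by (simp add: field_simps)
    have "c (Suc l) * \<Gamma> (2 ^ k) \<le> (1 - 1 / 2 ^ Suc l) * (c l * \<Gamma> (2 ^ k))"
      using mult_right_mono[OF c_Suc \<Gamma>0] by (simp add: mult.assoc)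
    also have "\<dots> \<le> (1 - 1 / 2 ^ Suc l) * (2 ^ l * \<Gamma> (2 * s))"
    proof (rule mult_left_mono)
      show "0 \<le> 1 - 1 / (2 :: real) ^ Suc l"
        using one_le_power[of "2 :: real" "Suc l"] by (simp only: le_diff_eq divide_le_eq) simp
    qed (use Suc s2 in simp)
    also have "\<dots> \<le> 2 ^ l * (2 * \<Gamma> s)"
      using mult_left_mono[OF st, of "2 ^ l"] by (simp add: algebra_simps)
    finally show ?case by (simp add: s_def)
  qed (simp add: c_def)
  have "1 / 4 \<le> c k" by (simp add: c_def)
  then have "1 / 4 * \<Gamma> t \<le> c k * \<Gamma> t" using \<Gamma>0 by (rule mult_right_mono)
  also have "\<dots> \<le> real t * \<Gamma> 1"
    using main[of k] t by simp
  also have "\<dots> = (\<Sum>j<t. \<Sum>\<sigma> | \<sigma> permutes {..<t}. g (\<sigma> ` {j}))"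
  proof -
    have "(\<Sum>\<sigma> | \<sigma> permutes {..<t}. g (\<sigma> ` {j})) = \<Gamma> 1" if "j < t" for j
      unfolding \<Gamma>_def by (intro sum_permutes_image) (use that in auto)
    then show ?thesis by simp
  qed
  also have "\<dots> = (\<Sum>\<sigma> | \<sigma> permutes {..<t}. \<Sum>j<t. g {\<sigma> j})"
    by (subst sum.swap) simp
  also have "\<dots> = (\<Sum>\<sigma> | \<sigma> permutes {..<t}. \<Sum>j<t. g {j})"
  proof (rule sum.cong[OF refl])
    fix \<sigma> assume "\<sigma> \<in> {\<sigma>. \<sigma> permutes {..<t}}"
    then have "\<sigma> permutes {..<t}" by simp
    from sum.permute[OF this, of "\<lambda>j. g {j}"]
    show "(\<Sum>j<t. g {\<sigma> j}) = (\<Sum>j<t. g {j})" by (simp add: o_def)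
  qed
  finally have "1 / 4 * \<Gamma> t \<le> fact t * (\<Sum>j<t. g {j})"
    by (simp add: card_permutations)
  moreover have "\<Gamma> t = fact t * g {..<t}"
    by (simp add: \<Gamma>_def permutes_image card_permutations)
  ultimately have "fact t * (1 / 4 * g {..<t}) \<le> fact t * (\<Sum>j<t. g {j})"
    by (simp add: algebra_simps)
  then have "1 / 4 * g {..<t} \<le> (\<Sum>j<t. g {j})"
    by (simp add: mult_le_cancel_left_pos del: times_divide_eq_left)
  then show ?thesis by (simp add: g_def)
qed

section \<open>Promise disjointness with factorising transcripts\<close>

lemma expectation_pair_pmf_mult:
  fixes f :: "'a \<Rightarrow> real" and g :: "'b \<Rightarrow> real"
  assumes f: "\<And>x. 0 \<le> f x" "\<And>x. f x \<le> 1" and g: "\<And>x. 0 \<le> g x" "\<And>x. g x \<le> 1"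
  shows "measure_pmf.expectation (pair_pmf p q) (\<lambda>(x, y). f x * g y)
       = measure_pmf.expectation p f * measure_pmf.expectation q g"
proof -
  \<comment> \<open>Seed distributions may have infinite support, so integrability has to come from
    boundedness.\<close>
  have intf: "integrable (measure_pmf p) f"
    by (rule measure_pmf.integrable_const_bound[where B = 1]) (auto simp: f)
  have intg: "integrable (measure_pmf q) g"
    by (rule measure_pmf.integrable_const_bound[where B = 1]) (auto simp: g)
  have "f a * g b \<le> 1 * 1" for a b by (rule mult_mono) (auto simp: f g)
  then have int: "integrable (measure_pmf (pair_pmf p q)) (\<lambda>(x, y). f x * g y)"
    by (intro measure_pmf.integrable_const_bound[where B = 1]) (auto simp: f g)
  have "ennreal (measure_pmf.expectation (pair_pmf p q) (\<lambda>(x, y). f x * g y))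
      = (\<integral>\<^sup>+x. ennreal (case x of (a, b) \<Rightarrow> f a * g b) \<partial>pair_pmf p q)"
    by (rule nn_integral_eq_integral[symmetric]) (auto simp: int f g)
  also have "\<dots> = (\<integral>\<^sup>+a. \<integral>\<^sup>+b. ennreal (f a) * ennreal (g b) \<partial>q \<partial>p)"
    by (simp add: nn_integral_pair_pmf' ennreal_mult f g)
  also have "\<dots> = (\<integral>\<^sup>+a. ennreal (f a) \<partial>p) * (\<integral>\<^sup>+b. ennreal (g b) \<partial>q)"
    by (simp add: nn_integral_cmult nn_integral_multc)
  also have "\<dots> = ennreal (measure_pmf.expectation p f * measure_pmf.expectation q g)"
    by (simp add: nn_integral_eq_integral intf intg f g ennreal_mult)
  finally show ?thesis
    by (simp add: f g integral_nonneg_AE split: prod.splits)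
qed

lemma expectation_Pi_pmf_mult:
  fixes \<phi> \<psi> :: "('i \<Rightarrow> 'b) \<Rightarrow> real"
  assumes fin: "finite I" and sub: "A \<subseteq> I"
    and \<phi>: "\<And>x. 0 \<le> \<phi> x" "\<And>x. \<phi> x \<le> 1" and \<psi>: "\<And>x. 0 \<le> \<psi> x" "\<And>x. \<psi> x \<le> 1"
    and dep\<phi>: "\<And>x y. (\<And>i. i \<in> A \<Longrightarrow> x i = y i) \<Longrightarrow> \<phi> x = \<phi> y"
    and dep\<psi>: "\<And>x y. (\<And>i. i \<in> I - A \<Longrightarrow> x i = y i) \<Longrightarrow> \<psi> x = \<psi> y"
  shows "measure_pmf.expectation (Pi_pmf I d p) (\<lambda>x. \<phi> x * \<psi> x)
       = measure_pmf.expectation (Pi_pmf I d p) \<phi> * measure_pmf.expectation (Pi_pmf I d p) \<psi>"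
proof -
  let ?A = "Pi_pmf A d p" and ?B = "Pi_pmf (I - A) d p"
  define mrg where "mrg = (\<lambda>(f :: 'i \<Rightarrow> 'b, g) x. if x \<in> A then f x else g x)"
  have eq: "Pi_pmf I d p = map_pmf mrg (pair_pmf ?A ?B)"
    using Pi_pmf_union[of A "I - A" d p] fin sub finite_subset[OF sub fin]
    by (simp add: Un_absorb1 mrg_def)
  have m\<phi>: "\<phi> (mrg u) = \<phi> (fst u)" for u
    by (rule dep\<phi>) (auto simp: mrg_def split: prod.splits)
  have m\<psi>: "\<psi> (mrg u) = \<psi> (snd u)" for u
    by (rule dep\<psi>) (auto simp: mrg_def split: prod.splits)
  have "measure_pmf.expectation (Pi_pmf I d p) (\<lambda>x. \<phi> x * \<psi> x)
      = measure_pmf.expectation (pair_pmf ?A ?B) (\<lambda>(x, y). \<phi> x * \<psi> y)"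
    by (simp add: eq m\<phi> m\<psi> case_prod_unfold)
  also have "\<dots> = measure_pmf.expectation ?A \<phi> * measure_pmf.expectation ?B \<psi>"
    by (rule expectation_pair_pmf_mult) (auto simp: \<phi> \<psi>)
  also have "\<dots> = measure_pmf.expectation (Pi_pmf I d p) \<phi> * measure_pmf.expectation (Pi_pmf I d p) \<psi>"
    by (simp add: eq m\<phi> m\<psi>)
  finally show ?thesis .
qed

text \<open>Applied twice: to the random bits, grouped by their owner \<open>z\<close>, and to the
  seeds of the nodes, grouped by player.\<close>

lemma expectation_Pi_pmf_prod_blocks:
  fixes \<phi> :: "'j \<Rightarrow> ('i \<Rightarrow> 'b) \<Rightarrow> real"
  assumes fin: "finite I" and finJ: "finite J"
    and \<phi>: "\<And>j x. 0 \<le> \<phi> j x" "\<And>j x. \<phi> j x \<le> 1"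
    and dep: "\<And>j x y. j \<in> J \<Longrightarrow> (\<And>i. i \<in> I \<Longrightarrow> cls i = j \<Longrightarrow> x i = y i) \<Longrightarrow> \<phi> j x = \<phi> j y"
  shows "measure_pmf.expectation (Pi_pmf I d p) (\<lambda>x. \<Prod>j\<in>J. \<phi> j x)
       = (\<Prod>j\<in>J. measure_pmf.expectation (Pi_pmf I d p) (\<phi> j))"
  using finJ dep
proof (induction J rule: finite_induct)
  case (insert j J)
  have "measure_pmf.expectation (Pi_pmf I d p) (\<lambda>x. \<phi> j x * (\<Prod>j\<in>J. \<phi> j x))
      = measure_pmf.expectation (Pi_pmf I d p) (\<phi> j)
        * measure_pmf.expectation (Pi_pmf I d p) (\<lambda>x. \<Prod>j\<in>J. \<phi> j x)"
  proof (rule expectation_Pi_pmf_mult[where A = "{i \<in> I. cls i = j}"])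
    show "\<phi> j x = \<phi> j y" if "\<And>i. i \<in> {i \<in> I. cls i = j} \<Longrightarrow> x i = y i" for x y
      using that by (intro insert.prems) auto
    show "(\<Prod>j\<in>J. \<phi> j x) = (\<Prod>j\<in>J. \<phi> j y)"
      if *: "\<And>i. i \<in> I - {i \<in> I. cls i = j} \<Longrightarrow> x i = y i" for x y
    proof (rule prod.cong[OF refl])
      fix j' assume "j' \<in> J"
      then show "\<phi> j' x = \<phi> j' y"
        using insert.hyps by (intro insert.prems) (auto intro!: *)
    qed
  qed (auto simp: fin \<phi> prod_nonneg intro!: prod_le_1)
  moreover have "measure_pmf.expectation (Pi_pmf I d p) (\<lambda>x. \<Prod>j\<in>J. \<phi> j x)
      = (\<Prod>j\<in>J. measure_pmf.expectation (Pi_pmf I d p) (\<phi> j))"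
    by (rule insert.IH) (rule insert.prems, auto)
  ultimately show ?case using insert.hyps by simp
qed simp

text \<open>Drawing coordinate \<open>i\<close> afresh does not change the distribution. This brings
  the average over the two values of a bit, or over all possible owners of a coordinate, under the
  expectation.\<close>

lemma expectation_Pi_pmf_resample:
  fixes F :: "('i \<Rightarrow> 'b) \<Rightarrow> real"
  assumes fin: "finite I" "i \<in> I" "finite S" "S \<noteq> {}" "\<And>i. finite (set_pmf (p i))"
    and p: "p i = pmf_of_set S"
  shows "measure_pmf.expectation (Pi_pmf I d p) F
       = measure_pmf.expectation (Pi_pmf I d p) (\<lambda>x. (\<Sum>b\<in>S. F (x(i := b))) / real (card S))"
proof -
  define J where "J = I - {i}"
  have I: "I = insert i J" "finite J" "i \<notin> J" using fin by (auto simp: J_def)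
  have fins: "finite (set_pmf (Pi_pmf J d p))"
    using I(2) fin(5) by (simp add: set_Pi_pmf finite_PiE_dflt)
  have *: "measure_pmf.expectation (Pi_pmf I d p) G
      = (\<Sum>b\<in>S. measure_pmf.expectation (Pi_pmf J d p) (\<lambda>f. G (f(i := b)))) / real (card S)"
    for G :: "('i \<Rightarrow> 'b) \<Rightarrow> real"
    unfolding I(1) Pi_pmf_insert'[OF I(2,3)] p
    by (subst pmf_expectation_bind_pmf_of_set)
       (use fin fins in \<open>simp_all add: map_pmf_def[symmetric] sum_divide_distrib divide_inverse mult.commute sum_distrib_left\<close>)
  have "measure_pmf.expectation (Pi_pmf J d p) (\<lambda>f. \<Sum>b\<in>S. F (f(i := b)))
      = (\<Sum>b\<in>S. measure_pmf.expectation (Pi_pmf J d p) (\<lambda>f. F (f(i := b))))"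
    using fins by (intro Bochner_Integration.integral_sum integrable_measure_pmf_finite)
  then show ?thesis
    using fin by (subst (1 2) *) (simp add: card_gt_0_iff)
qed

section \<open>What a transcript can reveal about uniform bits\<close>

lemma cosh_le_exp_half_sq: "cosh x \<le> exp (x\<^sup>2 / 2)" for x :: real
proof -
  have *: "cosh x \<le> exp (x\<^sup>2 / 2)" if "x \<ge> 0" for x :: real
  proof -
    have pos: "0 < 1 + (exp (2 * x) - 1) / 2" by (simp add: add_pos_pos field_simps)
    \<comment> \<open>Hoeffding's lemma for a fair two-point variable of range \<open>2 * x\<close>;
      the left side is \<open>ln (cosh x)\<close>.\<close>
    have "- (2 * x) * (1 / 2) + ln (1 + (1 / 2) * (exp (2 * x) - 1)) \<le> (2 * x)\<^sup>2 / 8"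
      by (rule Hoeffdings_lemma_aux) (use that in auto)
    then have "ln (1 + (exp (2 * x) - 1) / 2) \<le> x + x\<^sup>2 / 2" by (simp add: power2_eq_square)
    then have "1 + (exp (2 * x) - 1) / 2 \<le> exp x * exp (x\<^sup>2 / 2)"
      using pos by (metis exp_le_cancel_iff exp_ln exp_add)
    moreover have "1 + (exp (2 * x) - 1) / 2 = (1 + exp (2 * x)) / 2" by (simp add: field_simps)
    ultimately have "exp (- x) * ((1 + exp (2 * x)) / 2) \<le> exp (- x) * (exp x * exp (x\<^sup>2 / 2))"
      by (intro mult_left_mono) auto
    moreover have "exp (- x) * ((1 + exp (2 * x)) / 2) = cosh x"
      by (simp add: cosh_def field_simps flip: exp_add)
    ultimately show ?thesis by (simp add: exp_minus field_simps)
  qed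
  show ?thesis using *[of x] *[of "- x"] by (cases "x \<ge> 0") auto
qed


definition unif_bits :: "nat \<Rightarrow> (nat \<Rightarrow> bool) pmf" where
  "unif_bits M = Pi_pmf {..<M} False (\<lambda>_. pmf_of_set UNIV)"

lemma finite_set_unif_bits [simp]: "finite (set_pmf (unif_bits M))"
  by (simp add: unif_bits_def set_Pi_pmf finite_PiE_dflt)

lemma integrable_unif_bits [simp]: "integrable (measure_pmf (unif_bits M)) (f :: _ \<Rightarrow> real)"
  by (rule integrable_measure_pmf_finite) simp

lemma expectation_unif_bits_resample:
  fixes F :: "(nat \<Rightarrow> bool) \<Rightarrow> real"
  assumes "i < M"
  shows "measure_pmf.expectation (unif_bits M) F
       = (measure_pmf.expectation (unif_bits M) (\<lambda>y. F (y(i := False)))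
          + measure_pmf.expectation (unif_bits M) (\<lambda>y. F (y(i := True)))) / 2"
proof -
  have "measure_pmf.expectation (unif_bits M) F
      = measure_pmf.expectation (unif_bits M) (\<lambda>y. (F (y(i := False)) + F (y(i := True))) / 2)"
    unfolding unif_bits_def using assms
    by (subst expectation_Pi_pmf_resample[where i = i and S = UNIV]) (auto simp: UNIV_bool add.commute)
  then show ?thesis by (simp add: Bochner_Integration.integral_add)
qed

lemma expectation_unif_bits_exp_le:
  fixes m :: "nat \<Rightarrow> real"
  shows "measure_pmf.expectation (unif_bits M) (\<lambda>y. exp (\<Sum>i<M. m i * (if y i then 1 else - 1)))
       \<le> exp ((\<Sum>i<M. (m i)\<^sup>2) / 2)"
proof -
  have "measure_pmf.expectation (unif_bits M) (\<lambda>y. exp (\<Sum>i<M. m i * (if y i then 1 else - 1)))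
      = measure_pmf.expectation (unif_bits M) (\<lambda>y. \<Prod>i<M. exp (m i * (if y i then 1 else - 1)))"
    by (simp add: exp_sum)
  also have "\<dots> = (\<Prod>i<M. measure_pmf.expectation (pmf_of_set UNIV) (\<lambda>b. exp (m i * (if b then 1 else - 1))))"
    unfolding unif_bits_def
    by (rule expectation_prod_Pi_pmf) (auto intro: integrable_measure_pmf_finite)
  also have "\<dots> = (\<Prod>i<M. cosh (m i))"
    by (intro prod.cong refl) (simp add: integral_pmf_of_set UNIV_bool cosh_def add.commute)
  also have "\<dots> \<le> (\<Prod>i<M. exp ((m i)\<^sup>2 / 2))"
    by (intro prod_mono) (auto simp: cosh_le_exp_half_sq less_imp_le[OF cosh_real_pos])
  finally show ?thesis by (simp add: exp_sum sum_divide_distrib)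
qed

text \<open>By convexity of the exponential under the tilted measure \<open>f / \<alpha>\<close>.\<close>

lemma level_one_inequality:
  fixes f :: "(nat \<Rightarrow> bool) \<Rightarrow> real"
  assumes f: "\<And>y. 0 \<le> f y" "\<And>y. f y \<le> 1"
    and \<alpha>: "\<alpha> = measure_pmf.expectation (unif_bits M) f" "\<alpha> > 0"
    and m: "\<And>i. \<alpha> * m i = measure_pmf.expectation (unif_bits M) (\<lambda>y. f y * (if y i then 1 else - 1))"
  shows "(\<Sum>i<M. (m i)\<^sup>2) \<le> 2 * ln (1 / \<alpha>)"
proof -
  define s where "s = (\<Sum>i<M. (m i)\<^sup>2)"
  define L where "L y = (\<Sum>i<M. m i * (if y i then 1 else - 1))" for y :: "nat \<Rightarrow> bool"
  have fL: "measure_pmf.expectation (unif_bits M) (\<lambda>y. f y * L y) = \<alpha> * s"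
  proof -
    have "measure_pmf.expectation (unif_bits M) (\<lambda>y. f y * L y)
        = measure_pmf.expectation (unif_bits M) (\<lambda>y. \<Sum>i<M. m i * (f y * (if y i then 1 else - 1)))"
      unfolding L_def by (simp add: sum_distrib_left mult.left_commute)
    also have "\<dots> = (\<Sum>i<M. m i * measure_pmf.expectation (unif_bits M) (\<lambda>y. f y * (if y i then 1 else - 1)))"
      by (subst Bochner_Integration.integral_sum) (simp_all)
    also have "\<dots> = \<alpha> * s"
      unfolding m[symmetric] by (simp add: s_def sum_distrib_left power2_eq_square mult.left_commute)
    finally show ?thesis .
  qed
  \<comment> \<open>The tangent of the exponential is taken at \<open>s\<close>, which is the mean
    of \<open>L\<close> under the density \<open>f / \<alpha>\<close>, so that its linear term
    integrates to 0. With the subgaussian bound this gives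
    \<open>exp s * \<alpha> \<le> exp (s / 2)\<close>.\<close>
  have "exp s * \<alpha> = measure_pmf.expectation (unif_bits M) (\<lambda>y. exp s * ((1 - s) * f y + f y * L y))"
    using fL \<alpha>(1) by (simp add: Bochner_Integration.integral_add) (simp add: algebra_simps)
  also have "\<dots> \<le> measure_pmf.expectation (unif_bits M) (\<lambda>y. exp (L y))"
  proof (rule integral_mono)
    fix y
    have "exp s * ((1 - s) * f y + f y * L y) = f y * (exp s * (1 + (L y - s)))"
      by (simp add: algebra_simps)
    also have "\<dots> \<le> f y * (exp s * exp (L y - s))"
      by (intro mult_left_mono) (auto simp: f)
    also have "\<dots> = f y * exp (L y)" by (simp flip: exp_add)
    also have "\<dots> \<le> exp (L y)" by (simp add: f mult_left_le_one_le)
    finally show "exp s * ((1 - s) * f y + f y * L y) \<le> exp (L y)" .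
  qed simp_all
  also have "\<dots> \<le> exp (s / 2)"
    unfolding L_def s_def by (rule expectation_unif_bits_exp_le)
  finally have "ln (exp s * \<alpha>) \<le> s / 2"
    using \<alpha>(2) by (metis exp_gt_zero ln_exp ln_mono mult_pos_pos)
  then show ?thesis
    using \<alpha>(2) by (simp add: ln_mult ln_div s_def[symmetric])
qed

text \<open>For \<open>a\<close> and \<open>b\<close> the probabilities of a transcript under the
  two values of a bit, \<open>a + b\<close> is twice its average probability; dividing by it turns a
  squared bias into a bound on a squared Hellinger distance.\<close>

lemma sq_diff_sqrt_le:
  fixes a b :: real
  assumes "0 \<le> a" "0 \<le> b"
  shows "(a + b) * (sqrt a - sqrt b)\<^sup>2 \<le> (a - b)\<^sup>2"
proof -
  have "(sqrt a - sqrt b)\<^sup>2 * (a + b) \<le> (sqrt a - sqrt b)\<^sup>2 * (sqrt a + sqrt b)\<^sup>2"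
    using assms by (intro mult_left_mono) (auto simp: power2_sum)
  also have "\<dots> = ((sqrt a - sqrt b) * (sqrt a + sqrt b))\<^sup>2"
    by (simp add: power_mult_distrib)
  also have "(sqrt a - sqrt b) * (sqrt a + sqrt b) = a - b"
    using assms by (simp add: algebra_simps)
  finally show ?thesis by (simp add: mult.commute)
qed

lemma sum_entropy_le_ln_card:
  fixes \<alpha> :: "'a \<Rightarrow> real"
  assumes "finite \<Omega>" "\<And>\<pi>. \<pi> \<in> \<Omega> \<Longrightarrow> 0 \<le> \<alpha> \<pi>" "(\<Sum>\<pi>\<in>\<Omega>. \<alpha> \<pi>) = 1"
  shows "(\<Sum>\<pi>\<in>\<Omega>. \<alpha> \<pi> * ln (1 / \<alpha> \<pi>)) \<le> ln (real (card \<Omega>))"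
proof -
  define K where "K = real (card \<Omega>)"
  have "\<Omega> \<noteq> {}" using assms(3) by auto
  then have K: "K > 0" using assms(1) by (simp add: K_def card_gt_0_iff)
  \<comment> \<open>Comparison with the uniform distribution through \<open>ln x \<le> x - 1\<close>
    at \<open>x = 1 / (\<alpha> \<pi> * K)\<close>. In the sum over \<open>\<Omega>\<close> the term
    \<open>-1\<close> and the \<open>K\<close> terms \<open>1 / K\<close> cancel.\<close>
  have "\<alpha> \<pi> * ln (1 / \<alpha> \<pi>) \<le> \<alpha> \<pi> * (ln K - 1) + 1 / K" if "\<pi> \<in> \<Omega>" for \<pi>
  proof (cases "\<alpha> \<pi> = 0")
    case False
    then have pos: "\<alpha> \<pi> > 0" using assms(2)[OF that] by simp
    have "ln (1 / (\<alpha> \<pi> * K)) \<le> 1 / (\<alpha> \<pi> * K) - 1"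
      by (rule ln_le_minus_one) (use pos K in simp)
    then have "ln (1 / \<alpha> \<pi>) \<le> (ln K - 1) + 1 / (\<alpha> \<pi> * K)"
      using pos K by (simp add: ln_div ln_mult)
    then have "\<alpha> \<pi> * ln (1 / \<alpha> \<pi>) \<le> \<alpha> \<pi> * ((ln K - 1) + 1 / (\<alpha> \<pi> * K))"
      using pos by (intro mult_left_mono) auto
    also have "\<dots> = \<alpha> \<pi> * (ln K - 1) + 1 / K" using pos K by (simp add: field_simps)
    finally show ?thesis .
  qed (use K in simp)
  then have "(\<Sum>\<pi>\<in>\<Omega>. \<alpha> \<pi> * ln (1 / \<alpha> \<pi>)) \<le> (\<Sum>\<pi>\<in>\<Omega>. \<alpha> \<pi> * (ln K - 1) + 1 / K)"
    by (rule sum_mono)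
  also have "\<dots> = ln K"
    using K by (simp add: sum.distrib assms(3) K_def flip: sum_distrib_right)
  finally show ?thesis by (simp add: K_def)
qed

text \<open>Given the transcript \<open>\<pi>\<close>, the posterior density of the bits is
  \<open>f \<pi> / \<alpha> \<pi>\<close>. The level-one inequality bounds the sum of its squared
  biases by \<open>2 * ln (1 / \<alpha> \<pi>)\<close>, and averaging this over the transcripts
  leaves their entropy.\<close>

lemma sum_sqdist_sqrt_bits_le:
  fixes f :: "'a \<Rightarrow> (nat \<Rightarrow> bool) \<Rightarrow> real" and M :: nat
  assumes fin: "finite \<Omega>"
    and f: "\<And>\<pi> y. 0 \<le> f \<pi> y" and total: "\<And>y. (\<Sum>\<pi>\<in>\<Omega>. f \<pi> y) = 1"
  defines "Q \<equiv> \<lambda>b i \<pi>. measure_pmf.expectation (unif_bits M) (\<lambda>y. f \<pi> (y(i := b)))"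
  shows "(\<Sum>i<M. sqdist \<Omega> (\<lambda>\<pi>. sqrt (Q False i \<pi>)) (\<lambda>\<pi>. sqrt (Q True i \<pi>))) \<le> 4 * ln (real (card \<Omega>))"
proof -
  define \<alpha> where "\<alpha> \<pi> = measure_pmf.expectation (unif_bits M) (f \<pi>)" for \<pi>
  have f1: "f \<pi> y \<le> 1" if "\<pi> \<in> \<Omega>" for \<pi> y
    using member_le_sum[of \<pi> \<Omega> "\<lambda>\<pi>. f \<pi> y"] that f fin total[of y] by auto
  have Q0: "0 \<le> Q b i \<pi>" for b i \<pi> unfolding Q_def by (simp add: f)
  have \<alpha>0: "0 \<le> \<alpha> \<pi>" for \<pi> unfolding \<alpha>_def by (simp add: f)
  have \<alpha>Q: "2 * \<alpha> \<pi> = Q False i \<pi> + Q True i \<pi>" if "i < M" for i \<pi>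
    using expectation_unif_bits_resample[OF that, of "f \<pi>"] by (simp add: \<alpha>_def Q_def)
  have sg: "2 * measure_pmf.expectation (unif_bits M) (\<lambda>y. f \<pi> y * (if y i then 1 else - 1))
      = Q True i \<pi> - Q False i \<pi>" if "i < M" for i \<pi>
    using expectation_unif_bits_resample[OF that, of "\<lambda>y. f \<pi> y * (if y i then 1 else - 1)"]
    by (simp add: Q_def)
  have one: "(\<Sum>i<M. (sqrt (Q False i \<pi>) - sqrt (Q True i \<pi>))\<^sup>2) \<le> 4 * (\<alpha> \<pi> * ln (1 / \<alpha> \<pi>))"
    if \<pi>: "\<pi> \<in> \<Omega>" for \<pi>
  proof (cases "\<alpha> \<pi> = 0")
    case True
    then have "Q False i \<pi> = 0 \<and> Q True i \<pi> = 0" if "i < M" for i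
      using \<alpha>Q[OF that, of \<pi>] Q0[of False i \<pi>] Q0[of True i \<pi>] by simp
    with True show ?thesis by simp
  next
    case False
    then have pos: "\<alpha> \<pi> > 0" using \<alpha>0[of \<pi>] by simp
    define m where "m i = measure_pmf.expectation (unif_bits M) (\<lambda>y. f \<pi> y * (if y i then 1 else - 1)) / \<alpha> \<pi>" for i
    have "(sqrt (Q False i \<pi>) - sqrt (Q True i \<pi>))\<^sup>2 \<le> 2 * \<alpha> \<pi> * (m i)\<^sup>2" if "i < M" for i
    proof -
      have "2 * \<alpha> \<pi> * (sqrt (Q False i \<pi>) - sqrt (Q True i \<pi>))\<^sup>2 \<le> (Q False i \<pi> - Q True i \<pi>)\<^sup>2"
        unfolding \<alpha>Q[OF that] by (rule sq_diff_sqrt_le[OF Q0 Q0])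
      also have "\<dots> = (2 * (\<alpha> \<pi> * m i))\<^sup>2"
        using sg[OF that, of \<pi>] pos by (simp add: m_def power2_commute)
      also have "\<dots> = 2 * \<alpha> \<pi> * (2 * \<alpha> \<pi> * (m i)\<^sup>2)" by (simp add: power2_eq_square)
      finally show ?thesis using pos by simp
    qed
    then have "(\<Sum>i<M. (sqrt (Q False i \<pi>) - sqrt (Q True i \<pi>))\<^sup>2) \<le> (\<Sum>i<M. 2 * \<alpha> \<pi> * (m i)\<^sup>2)"
      by (intro sum_mono) simp
    also have "\<dots> = 2 * \<alpha> \<pi> * (\<Sum>i<M. (m i)\<^sup>2)" by (simp add: sum_distrib_left)
    also have "\<dots> \<le> 2 * \<alpha> \<pi> * (2 * ln (1 / \<alpha> \<pi>))"
      using pos f1[OF \<pi>] by (intro mult_left_mono level_one_inequality[of "f \<pi>"]) (auto simp: f \<alpha>_def m_def)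
    finally show ?thesis by simp
  qed
  have "(\<Sum>i<M. sqdist \<Omega> (\<lambda>\<pi>. sqrt (Q False i \<pi>)) (\<lambda>\<pi>. sqrt (Q True i \<pi>)))
      = (\<Sum>\<pi>\<in>\<Omega>. \<Sum>i<M. (sqrt (Q False i \<pi>) - sqrt (Q True i \<pi>))\<^sup>2)"
    unfolding sqdist_def by (rule sum.swap)
  also have "\<dots> \<le> (\<Sum>\<pi>\<in>\<Omega>. 4 * (\<alpha> \<pi> * ln (1 / \<alpha> \<pi>)))"
    by (rule sum_mono) (rule one)
  also have "\<dots> = 4 * (\<Sum>\<pi>\<in>\<Omega>. \<alpha> \<pi> * ln (1 / \<alpha> \<pi>))"
    by (simp add: sum_distrib_left)
  also have "\<dots> \<le> 4 * ln (real (card \<Omega>))"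
  proof -
    have "(\<Sum>\<pi>\<in>\<Omega>. \<alpha> \<pi>) = measure_pmf.expectation (unif_bits M) (\<lambda>y. \<Sum>\<pi>\<in>\<Omega>. f \<pi> y)"
      unfolding \<alpha>_def by (subst Bochner_Integration.integral_sum) simp_all
    then have "(\<Sum>\<pi>\<in>\<Omega>. \<alpha> \<pi>) = 1" by (simp add: total)
    then show ?thesis using sum_entropy_le_ln_card[OF fin \<alpha>0] by simp
  qed
  finally show ?thesis .
qed


text \<open>A test \<open>F\<close> that tells \<open>P\<close> from \<open>Q\<close> forces their
  Hellinger distance up: \<open>P - Q\<close> is the difference of the square roots times their sum,
  and in Cauchy-Schwarz the squared sums contribute at most 4.\<close>

lemma sqdist_sqrt_ge_sq_diff:
  fixes P Q :: "'a \<Rightarrow> real"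
  assumes fin: "finite \<Omega>" and F: "F \<subseteq> \<Omega>"
    and nn: "\<And>\<pi>. 0 \<le> P \<pi>" "\<And>\<pi>. 0 \<le> Q \<pi>"
    and total: "(\<Sum>\<pi>\<in>\<Omega>. P \<pi>) = 1" "(\<Sum>\<pi>\<in>\<Omega>. Q \<pi>) = 1"
  shows "((\<Sum>\<pi>\<in>F. P \<pi>) - (\<Sum>\<pi>\<in>F. Q \<pi>))\<^sup>2 / 4 \<le> sqdist \<Omega> (\<lambda>\<pi>. sqrt (P \<pi>)) (\<lambda>\<pi>. sqrt (Q \<pi>))"
proof -
  have "((\<Sum>\<pi>\<in>F. P \<pi>) - (\<Sum>\<pi>\<in>F. Q \<pi>))\<^sup>2
      = (\<Sum>\<pi>\<in>F. (sqrt (P \<pi>) - sqrt (Q \<pi>)) * (sqrt (P \<pi>) + sqrt (Q \<pi>)))\<^sup>2"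
    by (simp add: sum_subtractf[symmetric] algebra_simps nn)
  also have "\<dots> \<le> (\<Sum>\<pi>\<in>F. (sqrt (P \<pi>) - sqrt (Q \<pi>))\<^sup>2) * (\<Sum>\<pi>\<in>F. (sqrt (P \<pi>) + sqrt (Q \<pi>))\<^sup>2)"
    by (rule Cauchy_Schwarz_ineq_sum)
  also have "\<dots> \<le> sqdist \<Omega> (\<lambda>\<pi>. sqrt (P \<pi>)) (\<lambda>\<pi>. sqrt (Q \<pi>)) * 4"
  proof (rule mult_mono)
    show "(\<Sum>\<pi>\<in>F. (sqrt (P \<pi>) - sqrt (Q \<pi>))\<^sup>2) \<le> sqdist \<Omega> (\<lambda>\<pi>. sqrt (P \<pi>)) (\<lambda>\<pi>. sqrt (Q \<pi>))"
      unfolding sqdist_def by (rule sum_mono2[OF fin F]) simp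
    have "(\<Sum>\<pi>\<in>F. (sqrt (P \<pi>) + sqrt (Q \<pi>))\<^sup>2) \<le> (\<Sum>\<pi>\<in>\<Omega>. (sqrt (P \<pi>) + sqrt (Q \<pi>))\<^sup>2)"
      by (rule sum_mono2[OF fin F]) simp
    also have "\<dots> \<le> (\<Sum>\<pi>\<in>\<Omega>. 2 * P \<pi> + 2 * Q \<pi>)"
    proof (rule sum_mono)
      fix \<pi>
      have "0 \<le> (sqrt (P \<pi>) - sqrt (Q \<pi>))\<^sup>2" by simp
      then show "(sqrt (P \<pi>) + sqrt (Q \<pi>))\<^sup>2 \<le> 2 * P \<pi> + 2 * Q \<pi>"
        by (simp add: power2_sum power2_diff nn)
    qed
    also have "\<dots> = 4" by (simp add: sum.distrib total flip: sum_distrib_left)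
    finally show "(\<Sum>\<pi>\<in>F. (sqrt (P \<pi>) + sqrt (Q \<pi>))\<^sup>2) \<le> 4" .
  qed (auto simp: sqdist_def intro!: sum_nonneg)
  finally show ?thesis by simp
qed

text \<open>
  Here \<open>\<pi>\<close> ranges over transcripts, \<open>g \<pi> j S\<close> is the probability that player \<open>j\<close> with input \<open>S\<close>
  acts consistently with \<open>\<pi>\<close>, and \<open>g0 \<pi>\<close> is that of a further party without input. The hard
  distribution gives every coordinate \<open>i\<close> to a random player \<open>z i\<close>, who keeps it with probability
  1/2; the level-one inequality bounds what the transcript reveals about the kept bits.
\<close>

theorem promise_disjointness_transcripts:
  fixes g :: "'a \<Rightarrow> nat \<Rightarrow> nat set \<Rightarrow> real" and g0 :: "'a \<Rightarrow> real"
  assumes t: "t = 2 ^ k" and fin: "finite \<Omega>"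
    and g: "\<And>\<pi> j S. 0 \<le> g \<pi> j S" "\<And>\<pi> j S. g \<pi> j S \<le> 1" and g0: "\<And>\<pi>. 0 \<le> g0 \<pi>"
    and total: "\<And>S. (\<Sum>\<pi>\<in>\<Omega>. g0 \<pi> * (\<Prod>j<t. g \<pi> j (S j))) = 1"
    and F: "F \<subseteq> \<Omega>" and q: "1 / 2 \<le> q"
    and disj: "\<And>i z y. i < M \<Longrightarrow> (\<And>i. i < M \<Longrightarrow> z i < t) \<Longrightarrow>
      q \<le> (\<Sum>\<pi>\<in>F. g0 \<pi> * (\<Prod>j<t. g \<pi> j {i'. i' < M \<and> i' \<noteq> i \<and> z i' = j \<and> y i'}))"
    and inter: "\<And>i z y. i < M \<Longrightarrow> (\<And>i. i < M \<Longrightarrow> z i < t) \<Longrightarrow>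
      (\<Sum>\<pi>\<in>F. g0 \<pi> * (\<Prod>j<t. g \<pi> j (insert i {i'. i' < M \<and> i' \<noteq> i \<and> z i' = j \<and> y i'}))) \<le> 1 - q"
  shows "real M * (2 * q - 1)\<^sup>2 \<le> 64 * real t * ln (real (card \<Omega>))"
proof -
  have t0: "t > 0" by (simp add: t)
  \<comment> \<open>Everybody in \<open>A\<close> additionally holds \<open>i\<close>. The sets
    \<open>{}\<close> and \<open>{..<t}\<close> are the two sides of the promise, and
    \<open>{z i}\<close> is the hard distribution with bit \<open>i\<close> set. Sets strictly in
    between can violate the promise, but the factorisation holds for them too, and cut and paste
    passes through them.\<close>
  define inp where "inp i z y A j = (if j \<in> A then {i} else {}) \<union> {i'. i' < M \<and> i' \<noteq> i \<and> z i' = j \<and> y i'}"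
    for i :: nat and z :: "nat \<Rightarrow> nat" and y A j
  define Q where "Q i z A \<pi> = measure_pmf.expectation (unif_bits M)
      (\<lambda>y. g0 \<pi> * (\<Prod>j<t. g \<pi> j (inp i z y A j)))" for i z A \<pi>
  define G where "G i z \<pi> j b = measure_pmf.expectation (unif_bits M)
      (\<lambda>y. g \<pi> j (inp i z y (if b then {j} else {}) j))" for i z \<pi> j b
  \<comment> \<open>For fixed \<open>z\<close> the players' sets are functions of disjoint blocks of
    bits, so averaging over \<open>y\<close> preserves the product form.\<close>
  have Q_prod: "Q i z A \<pi> = g0 \<pi> * (\<Prod>j<t. G i z \<pi> j (j \<in> A))" for i z A \<pi>
  proof -
    have "Q i z A \<pi> = g0 \<pi> * measure_pmf.expectation (unif_bits M) (\<lambda>y. \<Prod>j<t. g \<pi> j (inp i z y A j))"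
      unfolding Q_def by simp
    also have "measure_pmf.expectation (unif_bits M) (\<lambda>y. \<Prod>j<t. g \<pi> j (inp i z y A j))
        = (\<Prod>j<t. measure_pmf.expectation (unif_bits M) (\<lambda>y. g \<pi> j (inp i z y A j)))"
      unfolding unif_bits_def
    proof (rule expectation_Pi_pmf_prod_blocks[where cls = z])
      show "g \<pi> j (inp i z x A j) = g \<pi> j (inp i z y A j)"
        if "\<And>i. i \<in> {..<M} \<Longrightarrow> z i = j \<Longrightarrow> x i = y i" for j x y
        using that by (intro arg_cong[where f = "g \<pi> j"]) (auto simp: inp_def)
    qed (auto simp: g)
    also have "\<dots> = (\<Prod>j<t. G i z \<pi> j (j \<in> A))"
      by (intro prod.cong refl) (simp add: G_def inp_def)
    finally show ?thesis .
  qed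
  have G0: "0 \<le> G i z \<pi> j b" for i z \<pi> j b unfolding G_def by (simp add: g)
  have Q0: "0 \<le> Q i z A \<pi>" for i z A \<pi>
    unfolding Q_prod by (simp add: g0 G0 prod_nonneg)
  have Q_total: "(\<Sum>\<pi>\<in>\<Omega>. Q i z A \<pi>) = 1" for i z A
    unfolding Q_def by (subst Bochner_Integration.integral_sum[symmetric]) (simp_all add: total)
  define v where "v i z A \<pi> = sqrt (Q i z A \<pi>)" for i z A \<pi>
  have Q_cut: "Q i z A \<pi> * Q i z B \<pi> = Q i z {} \<pi> * Q i z (A \<union> B) \<pi>" if "A \<inter> B = {}" for i z A B \<pi>
  proof -
    have "(\<Prod>j<t. G i z \<pi> j (j \<in> A)) * (\<Prod>j<t. G i z \<pi> j (j \<in> B))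
        = (\<Prod>j<t. G i z \<pi> j (j \<in> {})) * (\<Prod>j<t. G i z \<pi> j (j \<in> A \<union> B))"
      unfolding prod.distrib[symmetric]
    proof (rule prod.cong[OF refl])
      fix j
      show "G i z \<pi> j (j \<in> A) * G i z \<pi> j (j \<in> B) = G i z \<pi> j (j \<in> {}) * G i z \<pi> j (j \<in> A \<union> B)"
        using that by (cases "j \<in> A"; cases "j \<in> B") auto
    qed
    then show ?thesis unfolding Q_prod by (simp add: mult.assoc mult.left_commute)
  qed
  have jay: "sqdist \<Omega> (v i z {}) (v i z {..<t}) \<le> 4 * (\<Sum>j<t. sqdist \<Omega> (v i z {}) (v i z {j}))" for i z
  proof (rule hellinger_sq_le_sum_singletons[OF t])
    show "(\<Sum>\<pi>\<in>\<Omega>. (v i z A \<pi>)\<^sup>2) = 1" for A by (simp add: v_def Q0 Q_total)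
    show "v i z A \<pi> * v i z B \<pi> = v i z {} \<pi> * v i z (A \<union> B) \<pi>" if "A \<inter> B = {}" for A B \<pi>
      unfolding v_def real_sqrt_mult[symmetric] Q_cut[OF that] ..
  qed
  have far: "(2 * q - 1)\<^sup>2 / 4 \<le> sqdist \<Omega> (v i z {}) (v i z {..<t})"
    if i: "i < M" and z: "\<And>i. i < M \<Longrightarrow> z i < t" for i z
  proof -
    have "q \<le> (\<Sum>\<pi>\<in>F. Q i z {} \<pi>)"
    proof -
      have "q = measure_pmf.expectation (unif_bits M) (\<lambda>y. q)" by simp
      also have "\<dots> \<le> measure_pmf.expectation (unif_bits M) (\<lambda>y. \<Sum>\<pi>\<in>F. g0 \<pi> * (\<Prod>j<t. g \<pi> j (inp i z y {} j)))"
        using disj[OF i z] by (intro integral_mono) (simp_all add: inp_def)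
      finally show ?thesis unfolding Q_def by (subst (asm) Bochner_Integration.integral_sum) simp_all
    qed
    moreover have "(\<Sum>\<pi>\<in>F. Q i z {..<t} \<pi>) \<le> 1 - q"
    proof -
      have "(\<Sum>\<pi>\<in>F. Q i z {..<t} \<pi>)
          = measure_pmf.expectation (unif_bits M) (\<lambda>y. \<Sum>\<pi>\<in>F. g0 \<pi> * (\<Prod>j<t. g \<pi> j (inp i z y {..<t} j)))"
        unfolding Q_def by (subst Bochner_Integration.integral_sum) simp_all
      also have "\<dots> \<le> measure_pmf.expectation (unif_bits M) (\<lambda>y. 1 - q)"
        using inter[OF i z] by (intro integral_mono) (simp_all add: inp_def)
      finally show ?thesis by simp
    qed
    ultimately have "2 * q - 1 \<le> (\<Sum>\<pi>\<in>F. Q i z {} \<pi>) - (\<Sum>\<pi>\<in>F. Q i z {..<t} \<pi>)" by simp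
    then have "(2 * q - 1)\<^sup>2 \<le> ((\<Sum>\<pi>\<in>F. Q i z {} \<pi>) - (\<Sum>\<pi>\<in>F. Q i z {..<t} \<pi>))\<^sup>2"
      using q by (intro power_mono) auto
    moreover have "((\<Sum>\<pi>\<in>F. Q i z {} \<pi>) - (\<Sum>\<pi>\<in>F. Q i z {..<t} \<pi>))\<^sup>2 / 4 \<le> sqdist \<Omega> (v i z {}) (v i z {..<t})"
      unfolding v_def by (rule sqdist_sqrt_ge_sq_diff[OF fin F]) (simp_all add: Q0 Q_total)
    ultimately show ?thesis by simp
  qed
  \<comment> \<open>The inputs for \<open>{}\<close> and \<open>{z i}\<close> are exactly those of
    the hard distribution with bit \<open>i\<close> cleared and set, which is why only the owner's
    singleton occurs here.\<close>
  have info: "(\<Sum>i<M. sqdist \<Omega> (v i z {}) (v i z {z i})) \<le> 4 * ln (real (card \<Omega>))"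
    if z: "\<And>i. i < M \<Longrightarrow> z i < t" for z
  proof -
    define f where "f \<pi> y = g0 \<pi> * (\<Prod>j<t. g \<pi> j {i. i < M \<and> z i = j \<and> y i})" for \<pi> y
    have QF: "Q i z {} \<pi> = measure_pmf.expectation (unif_bits M) (\<lambda>y. f \<pi> (y(i := False)))"
      if "i < M" for i \<pi>
      unfolding Q_def f_def
    proof -
      have "inp i z y {} j = {i'. i' < M \<and> z i' = j \<and> (y(i := False)) i'}" for y j
        by (auto simp: inp_def)
      then show "measure_pmf.expectation (unif_bits M) (\<lambda>y. g0 \<pi> * (\<Prod>j<t. g \<pi> j (inp i z y {} j)))
        = measure_pmf.expectation (unif_bits M)
            (\<lambda>y. g0 \<pi> * (\<Prod>j<t. g \<pi> j {i'. i' < M \<and> z i' = j \<and> (y(i := False)) i'}))" by simp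
    qed
    have QT: "Q i z {z i} \<pi> = measure_pmf.expectation (unif_bits M) (\<lambda>y. f \<pi> (y(i := True)))"
      if "i < M" for i \<pi>
      unfolding Q_def f_def
    proof -
      have "inp i z y {z i} j = {i'. i' < M \<and> z i' = j \<and> (y(i := True)) i'}" for y j
        using that by (auto simp: inp_def)
      then show "measure_pmf.expectation (unif_bits M) (\<lambda>y. g0 \<pi> * (\<Prod>j<t. g \<pi> j (inp i z y {z i} j)))
        = measure_pmf.expectation (unif_bits M)
            (\<lambda>y. g0 \<pi> * (\<Prod>j<t. g \<pi> j {i'. i' < M \<and> z i' = j \<and> (y(i := True)) i'}))" by simp
    qed
    have "(\<Sum>i<M. sqdist \<Omega> (v i z {}) (v i z {z i}))
        = (\<Sum>i<M. sqdist \<Omega> (\<lambda>\<pi>. sqrt (measure_pmf.expectation (unif_bits M) (\<lambda>y. f \<pi> (y(i := False)))))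
            (\<lambda>\<pi>. sqrt (measure_pmf.expectation (unif_bits M) (\<lambda>y. f \<pi> (y(i := True))))))"
      by (intro sum.cong refl) (simp add: v_def QF QT sqdist_def)
    also have "\<dots> \<le> 4 * ln (real (card \<Omega>))"
      by (rule sum_sqdist_sqrt_bits_le[OF fin]) (auto simp: f_def total g0 g prod_nonneg)
    finally show ?thesis .
  qed
  define Z where "Z = Pi_pmf {..<M} 0 (\<lambda>_. pmf_of_set {..<t})"
  have setp: "set_pmf (pmf_of_set {..<t}) = {..<t}" using t0 by (subst set_pmf_of_set) auto
  then have finp: "finite (set_pmf (pmf_of_set {..<t}))" by simp
  have finZ: "finite (set_pmf Z)"
    using finp by (simp add: Z_def set_Pi_pmf finite_PiE_dflt)
  have intZ: "integrable (measure_pmf Z) h" for h :: "_ \<Rightarrow> real"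
    by (rule integrable_measure_pmf_finite[OF finZ])
  have Zt: "z i < t" if "z \<in> set_pmf Z" "i < M" for z i
    using that by (auto simp: Z_def set_Pi_pmf PiE_dflt_def setp)
  \<comment> \<open>Coordinate \<open>i\<close> is left out of the random part of
    \<open>inp\<close>, so its owner has no influence on \<open>v i z\<close>. A random owner
    therefore averages over all singletons.\<close>
  have v_upd: "v i (z(i := j)) A = v i z A" for i z j A
  proof -
    have "inp i (z(i := j)) y A j' = inp i z y A j'" for y j' by (auto simp: inp_def)
    then show ?thesis by (simp add: v_def Q_def fun_eq_iff del: fun_upd_apply)
  qed
  \<comment> \<open>The 16 is 4 from the gap in \<open>far\<close> times 4 from
    \<open>jay\<close>.\<close>
  have coord: "(2 * q - 1)\<^sup>2 / (16 * real t) \<le> measure_pmf.expectation Z (\<lambda>z. sqdist \<Omega> (v i z {}) (v i z {z i}))"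
    if i: "i < M" for i
  proof -
    have "(2 * q - 1)\<^sup>2 / (16 * real t) = measure_pmf.expectation Z (\<lambda>z. (2 * q - 1)\<^sup>2 / (16 * real t))"
      by simp
    also have "\<dots> \<le> measure_pmf.expectation Z (\<lambda>z. (\<Sum>j<t. sqdist \<Omega> (v i z {}) (v i z {j})) / real t)"
    proof (intro integral_mono_AE intZ AE_pmfI)
      fix z assume z: "z \<in> set_pmf Z"
      have "(2 * q - 1)\<^sup>2 / 4 \<le> 4 * (\<Sum>j<t. sqdist \<Omega> (v i z {}) (v i z {j}))"
        using far[of i z, OF i Zt[OF z]] jay[of i z] by simp
      then show "(2 * q - 1)\<^sup>2 / (16 * real t) \<le> (\<Sum>j<t. sqdist \<Omega> (v i z {}) (v i z {j})) / real t"
        using t0 by (simp add: field_simps)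
    qed
    also have "\<dots> = measure_pmf.expectation Z (\<lambda>z. sqdist \<Omega> (v i z {}) (v i z {z i}))"
    proof -
      have "measure_pmf.expectation Z (\<lambda>z. sqdist \<Omega> (v i z {}) (v i z {z i}))
          = measure_pmf.expectation Z (\<lambda>z. (\<Sum>j<t. sqdist \<Omega> (v i (z(i := j)) {}) (v i (z(i := j)) {(z(i := j)) i})) / real (card {..<t}))"
        unfolding Z_def
        by (rule expectation_Pi_pmf_resample) (use i t0 finp in auto)
      then show ?thesis by (simp add: v_upd)
    qed
    finally show ?thesis .
  qed
  have "real M * ((2 * q - 1)\<^sup>2 / (16 * real t)) = (\<Sum>i<M. (2 * q - 1)\<^sup>2 / (16 * real t))" by simp
  also have "\<dots> \<le> (\<Sum>i<M. measure_pmf.expectation Z (\<lambda>z. sqdist \<Omega> (v i z {}) (v i z {z i})))"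
    by (intro sum_mono coord) simp
  also have "\<dots> = measure_pmf.expectation Z (\<lambda>z. \<Sum>i<M. sqdist \<Omega> (v i z {}) (v i z {z i}))"
    by (rule Bochner_Integration.integral_sum[symmetric]) (rule intZ)
  also have "\<dots> \<le> measure_pmf.expectation Z (\<lambda>z. 4 * ln (real (card \<Omega>)))"
    by (intro integral_mono_AE intZ AE_pmfI info Zt)
  finally have "real M * ((2 * q - 1)\<^sup>2 / (16 * real t)) \<le> 4 * ln (real (card \<Omega>))" by simp
  then show ?thesis using t0 by (simp add: field_simps)
qed

section \<open>Transcripts of CONGEST algorithms\<close>

text \<open>
  The view of a node when messages between different classes are read off \<open>\<mu>\<close>; it depends on the
  values and seeds of the node's own class only.
\<close>

fun local_view :: "congest_alg \<Rightarrow> (nat \<times> nat) set \<Rightarrow> (nat \<Rightarrow> nat) \<Rightarrow> (nat \<Rightarrow> nat \<times> nat \<Rightarrow> bool list)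
    \<Rightarrow> vals \<Rightarrow> (nat \<Rightarrow> nat) \<Rightarrow> nat \<Rightarrow> nat \<Rightarrow> view" where
  "local_view A E cls \<mu> val \<omega> 0 v =
     \<lparr>own_id = v, nbrs = E `` {v}, own_val = val v, seed = \<omega> v, inbox = []\<rparr>"
| "local_view A E cls \<mu> val \<omega> (Suc r) v =
     (local_view A E cls \<mu> val \<omega> r v)
       \<lparr>inbox := inbox (local_view A E cls \<mu> val \<omega> r v) @
          [\<lambda>u. if (u, v) \<in> E
               then if cls u = cls v then message A (local_view A E cls \<mu> val \<omega> r u) v else \<mu> r (u, v)
               else []]\<rparr>"

lemma local_view_cong:
  assumes E: "E \<subseteq> {..<n} \<times> {..<n}"
    and val: "\<And>u. u < n \<Longrightarrow> cls u = c \<Longrightarrow> val u = val' u"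
    and \<omega>: "\<And>u. u < n \<Longrightarrow> cls u = c \<Longrightarrow> \<omega> u = \<omega>' u"
    and \<mu>: "\<And>s e. s < r \<Longrightarrow> \<mu> s e = \<mu>' s e"
    and v: "v < n" "cls v = c"
  shows "local_view A E cls \<mu> val \<omega> r v = local_view A E cls \<mu>' val' \<omega>' r v"
  using \<mu> v
proof (induction r arbitrary: v)
  case (Suc r)
  have "local_view A E cls \<mu> val \<omega> r u = local_view A E cls \<mu>' val' \<omega>' r u" if "(u, v) \<in> E" "cls u = cls v" for u
    using that E Suc.prems by (intro Suc.IH) auto
  moreover have "local_view A E cls \<mu> val \<omega> r v = local_view A E cls \<mu>' val' \<omega>' r v"
    using Suc.prems by (intro Suc.IH) auto
  ultimately show ?case using Suc.prems(1)[of r] by (auto simp: fun_eq_iff)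
qed (simp add: val \<omega>)

lemma local_view_eq_view_after:
  assumes "\<And>s u w. s < r \<Longrightarrow> (u, w) \<in> E \<Longrightarrow> cls u \<noteq> cls w \<Longrightarrow>
      \<mu> s (u, w) = message A (view_after A E val \<omega> s u) w"
  shows "local_view A E cls \<mu> val \<omega> r v = view_after A E val \<omega> r v"
  using assms
proof (induction r arbitrary: v)
  case (Suc r)
  have "local_view A E cls \<mu> val \<omega> r u = view_after A E val \<omega> r u" for u
    using Suc.prems by (intro Suc.IH) auto
  then show ?case using Suc.prems[of r] by (auto simp: fun_eq_iff)
qed simp

text \<open>A guess \<open>\<mu>\<close> of the traffic that every sender confirms from its local
  view is the true traffic. There is no circularity, since a message of round \<open>s\<close>
  depends on the view after \<open>s\<close> rounds only.\<close>

lemma local_view_self_consistent: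
  assumes "\<And>s u w. s < r \<Longrightarrow> (u, w) \<in> E \<Longrightarrow> cls u \<noteq> cls w \<Longrightarrow>
      \<mu> s (u, w) = message A (local_view A E cls \<mu> val \<omega> s u) w"
  shows "local_view A E cls \<mu> val \<omega> r v = view_after A E val \<omega> r v"
  using assms
proof (induction r arbitrary: v rule: less_induct)
  case (less r)
  show ?case
  proof (rule local_view_eq_view_after)
    fix s u w assume *: "s < r" "(u, w) \<in> E" "cls u \<noteq> cls w"
    have "local_view A E cls \<mu> val \<omega> s u = view_after A E val \<omega> s u"
      using * less.prems by (intro less.IH) auto
    then show "\<mu> s (u, w) = message A (view_after A E val \<omega> s u) w"
      using less.prems[OF *] by simp
  qed
qed

definition cross :: "(nat \<times> nat) set \<Rightarrow> (nat \<Rightarrow> nat) \<Rightarrow> (nat \<times> nat) set" where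
  "cross E cls = {(u, v) \<in> E. cls u \<noteq> cls v}"

type_synonym transcript = "(nat \<times> nat \<times> nat \<Rightarrow> bool list) \<times> (nat \<Rightarrow> bool)"

text \<open>The second component holds one bit per class, meant to record whether the class gives a
  low answer; this makes the outcome a function of the transcript. Extensional functions keep the
  set finite.\<close>

definition transcripts :: "nat \<Rightarrow> nat \<Rightarrow> (nat \<times> nat) set \<Rightarrow> nat set \<Rightarrow> transcript set" where
  "transcripts b T X J =
     PiE ({..<T} \<times> X) (\<lambda>_. {xs. length xs \<le> b}) \<times> PiE J (\<lambda>_. UNIV)"

definition transcript_of ::
  "congest_alg \<Rightarrow> (nat \<times> nat) set \<Rightarrow> (nat \<Rightarrow> nat) \<Rightarrow> nat \<Rightarrow> nat set \<Rightarrow> nat \<Rightarrow> (real \<Rightarrow> bool)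
    \<Rightarrow> vals \<Rightarrow> (nat \<Rightarrow> nat) \<Rightarrow> transcript" where
  "transcript_of A E cls n J T low val \<omega> =
     (restrict (\<lambda>(r, u, v). message A (view_after A E val \<omega> r u) v) ({..<T} \<times> cross E cls),
      restrict (\<lambda>j. \<exists>v<n. cls v = j \<and> (\<exists>y. answer A (view_after A E val \<omega> T v) = Some y \<and> low y)) J)"

definition consistent ::
  "congest_alg \<Rightarrow> (nat \<times> nat) set \<Rightarrow> (nat \<Rightarrow> nat) \<Rightarrow> nat \<Rightarrow> nat \<Rightarrow> (real \<Rightarrow> bool)
    \<Rightarrow> transcript \<Rightarrow> nat \<Rightarrow> vals \<Rightarrow> (nat \<Rightarrow> nat) \<Rightarrow> bool" where
  "consistent A E cls n T low \<pi> j val \<omega> \<longleftrightarrow>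
     (\<forall>r<T. \<forall>(u, v)\<in>cross E cls. cls u = j \<longrightarrow>
        fst \<pi> (r, u, v) = message A (local_view A E cls (\<lambda>r e. fst \<pi> (r, e)) val \<omega> r u) v) \<and>
     (snd \<pi> j \<longleftrightarrow> (\<exists>v<n. cls v = j \<and>
        (\<exists>y. answer A (local_view A E cls (\<lambda>r e. fst \<pi> (r, e)) val \<omega> T v) = Some y \<and> low y)))"

lemma consistent_cong:
  assumes E: "E \<subseteq> {..<n} \<times> {..<n}"
    and val: "\<And>u. u < n \<Longrightarrow> cls u = j \<Longrightarrow> val u = val' u"
    and \<omega>: "\<And>u. u < n \<Longrightarrow> cls u = j \<Longrightarrow> \<omega> u = \<omega>' u"
  shows "consistent A E cls n T low \<pi> j val \<omega> = consistent A E cls n T low \<pi> j val' \<omega>'"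
proof -
  have lv: "local_view A E cls (\<lambda>r e. fst \<pi> (r, e)) val \<omega> r v = local_view A E cls (\<lambda>r e. fst \<pi> (r, e)) val' \<omega>' r v"
    if "v < n" "cls v = j" for r v
    using that by (intro local_view_cong[OF E, where c = j]) (auto simp: val \<omega>)
  have "(\<forall>(u, v)\<in>cross E cls. cls u = j \<longrightarrow> fst \<pi> (r, u, v) = message A (local_view A E cls (\<lambda>r e. fst \<pi> (r, e)) val \<omega> r u) v)
      = (\<forall>(u, v)\<in>cross E cls. cls u = j \<longrightarrow> fst \<pi> (r, u, v) = message A (local_view A E cls (\<lambda>r e. fst \<pi> (r, e)) val' \<omega>' r u) v)" for r
    using E by (intro ball_cong refl) (auto simp: cross_def lv)
  moreover have "(\<exists>v<n. cls v = j \<and> (\<exists>y. answer A (local_view A E cls (\<lambda>r e. fst \<pi> (r, e)) val \<omega> T v) = Some y \<and> low y))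
      = (\<exists>v<n. cls v = j \<and> (\<exists>y. answer A (local_view A E cls (\<lambda>r e. fst \<pi> (r, e)) val' \<omega>' T v) = Some y \<and> low y))"
    by (auto simp: lv)
  ultimately show ?thesis unfolding consistent_def by simp
qed

text \<open>The rectangle property: that a run produces \<open>\<pi>\<close> is a conjunction of
  conditions each of which concerns the values and seeds of one class. With independent seeds the
  probability of \<open>\<pi>\<close> is then a product over the classes.\<close>

lemma transcript_of_eq_iff:
  assumes \<pi>: "\<pi> \<in> transcripts b T (cross E cls) J" and J: "\<And>u v. (u, v) \<in> E \<Longrightarrow> cls u \<in> J"
  shows "transcript_of A E cls n J T low val \<omega> = \<pi> \<longleftrightarrow> (\<forall>j\<in>J. consistent A E cls n T low \<pi> j val \<omega>)"
proof -
  obtain m d where md: "\<pi> = (m, d)" by (cases \<pi>)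
  let ?lv = "local_view A E cls (\<lambda>r e. m (r, e)) val \<omega>" and ?va = "view_after A E val \<omega>"
  have m: "m \<in> extensional ({..<T} \<times> cross E cls)" and d: "d \<in> extensional J"
    using \<pi> by (auto simp: md transcripts_def PiE_def)
  show ?thesis
  proof
    assume "transcript_of A E cls n J T low val \<omega> = \<pi>"
    then have eqs: "m = restrict (\<lambda>(r, u, v). message A (?va r u) v) ({..<T} \<times> cross E cls)"
      "d = restrict (\<lambda>j. \<exists>v<n. cls v = j \<and> (\<exists>y. answer A (?va T v) = Some y \<and> low y)) J"
      by (simp_all add: transcript_of_def md)
    have m_eq: "m (r, u, v) = message A (?va r u) v" if "r < T" "(u, v) \<in> cross E cls" for r u v
      unfolding eqs using that by simp
    have d_eq: "d j \<longleftrightarrow> (\<exists>v<n. cls v = j \<and> (\<exists>y. answer A (?va T v) = Some y \<and> low y))" if "j \<in> J" for j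
      unfolding eqs using that by simp
    have lv: "?lv r v = ?va r v" if "r \<le> T" for r v
      by (rule local_view_eq_view_after) (use that m_eq in \<open>auto simp: cross_def\<close>)
    show "\<forall>j\<in>J. consistent A E cls n T low \<pi> j val \<omega>"
      by (auto simp: consistent_def md lv m_eq d_eq)
  next
    assume con: "\<forall>j\<in>J. consistent A E cls n T low \<pi> j val \<omega>"
    have m_eq: "m (r, u, v) = message A (?lv r u) v" if "r < T" "(u, v) \<in> cross E cls" for r u v
    proof -
      have "cls u \<in> J" using that J by (auto simp: cross_def)
      then show ?thesis using con that by (fastforce simp: consistent_def md)
    qed
    have lv: "?lv r v = ?va r v" if "r \<le> T" for r v
      by (rule local_view_self_consistent) (use that m_eq in \<open>auto simp: cross_def\<close>)
    have "restrict (\<lambda>(r, u, v). message A (?va r u) v) ({..<T} \<times> cross E cls) = m"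
      by (rule extensionalityI[OF _ m]) (auto simp: m_eq lv)
    moreover have "restrict (\<lambda>j. \<exists>v<n. cls v = j \<and> (\<exists>y. answer A (?va T v) = Some y \<and> low y)) J = d"
      by (rule extensionalityI[OF _ d]) (use con in \<open>auto simp: consistent_def md lv\<close>)
    ultimately show "transcript_of A E cls n J T low val \<omega> = \<pi>"
      by (simp add: transcript_of_def md)
  qed
qed

lemma finite_bool_lists_le: "finite {xs :: bool list. length xs \<le> b}"
  using finite_lists_length_le[of "UNIV :: bool set" b] by simp

lemma card_bool_lists_le: "card {xs :: bool list. length xs \<le> b} \<le> 2 ^ Suc b"
proof -
  have "card {xs :: bool list. length xs \<le> b} = (\<Sum>i\<le>b. 2 ^ i)"
    using card_lists_length_le[of "UNIV :: bool set" b] by simp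
  also have "\<dots> \<le> 2 ^ Suc b" by (induction b) auto
  finally show ?thesis .
qed

lemma finite_transcripts:
  assumes "finite X" "finite J"
  shows "finite (transcripts b T X J)"
  unfolding transcripts_def using assms by (intro finite_cartesian_product finite_PiE) (auto simp: finite_bool_lists_le)

lemma card_transcripts_le:
  assumes "finite X" "finite J"
  shows "card (transcripts b T X J) \<le> 2 ^ (Suc b * (T * card X) + card J)"
proof -
  have "card (transcripts b T X J) = card {xs :: bool list. length xs \<le> b} ^ (T * card X) * 2 ^ card J"
    using assms by (simp add: transcripts_def card_cartesian_product card_PiE)
  also have "\<dots> \<le> (2 ^ Suc b) ^ (T * card X) * 2 ^ card J"
    by (intro mult_right_mono power_mono card_bool_lists_le) auto
  also have "\<dots> = 2 ^ (Suc b * (T * card X) + card J)"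
    by (simp only: power_mult[symmetric] power_add)
  finally show ?thesis .
qed

lemma transcript_of_in_transcripts:
  assumes "\<And>s u. length (message A s u) \<le> b"
  shows "transcript_of A E cls n J T low val \<omega> \<in> transcripts b T (cross E cls) J"
  using assms by (auto simp: transcript_of_def transcripts_def)

text \<open>Class \<open>j < t\<close> acts as player \<open>j\<close>, with \<open>enc\<close>
  spreading its set over its nodes; class \<open>t\<close> is the party without input. The factor in
  parentheses bounds the transcript length: \<open>b + 1\<close> bits per round and directed edge
  between classes, to allow for messages of varying length, and one answer bit for each of the
  \<open>t + 1\<close> classes.\<close>

theorem congest_promise_disjointness:
  fixes A :: congest_alg and enc :: "nat \<Rightarrow> nat set \<Rightarrow> nat option" and cls :: "nat \<Rightarrow> nat" and t :: nat
  defines "val \<equiv> \<lambda>S v. if cls v < t then enc v (S (cls v)) else None"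
  assumes t: "t = 2 ^ k" and E: "E \<subseteq> {..<n} \<times> {..<n}" and cls: "\<And>v. v < n \<Longrightarrow> cls v \<le> t"
    and b: "\<And>s u. length (message A s u) \<le> b" and q: "1 / 2 \<le> q"
    and disj: "\<And>i z y S. i < M \<Longrightarrow> (\<And>i. i < M \<Longrightarrow> z i < t) \<Longrightarrow>
        S = (\<lambda>j. {i'. i' < M \<and> i' \<noteq> i \<and> z i' = j \<and> y i'}) \<Longrightarrow>
        q \<le> success_prob A n E (val S) T (correct (val S)) \<and> (\<forall>a. correct (val S) a \<longrightarrow> low a)"
    and inter: "\<And>i z y S. i < M \<Longrightarrow> (\<And>i. i < M \<Longrightarrow> z i < t) \<Longrightarrow>
        S = (\<lambda>j. insert i {i'. i' < M \<and> i' \<noteq> i \<and> z i' = j \<and> y i'}) \<Longrightarrow>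
        q \<le> success_prob A n E (val S) T (correct (val S)) \<and> (\<forall>a. correct (val S) a \<longrightarrow> \<not> low a)"
  shows "real M * (2 * q - 1)\<^sup>2 \<le> 64 * real t * (real (Suc b) * (real T * real (card (cross E cls))) + real t + 1)"
proof -
  let ?P = "Pi_pmf {..<n} 0 (coins A)"
  let ?X = "cross E cls"
  define \<Omega> where "\<Omega> = transcripts b T ?X {..t}"
  define tr where "tr S = transcript_of A E cls n {..t} T low (val S)" for S
  define g where "g \<pi> j S = measure_pmf.prob ?P {\<omega>. consistent A E cls n T low \<pi> j (\<lambda>v. enc v S) \<omega>}" for \<pi> j S
  define g0 where "g0 \<pi> = measure_pmf.prob ?P {\<omega>. consistent A E cls n T low \<pi> t (\<lambda>v. None) \<omega>}" for \<pi>
  have finX: "finite ?X"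
    using finite_subset[OF E] by (auto simp: cross_def intro: finite_subset[of _ E])
  have fin: "finite \<Omega>" unfolding \<Omega>_def using finX by (rule finite_transcripts) simp
  have J: "cls u \<in> {..t}" if "(u, v) \<in> E" for u v using that E cls by auto
  have prob: "pmf (map_pmf (tr S) ?P) \<pi> = g0 \<pi> * (\<Prod>j<t. g \<pi> j (S j))" if "\<pi> \<in> \<Omega>" for \<pi> S
  proof -
    let ?C = "\<lambda>j. {\<omega>. consistent A E cls n T low \<pi> j (val S) \<omega>}"
    have "pmf (map_pmf (tr S) ?P) \<pi> = measure_pmf.prob ?P {\<omega>. \<forall>j\<in>{..t}. consistent A E cls n T low \<pi> j (val S) \<omega>}"
      unfolding pmf_map vimage_def tr_def
      using transcript_of_eq_iff[OF that[unfolded \<Omega>_def], of A n low "val S"] J by simp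
    also have "\<dots> = measure_pmf.expectation ?P (\<lambda>\<omega>. \<Prod>j\<in>{..t}. indicator (?C j) \<omega>)"
    proof -
      have "(\<Prod>j\<in>{..t}. indicator (?C j) \<omega>) =
          (indicator {\<omega>. \<forall>j\<in>{..t}. consistent A E cls n T low \<pi> j (val S) \<omega>} \<omega> :: real)" for \<omega>
        by (auto simp: indicator_def prod_zero_iff)
      then show ?thesis by simp
    qed
    also have "\<dots> = (\<Prod>j\<in>{..t}. measure_pmf.expectation ?P (indicator (?C j)))"
    proof (rule expectation_Pi_pmf_prod_blocks[where cls = cls])
      fix j and x y :: "nat \<Rightarrow> nat" assume "\<And>i. i \<in> {..<n} \<Longrightarrow> cls i = j \<Longrightarrow> x i = y i"
      then have "consistent A E cls n T low \<pi> j (val S) x = consistent A E cls n T low \<pi> j (val S) y"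
        by (intro consistent_cong[OF E]) auto
      then show "indicator (?C j) x = (indicator (?C j) y :: real)" by (simp add: indicator_def)
    qed auto
    also have "\<dots> = (\<Prod>j\<in>{..t}. measure_pmf.prob ?P (?C j))" by simp
    also have "{..t} = insert t {..<t}" by auto
    also have "(\<Prod>j\<in>insert t {..<t}. measure_pmf.prob ?P (?C j))
        = measure_pmf.prob ?P (?C t) * (\<Prod>j<t. measure_pmf.prob ?P (?C j))" by simp
    also have "measure_pmf.prob ?P (?C t) = g0 \<pi>"
      unfolding g0_def by (intro arg_cong2[where f = measure] refl Collect_cong consistent_cong[OF E]) (auto simp: val_def)
    also have "(\<Prod>j<t. measure_pmf.prob ?P (?C j)) = (\<Prod>j<t. g \<pi> j (S j))"
    proof (rule prod.cong[OF refl])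
      fix j assume "j \<in> {..<t}"
      then show "measure_pmf.prob ?P (?C j) = g \<pi> j (S j)"
        unfolding g_def by (intro arg_cong2[where f = measure] refl Collect_cong consistent_cong[OF E]) (auto simp: val_def)
    qed
    finally show ?thesis .
  qed
  \<comment> \<open>A successful run has an answer and all its answers are correct, so it has a low
    answer on disjoint inputs and none on intersecting ones.\<close>
  define F where "F = {\<pi> \<in> \<Omega>. \<exists>j\<le>t. snd \<pi> j}"
  have sum_eq: "(\<Sum>\<pi>\<in>G. g0 \<pi> * (\<Prod>j<t. g \<pi> j (S j))) = measure_pmf.prob ?P {\<omega>. tr S \<omega> \<in> G}"
    if "G \<subseteq> \<Omega>" for G S
  proof -
    have "finite G" using that fin finite_subset by blast
    then have "measure_pmf.prob (map_pmf (tr S) ?P) G = (\<Sum>\<pi>\<in>G. pmf (map_pmf (tr S) ?P) \<pi>)"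
      by (rule measure_measure_pmf_finite)
    also have "\<dots> = (\<Sum>\<pi>\<in>G. g0 \<pi> * (\<Prod>j<t. g \<pi> j (S j)))"
      using that prob by (intro sum.cong) auto
    finally show ?thesis by (simp add: vimage_def)
  qed
  have tr_in: "tr S \<omega> \<in> \<Omega>" for S \<omega>
    unfolding tr_def \<Omega>_def by (rule transcript_of_in_transcripts[OF b])
  have tr_F: "tr S \<omega> \<in> F \<longleftrightarrow> (\<exists>v<n. \<exists>y. answer A (view_after A E (val S) \<omega> T v) = Some y \<and> low y)" for S \<omega>
    using tr_in[of S \<omega>] cls by (auto simp: F_def tr_def transcript_of_def)
  have main: "real M * (2 * q - 1)\<^sup>2 \<le> 64 * real t * ln (real (card \<Omega>))"
  proof (rule promise_disjointness_transcripts[OF t fin, of g g0 F])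
    show "(\<Sum>\<pi>\<in>\<Omega>. g0 \<pi> * (\<Prod>j<t. g \<pi> j (S j))) = 1" for S
      unfolding sum_eq[OF subset_refl] by (simp add: tr_in)
    show "F \<subseteq> \<Omega>" by (auto simp: F_def)
    fix i :: nat and z :: "nat \<Rightarrow> nat" and y :: "nat \<Rightarrow> bool"
    assume iz: "i < M" "\<And>i. i < M \<Longrightarrow> z i < t"
    {
      define S where "S = (\<lambda>j. {i'. i' < M \<and> i' \<noteq> i \<and> z i' = j \<and> y i'})"
      have *: "q \<le> success_prob A n E (val S) T (correct (val S))" "\<And>a. correct (val S) a \<Longrightarrow> low a"
        using disj[OF iz S_def] by auto
      note *(1)
      also have "success_prob A n E (val S) T (correct (val S)) \<le> measure_pmf.prob ?P {\<omega>. tr S \<omega> \<in> F}"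
        unfolding success_prob_def
        by (rule measure_pmf.finite_measure_mono) (auto simp: tr_F *(2))
      also have "\<dots> = (\<Sum>\<pi>\<in>F. g0 \<pi> * (\<Prod>j<t. g \<pi> j (S j)))"
        by (rule sum_eq[symmetric]) (auto simp: F_def)
      finally show "q \<le> (\<Sum>\<pi>\<in>F. g0 \<pi> * (\<Prod>j<t. g \<pi> j {i'. i' < M \<and> i' \<noteq> i \<and> z i' = j \<and> y i'}))"
        by (simp add: S_def)
    next
      define S where "S = (\<lambda>j. insert i {i'. i' < M \<and> i' \<noteq> i \<and> z i' = j \<and> y i'})"
      have *: "q \<le> success_prob A n E (val S) T (correct (val S))" "\<And>a. correct (val S) a \<Longrightarrow> \<not> low a"
        using inter[OF iz S_def] by auto
      have "success_prob A n E (val S) T (correct (val S)) \<le> measure_pmf.prob ?P (UNIV - {\<omega>. tr S \<omega> \<in> F})"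
        unfolding success_prob_def
        by (rule measure_pmf.finite_measure_mono) (auto simp: tr_F dest!: *(2))
      also have "\<dots> = 1 - measure_pmf.prob ?P {\<omega>. tr S \<omega> \<in> F}"
        using measure_pmf.prob_compl[of "{\<omega>. tr S \<omega> \<in> F}" ?P] by simp
      also have "measure_pmf.prob ?P {\<omega>. tr S \<omega> \<in> F} = (\<Sum>\<pi>\<in>F. g0 \<pi> * (\<Prod>j<t. g \<pi> j (S j)))"
        by (rule sum_eq[symmetric]) (auto simp: F_def)
      finally show "(\<Sum>\<pi>\<in>F. g0 \<pi> * (\<Prod>j<t. g \<pi> j (insert i {i'. i' < M \<and> i' \<noteq> i \<and> z i' = j \<and> y i'}))) \<le> 1 - q"
        using *(1) by (simp add: S_def)
    }
  qed (use q in \<open>auto simp: g_def g0_def\<close>)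
  have "card \<Omega> > 0" using fin tr_in by (auto simp: card_gt_0_iff)
  moreover have "real (card \<Omega>) \<le> 2 ^ (Suc b * (T * card ?X) + Suc t)"
    using card_transcripts_le[OF finX, of "{..t}" b T]
    by (simp add: \<Omega>_def del: power_Suc)
  ultimately have "ln (real (card \<Omega>)) \<le> ln (2 ^ (Suc b * (T * card ?X) + Suc t))"
    by (intro ln_mono) auto
  also have "\<dots> = real (Suc b * (T * card ?X) + Suc t) * ln 2"
    by (subst ln_realpow) auto
  also have "\<dots> \<le> real (Suc b * (T * card ?X) + Suc t) * 1"
    using ln_2_less_1 by (intro mult_left_mono) auto
  finally have "ln (real (card \<Omega>)) \<le> real (Suc b) * (real T * real (card ?X)) + real t + 1"
    by (simp add: algebra_simps)
  then have "64 * real t * ln (real (card \<Omega>)) \<le> 64 * real t * (real (Suc b) * (real T * real (card ?X)) + real t + 1)"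
    by (intro mult_left_mono) auto
  with main show ?thesis by linarith
qed

section \<open>Double brooms and the diameter bound\<close>

lemma relpow_sym: "sym E \<Longrightarrow> (u, v) \<in> E ^^ m \<Longrightarrow> (v, u) \<in> E ^^ m"
proof (induction m arbitrary: u v)
  case (Suc m)
  from Suc.prems(2) obtain w where "(u, w) \<in> E ^^ m" "(w, v) \<in> E" by auto
  then have "(v, w) \<in> E" "(w, u) \<in> E ^^ m" using Suc symD by metis+
  then show ?case by (rule relpow_Suc_I2)
qed simp

text \<open>A potential that rises by at most 1 along an edge bounds distances from below, so no
  shortest path has to be analysed. It is integer-valued so that the branches of the star can be
  counted negatively.\<close>

lemma diameter_eqI:
  fixes \<phi> :: "nat \<Rightarrow> int"
  assumes walk: "\<And>u v. u < n \<Longrightarrow> v < n \<Longrightarrow> \<exists>m\<le>D. (u, v) \<in> E ^^ m"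
    and lip: "\<And>u v. (u, v) \<in> E \<Longrightarrow> \<phi> v \<le> \<phi> u + 1"
    and ends: "a < n" "b < n" "\<phi> b - \<phi> a = int D"
  shows "diameter n E = D" and "connected_graph n E"
proof -
  have le: "gdist E u v \<le> D" if uv: "u < n" "v < n" for u v
    using walk[OF that] Least_le[of "\<lambda>m. (u, v) \<in> E ^^ m"] unfolding gdist_def by (meson order_trans)
  have far: "\<phi> v \<le> \<phi> u + int m" if "(u, v) \<in> E ^^ m" for u v m
    using that
  proof (induction m arbitrary: v)
    case (Suc m)
    then obtain w where "(u, w) \<in> E ^^ m" "(w, v) \<in> E" by auto
    then show ?case using Suc.IH[of w] lip[of w v] by simp
  qed simp
  have "(a, b) \<in> E ^^ gdist E a b"
    unfolding gdist_def using walk[OF ends(1,2)] by (auto intro: LeastI)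
  from far[OF this] have ge: "D \<le> gdist E a b" using ends(3) by simp
  show "diameter n E = D" unfolding diameter_def
  proof (rule Max_eqI)
    show "finite {gdist E u v |u v. u < n \<and> v < n}"
      by (rule finite_subset[of _ "{..D}"]) (auto simp: le)
    show "D \<in> {gdist E u v |u v. u < n \<and> v < n}"
    proof -
      have "D = gdist E a b" using ge le[OF ends(1,2)] by simp
      then show ?thesis using ends(1,2) by blast
    qed
  qed (auto simp: le)
  show "connected_graph n E"
    unfolding connected_graph_def using walk by (meson relpow_imp_rtrancl)
qed

lemma level_walk:
  fixes lev :: "nat \<Rightarrow> nat"
  assumes adj: "\<And>u v. u \<in> V \<Longrightarrow> v \<in> V \<Longrightarrow> lev v = Suc (lev u) \<Longrightarrow> (u, v) \<in> E"
    and inh: "\<And>l. l \<le> L \<Longrightarrow> \<exists>w\<in>V. lev w = l"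
    and uv: "u \<in> V" "v \<in> V" "lev v \<le> L" "lev v = lev u + Suc d"
  shows "(u, v) \<in> E ^^ Suc d"
  using uv
proof (induction d arbitrary: v)
  case (Suc d)
  obtain w where w: "w \<in> V" "lev w = lev u + Suc d"
    using inh[of "lev u + Suc d"] Suc.prems by auto
  then have "(u, w) \<in> E ^^ Suc d" using Suc by auto
  moreover have "(w, v) \<in> E" using w Suc.prems by (intro adj) auto
  ultimately show ?case by (rule relpow_Suc_I)
qed (auto intro: adj)

text \<open>Nodes on different levels are joined by a monotone walk. Two nodes on the same level
  need a detour through an adjacent one, which takes 2 steps.\<close>

lemma level_dist_le:
  fixes lev :: "nat \<Rightarrow> nat"
  assumes sym: "sym E" and adj: "\<And>u v. u \<in> V \<Longrightarrow> v \<in> V \<Longrightarrow> lev v = Suc (lev u) \<Longrightarrow> (u, v) \<in> E"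
    and inh: "\<And>l. l \<le> L \<Longrightarrow> \<exists>w\<in>V. lev w = l" and L: "1 \<le> L" "L \<le> D" "2 \<le> D"
    and uv: "u \<in> V" "v \<in> V" "lev u \<le> L" "lev v \<le> L"
  shows "\<exists>m\<le>D. (u, v) \<in> E ^^ m"
proof -
  have up: "\<exists>m\<le>D. (u, v) \<in> E ^^ m" if "u \<in> V" "v \<in> V" "lev u < lev v" "lev v \<le> L" for u v
  proof -
    define d where "d = lev v - Suc (lev u)"
    then have d: "lev v = lev u + Suc d" using that by simp
    have "(u, v) \<in> E ^^ Suc d"
      by (rule level_walk[where V = V and lev = lev and L = L]) (fact adj inh that d)+
    moreover have "Suc d \<le> D" using d that(4) L(2) by linarith
    ultimately show ?thesis by blast
  qed
  consider "lev u < lev v" | "lev v < lev u" | "lev u = lev v" by linarith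
  then show ?thesis
  proof cases
    case 1
    then show ?thesis using up uv by blast
  next
    case 2
    then show ?thesis using up[of v u] uv relpow_sym[OF sym] by blast
  next
    case 3
    have "(if lev u = 0 then 1 else lev u - 1) \<le> L" using L uv by auto
    from inh[OF this] obtain w where w: "w \<in> V" "lev w = (if lev u = 0 then 1 else lev u - 1)" ..
    have "(u, w) \<in> E \<and> (w, v) \<in> E"
    proof (cases "lev u = 0")
      case True
      then show ?thesis using w uv 3 adj[of u w] adj[of v w] symD[OF sym] by auto
    next
      case False
      then show ?thesis using w uv 3 adj[of w u] adj[of w v] symD[OF sym] by auto
    qed
    then have "(u, v) \<in> E ^^ 2" by (auto simp: numeral_2_eq_2)
    then show ?thesis using L by blast
  qed
qed

text \<open>
  A double broom: a path with levels \<open>0..D\<close> in which the end levels are blown up to independent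
  sets. Nodes below \<open>(n + 1) div 2\<close> lie on the left half; the halves are joined by a single edge.
\<close>

definition broom_mid :: "nat \<Rightarrow> nat" where
  "broom_mid n = (n + 1) div 2"

text \<open>Nodes 0 and \<open>broom_mid n\<close> are the ends of the middle edge, and each half is
  numbered outwards. Truncated subtraction puts all surplus nodes of the left half on level 0, and
  \<open>min\<close> those of the right half on level \<open>D\<close>.\<close>

definition broom_lev :: "nat \<Rightarrow> nat \<Rightarrow> nat \<Rightarrow> nat" where
  "broom_lev n D v = (if v < broom_mid n then D div 2 - v
     else min D (D div 2 + 1 + (v - broom_mid n)))"

definition broom :: "nat \<Rightarrow> nat \<Rightarrow> (nat \<times> nat) set" where
  "broom n D = {(u, v). u < n \<and> v < n \<and>
     (broom_lev n D u = Suc (broom_lev n D v) \<or> broom_lev n D v = Suc (broom_lev n D u))}"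

definition broom_side :: "nat \<Rightarrow> nat \<Rightarrow> nat" where
  "broom_side n v = (if v < broom_mid n then 0 else 1)"

lemma broom_lev_le: "broom_lev n D v \<le> D"
  by (auto simp: broom_lev_def)

lemma broom_lev_surj:
  assumes "D < n" "l \<le> D"
  shows "\<exists>v<n. broom_lev n D v = l"
proof (cases "l \<le> D div 2")
  case True
  then show ?thesis using assms
    by (intro exI[of _ "D div 2 - l"]) (auto simp: broom_lev_def broom_mid_def)
next
  case False
  then show ?thesis using assms
    by (intro exI[of _ "broom_mid n + (l - D div 2 - 1)"]) (auto simp: broom_lev_def broom_mid_def)
qed

lemma simple_graph_broom: "simple_graph n (broom n D)"
  by (auto simp: simple_graph_def broom_def sym_def irrefl_def)

lemma
  assumes "3 \<le> D" "D < n"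
  shows diameter_broom: "diameter n (broom n D) = D" and connected_broom: "connected_graph n (broom n D)"
proof -
  obtain a b where ab: "a < n" "broom_lev n D a = 0" "b < n" "broom_lev n D b = D"
    using broom_lev_surj[OF assms(2), of 0] broom_lev_surj[OF assms(2), of D] by auto
  have sym: "sym (broom n D)" using simple_graph_broom by (simp add: simple_graph_def)
  have walk: "\<exists>m\<le>D. (u, v) \<in> broom n D ^^ m" if "u < n" "v < n" for u v
  proof (rule level_dist_le[where V = "{..<n}" and lev = "broom_lev n D" and L = D, OF sym])
    show "\<exists>w\<in>{..<n}. broom_lev n D w = l" if "l \<le> D" for l
      using broom_lev_surj[OF assms(2) that] by blast
  qed (use that assms broom_lev_le in \<open>simp_all add: broom_def\<close>)
  have lip: "int (broom_lev n D v) \<le> int (broom_lev n D u) + 1" if "(u, v) \<in> broom n D" for u v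
    using that by (auto simp: broom_def)
  from diameter_eqI[of n D "broom n D" "\<lambda>v. int (broom_lev n D v)" a b, OF walk lip] ab
  show "diameter n (broom n D) = D" "connected_graph n (broom n D)" by auto
qed

text \<open>For \<open>3 \<le> D\<close> the two middle levels are not end levels, so each contains
  a single node.\<close>

lemma cross_broom:
  assumes "3 \<le> D"
  shows "cross (broom n D) (broom_side n) \<subseteq> {(0, broom_mid n), (broom_mid n, 0)}"
proof -
  have "u = 0 \<and> v = broom_mid n"
    if "u < broom_mid n" "broom_mid n \<le> v" "broom_lev n D v \<le> Suc (broom_lev n D u)" for u v
    using that assms by (auto simp: broom_lev_def split: if_splits)
  note * = this
  show ?thesis
  proof
    fix e assume "e \<in> cross (broom n D) (broom_side n)"
    then obtain u v where e: "e = (u, v)" "broom_lev n D v \<le> Suc (broom_lev n D u)"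
        "broom_lev n D u \<le> Suc (broom_lev n D v)"
        "u < broom_mid n \<and> broom_mid n \<le> v \<or> v < broom_mid n \<and> broom_mid n \<le> u"
      by (auto simp: cross_def broom_def broom_side_def split: if_splits)
    then show "e \<in> {(0, broom_mid n), (broom_mid n, 0)}"
      using *[of u v] *[of v u] by auto
  qed
qed

text \<open>Information travels one edge per round. The nodes whose values differ lie where
  \<open>f \<le> 0\<close>, and \<open>f\<close> bounds the distance from there.\<close>

lemma view_after_eq_far:
  fixes f :: "nat \<Rightarrow> int"
  assumes lip: "\<And>u v. (u, v) \<in> E \<Longrightarrow> f v \<le> f u + 1"
    and val: "\<And>u. 0 < f u \<Longrightarrow> val u = val' u" and v: "int r < f v"
  shows "view_after A E val \<omega> r v = view_after A E val' \<omega> r v"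
  using v
proof (induction r arbitrary: v)
  case (Suc r)
  have "view_after A E val \<omega> r u = view_after A E val' \<omega> r u" if "(u, v) \<in> E" for u
    using lip[OF that] Suc.prems by (intro Suc.IH) simp
  moreover have "view_after A E val \<omega> r v = view_after A E val' \<omega> r v"
    using Suc.prems by (intro Suc.IH) simp
  ultimately show ?case by (auto simp: fun_eq_iff)
qed (simp add: val)

lemma prob_Int_ge: "measure_pmf.prob P X + measure_pmf.prob P Y - 1 \<le> measure_pmf.prob P (X \<inter> Y)"
proof -
  have "measure_pmf.prob P X \<le> measure_pmf.prob P ((X \<inter> Y) \<union> (UNIV - Y))"
    by (rule measure_pmf.finite_measure_mono) auto
  also have "\<dots> \<le> measure_pmf.prob P (X \<inter> Y) + measure_pmf.prob P (UNIV - Y)"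
    by (rule measure_Un_le) auto
  also have "measure_pmf.prob P (UNIV - Y) = 1 - measure_pmf.prob P Y"
    using measure_pmf.prob_compl[of Y P] by simp
  finally show ?thesis by simp
qed

text \<open>The bound 2/3 is due to comparing three runs on common seeds: all NULL, and a single
  value at either end. With positive probability all three succeed, and then the node answering 0 in
  the first run errs in one of the others.\<close>

lemma diameter_le_twice_rounds:
  assumes D: "3 \<le> D" "D < n" and N: "1 \<le> N" and q: "2 / 3 < q"
    and solves: "congest_solves B q n N D correct T A"
    and zero: "\<And>y. correct (\<lambda>_. None) y \<Longrightarrow> y = 0"
    and single: "\<And>a. a < n \<Longrightarrow> \<not> correct (\<lambda>v. if v = a then Some 1 else None) 0"
  shows "D \<le> 2 * T"
proof (rule ccontr)
  assume T: "\<not> D \<le> 2 * T"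
  let ?E = "broom n D" and ?P = "Pi_pmf {..<n} 0 (coins A)"
  let ?one = "\<lambda>a v. if v = a then Some 1 else None :: nat option"
  define S where "S val = {\<omega>. (\<exists>v<n. answer A (view_after A ?E val \<omega> T v) \<noteq> None) \<and>
            (\<forall>v<n. \<forall>y. answer A (view_after A ?E val \<omega> T v) = Some y \<longrightarrow> correct val y)}" for val
  obtain a b where ab: "a < n" "broom_lev n D a = 0" "b < n" "broom_lev n D b = D"
    using broom_lev_surj[OF D(2), of 0] broom_lev_surj[OF D(2), of D] by auto
  have S: "q \<le> measure_pmf.prob ?P (S val)" if "valid_vals n N val" for val
    using solves that simple_graph_broom diameter_broom[OF D] connected_broom[OF D]
    unfolding congest_solves_def success_prob_def S_def by blast
  have "q \<le> measure_pmf.prob ?P (S (\<lambda>_. None))" "q \<le> measure_pmf.prob ?P (S (?one a))"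
    "q \<le> measure_pmf.prob ?P (S (?one b))"
    using N by (auto intro!: S simp: valid_vals_def)
  then have "0 < measure_pmf.prob ?P (S (\<lambda>_. None) \<inter> S (?one a) \<inter> S (?one b))"
    using prob_Int_ge[of ?P "S (\<lambda>_. None)" "S (?one a)"]
      prob_Int_ge[of ?P "S (\<lambda>_. None) \<inter> S (?one a)" "S (?one b)"] q by linarith
  then have "S (\<lambda>_. None) \<inter> S (?one a) \<inter> S (?one b) \<noteq> {}" by force
  then obtain \<omega> where \<omega>: "\<omega> \<in> S (\<lambda>_. None)" "\<omega> \<in> S (?one a)" "\<omega> \<in> S (?one b)" by blast
  obtain v y where vy: "v < n" "answer A (view_after A ?E (\<lambda>_. None) \<omega> T v) = Some y"
    using \<omega>(1) unfolding S_def by blast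
  then have "y = 0" using \<omega>(1) zero unfolding S_def by blast
  with vy have v: "v < n" "answer A (view_after A ?E (\<lambda>_. None) \<omega> T v) = Some 0" by simp_all
  have "T < broom_lev n D v \<or> T + broom_lev n D v < D" using T by linarith
  then show False
  proof
    assume far: "T < broom_lev n D v"
    have "view_after A ?E (?one a) \<omega> T v = view_after A ?E (\<lambda>_. None) \<omega> T v"
      by (rule view_after_eq_far[where f = "\<lambda>v. int (broom_lev n D v)"]) (use far ab in \<open>auto simp: broom_def\<close>)
    then have "correct (?one a) 0" using v \<omega>(2) by (simp add: S_def)
    then show False using single[OF ab(1)] by contradiction
  next
    assume far: "T + broom_lev n D v < D"
    have "view_after A ?E (?one b) \<omega> T v = view_after A ?E (\<lambda>_. None) \<omega> T v"
      by (rule view_after_eq_far[where f = "\<lambda>v. int D - int (broom_lev n D v)"]) (use far ab in \<open>auto simp: broom_def\<close>)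
    then have "correct (?one b) 0" using v \<omega>(3) by (simp add: S_def)
    then show False using single[OF ab(3)] by contradiction
  qed
qed

text \<open>Since \<open>0 powr 0 = 0\<close>, the case \<open>p = 0\<close> needs no separate
  treatment from here on.\<close>

lemma moment_eq_sum_powr: "moment p n N val = (\<Sum>i=1..N. real (freq n val i) powr p)"
proof (cases "p = 0")
  case True
  have "(\<Sum>i=1..N. real (freq n val i) powr 0) = (\<Sum>i=1..N. if freq n val i > 0 then 1 else 0)"
    by (intro sum.cong refl) auto
  also have "\<dots> = real (card {i \<in> {1..N}. freq n val i > 0})"
    by (simp add: sum.If_cases Int_def)
  finally show ?thesis by (simp add: moment_def True)
qed (simp add: moment_def)

lemma moment_None: "moment p n N (\<lambda>_. None) = 0"
  by (simp add: moment_eq_sum_powr freq_def)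

lemma moment_single:
  assumes "a < n" "1 \<le> N"
  shows "moment p n N (\<lambda>v. if v = a then Some 1 else None) = 1"
proof -
  have f: "freq n (\<lambda>v. if v = a then Some 1 else None) i = (if i = 1 then 1 else 0)" for i
  proof -
    have "{v. v < n \<and> (if v = a then Some 1 else None) = Some i} = (if i = 1 then {a} else {})"
      using assms by auto
    then show ?thesis by (simp add: freq_def)
  qed
  have "moment p n N (\<lambda>v. if v = a then Some 1 else None) = (\<Sum>i=1..N. if i = 1 then 1 else 0)"
    unfolding moment_eq_sum_powr f by (rule sum.cong) auto
  then show ?thesis using assms(2) by simp
qed

section \<open>Stars and large moments\<close>

text \<open>
  The graph for \<open>t\<close> players: node 0 is the centre, player \<open>j < t\<close> owns the block of \<open>w\<close> nodes
  starting at the hub \<open>j * w + 1\<close>, and class \<open>t\<close> consists of the centre, a path of length \<open>D - 2\<close>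
  that fixes the diameter, and all remaining nodes.
\<close>

definition star_cls :: "nat \<Rightarrow> nat \<Rightarrow> nat \<Rightarrow> nat" where
  "star_cls t w v = (if v = 0 \<or> t * w < v then t else (v - 1) div w)"

text \<open>Hubs have level 1 and the rest of a block level 2. Leftover nodes get level 1, which
  attaches them to the centre without making class \<open>t\<close> deeper.\<close>

definition star_lev :: "nat \<Rightarrow> nat \<Rightarrow> nat \<Rightarrow> nat \<Rightarrow> nat" where
  "star_lev t w D v =
     (if v = 0 then 0
      else if v \<le> t * w then if (v - 1) mod w = 0 then 1 else 2
      else if v \<le> t * w + (D - 2) then v - t * w else 1)"

definition star :: "nat \<Rightarrow> nat \<Rightarrow> nat \<Rightarrow> nat \<Rightarrow> (nat \<times> nat) set" where
  "star n t w D = {(u, v). u < n \<and> v < n \<and>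
     (star_lev t w D u = Suc (star_lev t w D v) \<or> star_lev t w D v = Suc (star_lev t w D u)) \<and>
     (star_cls t w u = star_cls t w v \<or> u = 0 \<or> v = 0)}"

lemma star_lev_eq_0_iff: "star_lev t w D v = 0 \<longleftrightarrow> v = 0"
  by (auto simp: star_lev_def)

lemma star_cls_le:
  assumes "w > 0"
  shows "star_cls t w v \<le> t"
proof -
  have "(v - 1) div w \<le> t" if "v \<le> t * w"
    using that by (metis assms diff_le_self div_le_mono le_trans nonzero_mult_div_cancel_right not_less0)
  then show ?thesis by (auto simp: star_cls_def)
qed

lemma star_cls_block:
  assumes "j < t" "e < w"
  shows "star_cls t w (Suc (j * w + e)) = j" and "Suc (j * w + e) \<le> t * w"
proof -
  have "Suc j * w \<le> t * w" using assms by (intro mult_le_mono1) simp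
  then show *: "Suc (j * w + e) \<le> t * w" using assms by simp
  show "star_cls t w (Suc (j * w + e)) = j" using * assms by (simp add: star_cls_def)
qed

lemma star_cls_lessD:
  assumes "star_cls t w v < t" "w > 0"
  obtains e where "e < w" "Suc (star_cls t w v * w + e) = v" "(v - 1) mod w = e" "v \<le> t * w"
proof -
  have v: "v \<noteq> 0" "v \<le> t * w" "star_cls t w v = (v - 1) div w"
    using assms by (auto simp: star_cls_def split: if_splits)
  show thesis
    by (rule that[of "(v - 1) mod w"]) (use v assms in \<open>simp_all add: div_mult_mod_eq\<close>)
qed

lemma simple_graph_star: "simple_graph n (star n t w D)"
  by (auto simp: simple_graph_def star_def sym_def irrefl_def)

context
  fixes n t w D :: nat
  assumes D: "4 \<le> D" and w: "2 \<le> w" and t: "1 \<le> t" and n: "t * w + D \<le> n + 1"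
begin

private abbreviation "lev \<equiv> star_lev t w D"
private abbreviation "cls \<equiv> star_cls t w"
text \<open>A class together with the centre. Within such a set consecutive levels are completely
  joined, as the level lemmas demand; across two classes this fails.\<close>

private definition "V j = insert 0 {v. v < n \<and> cls v = j}"
private definition "L j = (if j < t then 2 else D - 2)"

private lemma lev_le_L: "v \<in> V j \<Longrightarrow> lev v \<le> L j"
  using D by (auto simp: V_def L_def star_lev_def star_cls_def)

private lemma lev_inhabited:
  assumes "j \<le> t" "l \<le> L j"
  shows "\<exists>v\<in>V j. lev v = l"
proof (cases "l = 0")
  case True
  then show ?thesis by (auto simp: V_def star_lev_def)
next
  case False
  show ?thesis
  proof (cases "j < t")
    case True
    define e where "e = l - 1"
    have e: "e < w" "l = Suc e" "e \<le> 1" using False assms w True by (auto simp: L_def e_def)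
    have "Suc (j * w + e) < n" using star_cls_block(2)[OF True e(1)] n D by linarith
    moreover have "lev (Suc (j * w + e)) = l"
      using star_cls_block(2)[OF True e(1)] e by (auto simp: star_lev_def)
    ultimately show ?thesis using star_cls_block(1)[OF True e(1)] by (auto simp: V_def)
  next
    case j: False
    then have "l \<le> D - 2" "j = t" using assms by (auto simp: L_def)
    then show ?thesis using False n D
      by (intro bexI[of _ "t * w + l"]) (auto simp: V_def star_lev_def star_cls_def)
  qed
qed

private lemma adjacent_in_V:
  "n > 0 \<Longrightarrow> u \<in> V j \<Longrightarrow> v \<in> V j \<Longrightarrow> lev v = Suc (lev u) \<Longrightarrow> (u, v) \<in> star n t w D"
  by (auto simp: V_def star_def)

lemma diameter_star: "diameter n (star n t w D) = D"
  and connected_star: "connected_graph n (star n t w D)"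
proof -
  have sym: "sym (star n t w D)" using simple_graph_star by (simp add: simple_graph_def)
  have n0: "n > 0" using n D by simp
  have L: "1 \<le> L j" "L j \<le> D - 2" "L j \<le> D" for j using D by (auto simp: L_def)
  have in_V: "v \<in> V (cls v)" if "v < n" for v using that by (simp add: V_def)
  have clst: "cls v \<le> t" for v using w by (intro star_cls_le) simp
  have to_root: "(0, v) \<in> star n t w D ^^ lev v" if "v < n" for v
  proof (cases "lev v")
    case 0
    then have "v = 0" by (simp add: star_lev_eq_0_iff)
    with 0 show ?thesis by simp
  next
    case (Suc d)
    have "(0, v) \<in> star n t w D ^^ Suc d"
    proof (rule level_walk[where V = "V (cls v)" and lev = lev and L = "L (cls v)"])
      show "\<exists>w\<in>V (cls v). lev w = l" if "l \<le> L (cls v)" for l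
        using lev_inhabited[OF clst that] .
      show "0 \<in> V (cls v)" by (simp add: V_def)
      show "lev v = lev 0 + Suc d" using Suc by (simp add: star_lev_def)
    qed (use adjacent_in_V n0 in_V[OF that] lev_le_L in auto)
    then show ?thesis using Suc by simp
  qed
  have walk: "\<exists>m\<le>D. (u, v) \<in> star n t w D ^^ m" if uv: "u < n" "v < n" for u v
  proof (cases "cls u = cls v")
    case True
    show ?thesis
    proof (rule level_dist_le[where V = "V (cls v)" and lev = lev and L = "L (cls v)", OF sym])
      show "\<exists>w\<in>V (cls v). lev w = l" if "l \<le> L (cls v)" for l
        using lev_inhabited[OF clst that] .
    qed (use adjacent_in_V n0 in_V[OF uv(1)] in_V[OF uv(2)] lev_le_L L True D in auto)
  next
    case False
    \<comment> \<open>Two branches contribute 2 + 2, which requires \<open>4 \<le> D\<close>; a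
      branch and the path contribute \<open>2 + (D - 2)\<close>.\<close>
    have "L (cls u) + L (cls v) \<le> D"
      using False clst[of u] clst[of v] D by (auto simp: L_def)
    then have "lev u + lev v \<le> D" using lev_le_L[OF in_V[OF uv(1)]] lev_le_L[OF in_V[OF uv(2)]] by simp
    moreover have "(u, v) \<in> star n t w D ^^ (lev u + lev v)"
      unfolding relpow_add using relpow_sym[OF sym to_root[OF uv(1)]] to_root[OF uv(2)] by auto
    ultimately show ?thesis by blast
  qed
  \<comment> \<open>Rises from -2 at a branch node of level 2, through 0 at the centre, to
    \<open>D - 2\<close> at the end of the path.\<close>
  define \<phi> where "\<phi> v = (if cls v = t then int (lev v) else - int (lev v))" for v
  have lip: "\<phi> v \<le> \<phi> u + 1" if "(u, v) \<in> star n t w D" for u v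
  proof -
    have "cls 0 = t" "lev 0 = 0" by (simp_all add: star_cls_def star_lev_def)
    then show ?thesis using that by (auto simp: \<phi>_def star_def)
  qed
  have two: "Suc (0 * w + 1) < n" "cls (Suc (0 * w + 1)) = 0"
    using star_cls_block[of 0 t 1 w] t w n D by linarith+
  have "\<phi> (Suc (0 * w + 1)) = - 2"
    unfolding \<phi>_def two using star_cls_block(2)[of 0 t 1 w] t w by (simp add: star_lev_def)
  moreover have "\<phi> (t * w + (D - 2)) = int (D - 2)"
    using D by (simp add: \<phi>_def star_cls_def star_lev_def)
  ultimately have "\<phi> (t * w + (D - 2)) - \<phi> (Suc (0 * w + 1)) = int D" using D by simp
  moreover have "t * w + (D - 2) < n" using n D by simp
  ultimately show "diameter n (star n t w D) = D" "connected_graph n (star n t w D)"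
    using diameter_eqI[of n D "star n t w D" \<phi>, OF walk lip two(1)] by blast+
qed

end

lemma card_cross_star:
  assumes "w > 0"
  shows "card (cross (star n t w D) (star_cls t w)) \<le> 2 * t"
proof -
  let ?hub = "\<lambda>j. Suc (j * w)"
  have hub: "v \<in> ?hub ` {..<t}" if "star_cls t w v \<noteq> t" "star_lev t w D v = 1" for v
  proof -
    have less: "star_cls t w v < t" using that star_cls_le[OF assms, of t v] by simp
    obtain e where e: "e < w" "Suc (star_cls t w v * w + e) = v" "(v - 1) mod w = e" "v \<le> t * w"
      by (rule star_cls_lessD[OF less assms])
    then have "v \<noteq> 0" by auto
    then have "star_lev t w D v = (if e = 0 then 1 else 2)" unfolding star_lev_def e(3) using e(4) by simp
    then have "e = 0" using that(2) by (metis numeral_eq_one_iff semiring_norm(85))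
    then have "v = ?hub (star_cls t w v)" using e(2) by (metis add_0_right)
    moreover have "star_cls t w v \<in> {..<t}" using less by simp
    ultimately show ?thesis by (rule image_eqI)
  qed
  have "cross (star n t w D) (star_cls t w) \<subseteq> (\<lambda>j. (0, ?hub j)) ` {..<t} \<union> (\<lambda>j. (?hub j, 0)) ` {..<t}"
  proof
    fix e assume "e \<in> cross (star n t w D) (star_cls t w)"
    then obtain u v where e: "e = (u, v)" "star_cls t w u \<noteq> star_cls t w v" "u = 0 \<or> v = 0"
        "star_lev t w D u = Suc (star_lev t w D v) \<or> star_lev t w D v = Suc (star_lev t w D u)"
      by (auto simp: cross_def star_def)
    have 0: "star_cls t w 0 = t" "star_lev t w D 0 = 0" by (simp_all add: star_cls_def star_lev_def)
    from e(3) show "e \<in> (\<lambda>j. (0, ?hub j)) ` {..<t} \<union> (\<lambda>j. (?hub j, 0)) ` {..<t}"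
    proof
      assume "u = 0"
      then have "v \<in> ?hub ` {..<t}" using e 0 by (intro hub) auto
      then show ?thesis using e \<open>u = 0\<close> by auto
    next
      assume "v = 0"
      then have "u \<in> ?hub ` {..<t}" using e 0 by (intro hub) auto
      then show ?thesis using e \<open>v = 0\<close> by auto
    qed
  qed
  then have "card (cross (star n t w D) (star_cls t w))
      \<le> card ((\<lambda>j. (0, ?hub j)) ` {..<t} \<union> (\<lambda>j. (?hub j, 0 :: nat)) ` {..<t})"
    by (intro card_mono) auto
  also have "\<dots> \<le> card ((\<lambda>j. (0 :: nat, ?hub j)) ` {..<t}) + card ((\<lambda>j. (?hub j, 0 :: nat)) ` {..<t})"
    by (rule card_Un_le)
  also have "\<dots> \<le> t + t"
    by (intro add_mono) (metis card_image_le card_lessThan finite_lessThan)+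
  finally show ?thesis by simp
qed

text \<open>
  A player whose set does not fit into its \<open>w\<close> nodes holds nothing. The sets of the hard distribution
  have total size about \<open>M\<close>, so for \<open>t * w \<ge> 2 * M\<close> this affects at most half of the players.
\<close>

definition star_enc :: "nat \<Rightarrow> nat \<Rightarrow> nat set \<Rightarrow> nat option" where
  "star_enc w v S = (if card S \<le> w \<and> (v - 1) mod w < card S
     then Some (Suc (sorted_list_of_set S ! ((v - 1) mod w))) else None)"

definition star_val :: "nat \<Rightarrow> nat \<Rightarrow> (nat \<Rightarrow> nat set) \<Rightarrow> vals" where
  "star_val t w S v = (if star_cls t w v < t then star_enc w v (S (star_cls t w v)) else None)"

lemma star_val_SomeD:
  assumes "star_val t w S v = Some c" "\<And>j. finite (S j)"
  shows "star_cls t w v < t" "card (S (star_cls t w v)) \<le> w" "(v - 1) mod w < card (S (star_cls t w v))"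
    "c = Suc (sorted_list_of_set (S (star_cls t w v)) ! ((v - 1) mod w))"
    "\<exists>i\<in>S (star_cls t w v). c = Suc i"
proof -
  show 1: "star_cls t w v < t" "card (S (star_cls t w v)) \<le> w" "(v - 1) mod w < card (S (star_cls t w v))"
    "c = Suc (sorted_list_of_set (S (star_cls t w v)) ! ((v - 1) mod w))"
    using assms by (auto simp: star_val_def star_enc_def split: if_splits)
  have "sorted_list_of_set (S (star_cls t w v)) ! ((v - 1) mod w) \<in> set (sorted_list_of_set (S (star_cls t w v)))"
    using 1 by (intro nth_mem) simp
  then show "\<exists>i\<in>S (star_cls t w v). c = Suc i" using 1 assms by auto
qed

text \<open>A player that fits stores each element at exactly one node, given by its position in the
  sorted list. Hence \<open>star_cls\<close> maps the nodes holding the value bijectively to the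
  players counted on the right.\<close>

lemma freq_star_val:
  assumes w: "w > 0" and n: "t * w < n" and fin: "\<And>j. finite (S j)"
  shows "freq n (star_val t w S) (Suc i) = card {j. j < t \<and> i \<in> S j \<and> card (S j) \<le> w}"
proof -
  let ?X = "{v. v < n \<and> star_val t w S v = Some (Suc i)}"
  have inj: "inj_on (star_cls t w) ?X"
  proof (rule inj_onI)
    fix u v assume u: "u \<in> ?X" and v: "v \<in> ?X" and eq: "star_cls t w u = star_cls t w v"
    let ?xs = "sorted_list_of_set (S (star_cls t w v))"
    have su: "star_val t w S u = Some (Suc i)" and sv: "star_val t w S v = Some (Suc i)" using u v by auto
    note U = star_val_SomeD[OF su fin, unfolded eq] and V = star_val_SomeD[OF sv fin]
    have "?xs ! ((u - 1) mod w) = ?xs ! ((v - 1) mod w)" using U(4) V(4) by simp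
    then have "(u - 1) mod w = (v - 1) mod w"
      using U(3) V(3) by (subst (asm) nth_eq_iff_index_eq) auto
    moreover obtain e where "Suc (star_cls t w u * w + e) = u" "(u - 1) mod w = e"
      by (rule star_cls_lessD[of t w u]) (use U(1) eq w in auto)
    moreover obtain e' where "Suc (star_cls t w v * w + e') = v" "(v - 1) mod w = e'"
      by (rule star_cls_lessD[of t w v]) (use V(1) w in auto)
    ultimately show "u = v" using eq by metis
  qed
  have img: "star_cls t w ` ?X = {j. j < t \<and> i \<in> S j \<and> card (S j) \<le> w}"
  proof (intro subset_antisym subsetI)
    fix j assume "j \<in> star_cls t w ` ?X"
    then obtain v where v: "star_val t w S v = Some (Suc i)" "j = star_cls t w v" by auto
    then show "j \<in> {j. j < t \<and> i \<in> S j \<and> card (S j) \<le> w}"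
      using star_val_SomeD[OF v(1) fin] by auto
  next
    fix j assume "j \<in> {j. j < t \<and> i \<in> S j \<and> card (S j) \<le> w}"
    then have j: "j < t" "i \<in> S j" "card (S j) \<le> w" by auto
    have "i \<in> set (sorted_list_of_set (S j))" using j fin by simp
    then obtain e where e: "e < card (S j)" "sorted_list_of_set (S j) ! e = i"
      by (auto simp: in_set_conv_nth)
    have ew: "e < w" using e j by simp
    have "star_val t w S (Suc (j * w + e)) = Some (Suc i)"
      using star_cls_block[OF j(1) ew] e j ew by (simp add: star_val_def star_enc_def)
    moreover have "Suc (j * w + e) < n" using star_cls_block(2)[OF j(1) ew] n by simp
    ultimately show "j \<in> star_cls t w ` ?X"
      using star_cls_block(1)[OF j(1) ew] by (intro image_eqI[of _ _ "Suc (j * w + e)"]) auto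
  qed
  show ?thesis unfolding freq_def img[symmetric] by (rule card_image[OF inj, symmetric])
qed

lemma moment_eq_sum_lessThan: "moment p n N val = (\<Sum>i<N. real (freq n val (Suc i)) powr p)"
  unfolding moment_eq_sum_powr by (rule sum.reindex_bij_witness[of _ Suc "\<lambda>i. i - 1"]) auto

lemma valid_star_val:
  assumes "M \<le> N" "\<And>j. S j \<subseteq> {..<M}"
  shows "valid_vals n N (star_val t w S)"
proof -
  have fin: "finite (S j)" for j using assms(2) finite_subset by blast
  show ?thesis unfolding valid_vals_def
    using star_val_SomeD(5)[OF _ fin] assms by fastforce
qed

lemma moment_star_val_disjoint:
  assumes w: "w > 0" and n: "t * w < n" and M: "M \<le> N"
    and S: "\<And>j. S j \<subseteq> {..<M}" "\<And>j j'. j \<noteq> j' \<Longrightarrow> S j \<inter> S j' = {}" and p: "p \<ge> 0"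
  shows "moment p n N (star_val t w S) \<le> real M"
proof -
  have fin: "finite (S j)" for j using S(1) finite_subset by blast
  have "real (freq n (star_val t w S) (Suc i)) powr p \<le> (if i < M then 1 else 0)" for i
  proof -
    let ?J = "{j. j < t \<and> i \<in> S j \<and> card (S j) \<le> w}"
    have "card ?J \<le> Suc 0"
      by (rule card_le_Suc0_iff_eq[THEN iffD2]) (use S(2) in auto)
    moreover have "?J = {}" if "\<not> i < M" using S(1) that by fastforce
    ultimately have "real (card ?J) \<le> 1" "\<not> i < M \<Longrightarrow> card ?J = 0" by simp_all
    then show ?thesis unfolding freq_star_val[OF w n fin]
      using powr_mono2[of p "real (card ?J)" 1] p by (cases "i < M") auto
  qed
  then have "moment p n N (star_val t w S) \<le> (\<Sum>i<N. if i < M then 1 else 0)"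
    unfolding moment_eq_sum_lessThan by (intro sum_mono) simp
  also have "\<dots> = real (card {i. i < N \<and> i < M})"
    by (simp add: sum.If_cases Int_def)
  also have "{i. i < N \<and> i < M} = {..<M}" using M by auto
  finally show ?thesis by simp
qed

lemma moment_star_val_intersecting:
  fixes t :: nat
  assumes w: "w > 0" and n: "t * w < n" and M: "M \<le> N" "i < M" and cap: "2 * M \<le> t * w"
    and S: "S = (\<lambda>j. insert i {i'. i' < M \<and> i' \<noteq> i \<and> z i' = j \<and> y i'})" and p: "p \<ge> 0"
  shows "(real t / 2) powr p \<le> moment p n N (star_val t w S)"
proof -
  have fin: "finite (S j)" for j by (simp add: S)
  define S0 where "S0 j = {i'. i' < M \<and> i' \<noteq> i \<and> z i' = j \<and> y i'}" for j
  define bad where "bad = {j. j < t \<and> w < card (S j)}"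
  define good where "good = {j. j < t \<and> i \<in> S j \<and> card (S j) \<le> w}"
  \<comment> \<open>A player that does not fit has at least \<open>w\<close> elements besides
    \<open>i\<close>. These remainders are disjoint, so there are at most
    \<open>M / w \<le> t / 2\<close> such players, and the others give the common element frequency
    at least \<open>t / 2\<close>.\<close>
  have "card bad * w = (\<Sum>j\<in>bad. w)" by simp
  also have "\<dots> \<le> (\<Sum>j\<in>bad. card (S0 j))"
    by (rule sum_mono) (auto simp: bad_def S S0_def card_insert_if split: if_splits)
  also have "\<dots> = card (\<Union>j\<in>bad. S0 j)"
    by (rule card_UN_disjoint[symmetric]) (auto simp: bad_def S0_def)
  also have "\<dots> \<le> card {..<M}" by (intro card_mono) (auto simp: S0_def)
  finally have "2 * (card bad * w) \<le> t * w" using cap unfolding card_lessThan by linarith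
  then have "2 * card bad \<le> t" using w by (metis mult.assoc mult_le_cancel2)
  moreover have "card bad + card good = t"
  proof -
    have "card bad + card good = card (bad \<union> good)"
      by (rule card_Un_disjoint[symmetric]) (auto simp: bad_def good_def)
    also have "bad \<union> good = {..<t}" by (auto simp: bad_def good_def S)
    finally show ?thesis by simp
  qed
  ultimately have "real t / 2 \<le> real (card good)" by simp
  then have "(real t / 2) powr p \<le> real (card good) powr p" using p by (intro powr_mono2) auto
  also have "\<dots> = real (freq n (star_val t w S) (Suc i)) powr p"
    unfolding freq_star_val[OF w n fin] good_def ..
  also have "\<dots> \<le> moment p n N (star_val t w S)"
    unfolding moment_eq_sum_lessThan using M by (intro member_le_sum) auto
  finally show ?thesis .
qed

lemma congest_star_bound:
  assumes D: "4 \<le> D" and w: "2 \<le> w" and t: "t = 2 ^ k" and n: "t * w + D \<le> n + 1"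
    and M: "1 \<le> M" "M \<le> N" and cap: "2 * M \<le> t * w" and p: "p \<ge> 0"
    and big: "2 * real M \<le> (real t / 2) powr p" and q: "1 / 2 \<le> q"
    and b: "\<And>s u. length (message A s u) \<le> b"
    and solves: "congest_solves B q n N D (approx_moment p (1 / 10) n N) T A"
  shows "real M * (2 * q - 1)\<^sup>2 \<le> 64 * real t * (real (Suc b) * (real T * (2 * real t)) + real t + 1)"
proof -
  let ?E = "star n t w D" and ?cls = "star_cls t w"
  have t1: "1 \<le> t" by (simp add: t)
  have w0: "w > 0" and tn: "t * w < n" using w n D by auto
  have succ: "q \<le> success_prob A n ?E val T (approx_moment p (1 / 10) n N val)" if "valid_vals n N val" for val
    using solves that simple_graph_star diameter_star[OF D w t1 n] connected_star[OF D w t1 n]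
    unfolding congest_solves_def by blast
  \<comment> \<open>Disjoint inputs have moment at most \<open>M\<close>, hence answers up to
    \<open>11 / 10 * M\<close>; intersecting ones have moment at least \<open>2 * M\<close>, hence
    answers from \<open>18 / 10 * M\<close> on.\<close>
  define low where "low y \<longleftrightarrow> y \<le> 11 / 10 * real M" for y :: real
  have sv: "(\<lambda>v. if ?cls v < t then star_enc w v (S (?cls v)) else None) = star_val t w S" for S
    by (simp add: star_val_def fun_eq_iff)
  have "real M * (2 * q - 1)\<^sup>2 \<le> 64 * real t * (real (Suc b) * (real T * real (card (cross ?E ?cls))) + real t + 1)"
  proof (rule congest_promise_disjointness[where cls = ?cls and enc = "star_enc w" and low = low
        and correct = "approx_moment p (1 / 10) n N", OF t _ star_cls_le[OF w0] b q, unfolded sv])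
    show "?E \<subseteq> {..<n} \<times> {..<n}" by (auto simp: star_def)
    fix i :: nat and z :: "nat \<Rightarrow> nat" and y S
    assume i: "i < M"
    {
      assume S: "S = (\<lambda>j. {i'. i' < M \<and> i' \<noteq> i \<and> z i' = j \<and> y i'})"
      have sub: "S j \<subseteq> {..<M}" for j by (auto simp: S)
      have valid: "valid_vals n N (star_val t w S)" by (rule valid_star_val[OF M(2) sub])
      have mom: "moment p n N (star_val t w S) \<le> real M"
        by (rule moment_star_val_disjoint[OF w0 tn M(2) sub _ p]) (auto simp: S)
      have "low a" if "approx_moment p (1 / 10) n N (star_val t w S) a" for a
        using that mom by (simp add: approx_moment_def low_def)
      then show "q \<le> success_prob A n ?E (star_val t w S) T (approx_moment p (1 / 10) n N (star_val t w S))
          \<and> (\<forall>a. approx_moment p (1 / 10) n N (star_val t w S) a \<longrightarrow> low a)"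
        using succ[OF valid] by blast
    next
      assume S: "S = (\<lambda>j. insert i {i'. i' < M \<and> i' \<noteq> i \<and> z i' = j \<and> y i'})"
      have sub: "S j \<subseteq> {..<M}" for j using i by (auto simp: S)
      have valid: "valid_vals n N (star_val t w S)" by (rule valid_star_val[OF M(2) sub])
      have mom: "2 * real M \<le> moment p n N (star_val t w S)"
        using big moment_star_val_intersecting[OF w0 tn M(2) i cap S p] by linarith
      have "\<not> low a" if "approx_moment p (1 / 10) n N (star_val t w S) a" for a
        using that mom M(1) by (simp add: approx_moment_def low_def)
      then show "q \<le> success_prob A n ?E (star_val t w S) T (approx_moment p (1 / 10) n N (star_val t w S))
          \<and> (\<forall>a. approx_moment p (1 / 10) n N (star_val t w S) a \<longrightarrow> \<not> low a)"
        using succ[OF valid] by blast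
    }
  qed
  also have "\<dots> \<le> 64 * real t * (real (Suc b) * (real T * (2 * real t)) + real t + 1)"
  proof -
    have "real (card (cross ?E ?cls)) \<le> 2 * real t"
      using of_nat_mono[OF card_cross_star[OF w0, of n t D], where 'a = real] by simp
    then show ?thesis by (intro mult_left_mono add_right_mono) auto
  qed
  finally show ?thesis .
qed

section \<open>Two-party reductions\<close>

definition pair_val :: "nat \<Rightarrow> nat \<Rightarrow> (nat \<Rightarrow> nat) \<Rightarrow> (nat \<Rightarrow> nat) \<Rightarrow> vals" where
  "pair_val n M ea eb v =
     (if v < M then Some (ea v)
      else if broom_mid n \<le> v \<and> v < broom_mid n + M then Some (eb (v - broom_mid n)) else None)"

lemma valid_pair_val:
  assumes "\<And>i. i < M \<Longrightarrow> ea i \<in> {1..N}" "\<And>i. i < M \<Longrightarrow> eb i \<in> {1..N}"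
  shows "valid_vals n N (pair_val n M ea eb)"
  using assms by (auto simp: valid_vals_def pair_val_def split: if_splits)

lemma freq_pair_val:
  assumes M: "M \<le> n div 2"
  shows "freq n (pair_val n M ea eb) c = card {i. i < M \<and> ea i = c} + card {i. i < M \<and> eb i = c}"
proof -
  let ?m = "broom_mid n"
  have m: "M \<le> ?m" "?m + M \<le> n" using M by (auto simp: broom_mid_def)
  have "{v. v < n \<and> pair_val n M ea eb v = Some c}
      = {i. i < M \<and> ea i = c} \<union> (\<lambda>i. ?m + i) ` {i. i < M \<and> eb i = c}"
  proof (intro subset_antisym subsetI)
    fix v assume "v \<in> {v. v < n \<and> pair_val n M ea eb v = Some c}"
    then show "v \<in> {i. i < M \<and> ea i = c} \<union> (\<lambda>i. ?m + i) ` {i. i < M \<and> eb i = c}"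
      by (auto simp: pair_val_def image_iff split: if_splits intro: exI[of _ "v - ?m"])
  qed (use m in \<open>auto simp: pair_val_def\<close>)
  moreover have "{i. i < M \<and> ea i = c} \<inter> (\<lambda>i. ?m + i) ` {i. i < M \<and> eb i = c} = {}"
    using m by auto
  ultimately show ?thesis
    unfolding freq_def by (simp add: card_Un_disjoint card_image)
qed

text \<open>By \<open>same\<close> the two sides agree only at equal positions, so position
  \<open>i\<close> accounts for one value of frequency 2 or for two values of frequency 1.\<close>

lemma moment_pair_val:
  assumes M: "M \<le> n div 2"
    and rng: "\<And>i. i < M \<Longrightarrow> ea i \<in> {1..N}" "\<And>i. i < M \<Longrightarrow> eb i \<in> {1..N}"
    and inj: "inj_on ea {..<M}" "inj_on eb {..<M}"
    and same: "\<And>i j. i < M \<Longrightarrow> j < M \<Longrightarrow> ea i = eb j \<Longrightarrow> i = j"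
  shows "moment p n N (pair_val n M ea eb) = (\<Sum>i<M. if ea i = eb i then 2 powr p else 2)"
proof -
  let ?I = "{..<M}"
  have cnt: "card {i. i < M \<and> e i = c} = (if c \<in> e ` ?I then 1 else 0)" if "inj_on e ?I" for e :: "nat \<Rightarrow> nat" and c
  proof (cases "c \<in> e ` ?I")
    case True
    then obtain i where i: "i < M" "c = e i" by auto
    then have "{i. i < M \<and> e i = c} = {i}" using that by (auto dest: inj_onD)
    then show ?thesis using True by simp
  next
    case False
    then have "{i. i < M \<and> e i = c} = {}" by auto
    then show ?thesis using False by simp
  qed
  define f :: "nat \<Rightarrow> nat" where "f c = (if c \<in> ea ` ?I then 1 else 0) + (if c \<in> eb ` ?I then 1 else 0)" for c
  have "moment p n N (pair_val n M ea eb) = (\<Sum>c=1..N. real (f c) powr p)"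
    unfolding moment_eq_sum_powr freq_pair_val[OF M] cnt[OF inj(1)] cnt[OF inj(2)] f_def ..
  also have "\<dots> = (\<Sum>c\<in>ea ` ?I \<union> (eb ` ?I - ea ` ?I). real (f c) powr p)"
    by (rule sum.mono_neutral_right) (use rng in \<open>auto simp: f_def\<close>)
  also have "\<dots> = (\<Sum>c\<in>ea ` ?I. real (f c) powr p) + (\<Sum>c\<in>eb ` ?I - ea ` ?I. real (f c) powr p)"
    by (rule sum.union_disjoint) auto
  also have "(\<Sum>c\<in>ea ` ?I. real (f c) powr p) = (\<Sum>i<M. if ea i = eb i then 2 powr p else 1)"
  proof -
    have "ea i \<in> eb ` ?I \<longleftrightarrow> ea i = eb i" if "i < M" for i
      using that same by (auto intro!: image_eqI[of _ _ i])
    then show ?thesis by (subst sum.reindex[OF inj(1)]) (auto simp: f_def intro!: sum.cong)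
  qed
  also have "(\<Sum>c\<in>eb ` ?I - ea ` ?I. real (f c) powr p) = (\<Sum>i<M. if ea i = eb i then 0 else 1)"
  proof -
    have img: "eb ` ?I - ea ` ?I = eb ` {i. i < M \<and> ea i \<noteq> eb i}"
    proof (intro subset_antisym subsetI)
      fix c assume "c \<in> eb ` ?I - ea ` ?I"
      then obtain i where i: "i < M" "c = eb i" "c \<notin> ea ` ?I" by auto
      then have "ea i \<noteq> eb i" by (metis imageI lessThan_iff)
      with i show "c \<in> eb ` {i. i < M \<and> ea i \<noteq> eb i}" by blast
    next
      fix c assume "c \<in> eb ` {i. i < M \<and> ea i \<noteq> eb i}"
      then obtain i where i: "i < M" "ea i \<noteq> eb i" "c = eb i" by auto
      have "c \<noteq> ea j" if "j < M" for j using same[OF that i(1)] i by metis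
      with i show "c \<in> eb ` ?I - ea ` ?I" by auto
    qed
    have "(\<Sum>c\<in>eb ` ?I - ea ` ?I. real (f c) powr p) = real (card (eb ` ?I - ea ` ?I))"
      by (simp add: f_def)
    also have "\<dots> = real (card {i. i < M \<and> ea i \<noteq> eb i})"
      unfolding img using inj(2) by (subst card_image) (auto simp: inj_on_def)
    also have "\<dots> = (\<Sum>i<M. if ea i = eb i then 0 else 1)"
    proof -
      have "{..<M} \<inter> - {i. ea i = eb i} = {i. i < M \<and> ea i \<noteq> eb i}" by auto
      then show ?thesis by (simp add: sum.If_cases)
    qed
    finally show ?thesis .
  qed
  also have "(\<Sum>i<M. if ea i = eb i then 2 powr p else 1) + (\<Sum>i<M. if ea i = eb i then 0 else 1)
      = (\<Sum>i<M. if ea i = eb i then 2 powr p else 2)"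
    unfolding sum.distrib[symmetric] by (rule sum.cong) auto
  finally show ?thesis .
qed

lemma card_cross_broom:
  assumes "3 \<le> D"
  shows "card (cross (broom n D) (broom_side n)) \<le> 2"
proof -
  have "card (cross (broom n D) (broom_side n)) \<le> card {(0, broom_mid n), (broom_mid n, 0)}"
    by (rule card_mono[OF _ cross_broom[OF assms]]) simp
  also have "\<dots> \<le> 2" by (simp add: card_insert_if)
  finally show ?thesis .
qed

lemma broom_subset: "broom n D \<subseteq> {..<n} \<times> {..<n}"
  by (auto simp: broom_def)

text \<open>
  Absent elements are replaced by private dummies, so that \<open>F\<^sub>p\<close> depends on the size of the
  intersection only.
\<close>

definition pad_enc :: "nat \<Rightarrow> nat \<Rightarrow> nat set \<Rightarrow> nat \<Rightarrow> nat" where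
  "pad_enc M j S i = (if i \<in> S then Suc i else Suc (Suc j * M + i))"

lemma congest_exact_bound:
  assumes D: "3 \<le> D" "D < n" and M: "M \<le> n div 2" "3 * M \<le> N"
    and p: "p \<noteq> 1" and q: "1 / 2 \<le> q"
    and b: "\<And>s u. length (message A s u) \<le> b"
    and solves: "congest_solves B q n N D (exact_moment p n N) T A"
  shows "real M * (2 * q - 1)\<^sup>2 \<le> 128 * (real (Suc b) * (real T * 2) + 3)"
proof -
  let ?E = "broom n D" and ?cls = "broom_side n" and ?m = "broom_mid n"
  define val where "val S = pair_val n M (pad_enc M 0 (S 0)) (pad_enc M 1 (S 1))" for S :: "nat \<Rightarrow> nat set"
  define enc where "enc v S = (if v < M then Some (pad_enc M 0 S v)
      else if ?m \<le> v \<and> v < ?m + M then Some (pad_enc M 1 S (v - ?m)) else None)" for v S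
  have Mm: "M \<le> ?m" using M by (auto simp: broom_mid_def)
  have sv: "(\<lambda>v. if ?cls v < 2 then enc v (S (?cls v)) else None) = val S" for S
    using Mm by (auto simp: val_def enc_def pair_val_def broom_side_def fun_eq_iff)
  have rng: "pad_enc M j S i \<in> {1..N}" if "i < M" "j \<le> 1" for i j S
  proof -
    have "j * M \<le> M" using mult_le_mono1[OF that(2), of M] by simp
    then have "Suc j * M + i < N" using that(1) M(2) unfolding mult_Suc by linarith
    then show ?thesis using that(1) M(2) by (auto simp: pad_enc_def simp del: mult_Suc)
  qed
  have inj: "inj_on (pad_enc M j S) {..<M}" for j S
    by (auto simp: inj_on_def pad_enc_def split: if_splits)
  have same: "i = j \<and> i \<in> S \<and> i \<in> S'" if "i < M" "j < M" "pad_enc M 0 S i = pad_enc M 1 S' j" for i j S S'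
    using that by (auto simp: pad_enc_def split: if_splits)
  have same_iff: "pad_enc M 0 S i = pad_enc M 1 S' i \<longleftrightarrow> i \<in> S \<and> i \<in> S'" if "i < M" for i S S'
    using that same[of i i S S'] by (auto simp: pad_enc_def)
  have mom: "moment p n N (val S) = (\<Sum>i<M. if i \<in> S 0 \<and> i \<in> S 1 then 2 powr p else 2)" for S
  proof -
    have "moment p n N (val S)
        = (\<Sum>i<M. if pad_enc M 0 (S 0) i = pad_enc M 1 (S 1) i then 2 powr p else 2)"
      unfolding val_def by (rule moment_pair_val[OF M(1) _ _ inj inj]) (use rng same in blast)+
    also have "\<dots> = (\<Sum>i<M. if i \<in> S 0 \<and> i \<in> S 1 then 2 powr p else 2)"
      by (rule sum.cong[OF refl]) (simp only: same_iff lessThan_iff)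
    finally show ?thesis .
  qed
  have succ: "q \<le> success_prob A n ?E (val S) T (exact_moment p n N (val S))" for S
  proof -
    have "valid_vals n N (val S)" unfolding val_def by (rule valid_pair_val) (use rng in auto)
    then show ?thesis
      using solves simple_graph_broom diameter_broom[OF D] connected_broom[OF D]
      unfolding congest_solves_def by blast
  qed
  have p2: "2 powr p \<noteq> (2 :: real)"
    using p by (metis numeral_eq_one_iff powr_inj powr_one semiring_norm(85) zero_less_numeral zero_le_numeral)
  \<comment> \<open>Disjoint inputs have moment exactly \<open>2 * M\<close>, so \<open>low\<close>
    tests for this single value; one common element shifts it by \<open>2 powr p - 2\<close>, which
    \<open>p2\<close> shows to be nonzero. As \<open>broom_side\<close> is 0 or 1, the party without
    input, class 2, has no nodes.\<close>
  have "real M * (2 * q - 1)\<^sup>2 \<le> 64 * real 2 * (real (Suc b) * (real T * real (card (cross ?E ?cls))) + real 2 + 1)"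
  proof (rule congest_promise_disjointness[where cls = ?cls and enc = enc and low = "\<lambda>y. y = 2 * real M"
        and correct = "exact_moment p n N" and k = 1 and t = 2, OF _ broom_subset _ b q, unfolded sv])
    fix i :: nat and z :: "nat \<Rightarrow> nat" and y S
    assume i: "i < M"
    {
      assume S: "S = (\<lambda>j. {i'. i' < M \<and> i' \<noteq> i \<and> z i' = j \<and> y i'})"
      have "moment p n N (val S) = (\<Sum>i<M. 2)" unfolding mom by (rule sum.cong) (auto simp: S)
      then show "q \<le> success_prob A n ?E (val S) T (exact_moment p n N (val S))
          \<and> (\<forall>a. exact_moment p n N (val S) a \<longrightarrow> a = 2 * real M)"
        using succ by (simp add: exact_moment_def)
    next
      assume S: "S = (\<lambda>j. insert i {i'. i' < M \<and> i' \<noteq> i \<and> z i' = j \<and> y i'})"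
      have "moment p n N (val S) = (\<Sum>i'<M. if i' = i then 2 powr p else 2)"
        unfolding mom by (rule sum.cong) (auto simp: S)
      also have "\<dots> = (\<Sum>i'<M. 2 + (if i' = i then 2 powr p - 2 else 0))"
        by (rule sum.cong) auto
      also have "\<dots> = 2 * real M + (2 powr p - 2)"
        using i by (simp add: sum.distrib)
      finally show "q \<le> success_prob A n ?E (val S) T (exact_moment p n N (val S))
          \<and> (\<forall>a. exact_moment p n N (val S) a \<longrightarrow> \<not> a = 2 * real M)"
        using succ p2 by (simp add: exact_moment_def)
    }
  qed (auto simp: broom_side_def)
  also have "\<dots> \<le> 128 * (real (Suc b) * (real T * 2) + 3)"
  proof -
    have "real (card (cross ?E ?cls)) \<le> 2"
      using of_nat_mono[OF card_cross_broom[OF D(1), of n], where 'a = real] by simp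
    then have "real (Suc b) * (real T * real (card (cross ?E ?cls))) \<le> real (Suc b) * (real T * 2)"
      by (intro mult_left_mono) auto
    then show ?thesis by simp
  qed
  finally show ?thesis .
qed

section \<open>Protocol trees that simulate an exchange of messages\<close>

lemma Alice_select:
  assumes "finite S" "card S \<le> 2 ^ k"
    and "\<And>m. m \<in> S \<Longrightarrow> \<exists>P. cost P \<le> c \<and> (\<forall>x y. run P x y = F m x y)"
  shows "\<exists>P. cost P \<le> c + k \<and> (\<forall>x y. a x \<in> S \<longrightarrow> run P x y = F (a x) x y)"
  using assms
proof (induction k arbitrary: S)
  case 0
  have "card S = 0 \<or> card S = 1" using 0(2) unfolding power_0 by linarith
  then consider "S = {}" | m where "S = {m}" using 0(1) card_1_singletonE by (metis card_0_eq)
  then show ?case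
  proof cases
    case 1
    then show ?thesis by (intro exI[of _ "Answer True"]) simp
  next
    case 2
    then obtain P where "cost P \<le> c" "\<And>x y. run P x y = F m x y" using 0(3)[of m] by auto
    then show ?thesis using 2 by (intro exI[of _ P]) auto
  qed
next
  case (Suc k)
  \<comment> \<open>Alice announces which half of \<open>S\<close> contains her message. After
    \<open>k\<close> halvings it is common knowledge, and the protocol made for this message takes
    over.\<close>
  obtain S1 where S1: "S1 \<subseteq> S" "card S1 = card S div 2"
    by (rule obtain_subset_with_card_n[of "card S div 2" S]) (simp, blast)
  have fin: "finite S1" "finite (S - S1)" using Suc.prems(1) S1(1) finite_subset by auto
  have "card (S - S1) = card S - card S div 2" using S1 fin by (simp add: card_Diff_subset)
  then have card: "card S1 \<le> 2 ^ k" "card (S - S1) \<le> 2 ^ k" using Suc.prems(2) S1(2) by auto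
  have "\<exists>P. cost P \<le> c + k \<and> (\<forall>x y. a x \<in> S1 \<longrightarrow> run P x y = F (a x) x y)"
    by (rule Suc.IH[OF fin(1) card(1)]) (use Suc.prems(3) S1(1) in blast)
  then obtain P where P: "cost P \<le> c + k" "\<And>x y. a x \<in> S1 \<Longrightarrow> run P x y = F (a x) x y" by blast
  have "\<exists>P. cost P \<le> c + k \<and> (\<forall>x y. a x \<in> S - S1 \<longrightarrow> run P x y = F (a x) x y)"
    by (rule Suc.IH[OF fin(2) card(2)]) (use Suc.prems(3) in blast)
  then obtain Q where Q: "cost Q \<le> c + k" "\<And>x y. a x \<in> S - S1 \<Longrightarrow> run Q x y = F (a x) x y" by blast
  show ?case
    by (rule exI[of _ "Alice (\<lambda>x. a x \<in> S1) P Q"]) (use P Q in auto)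
qed

fun swap_roles :: "('x, 'y) protocol \<Rightarrow> ('y, 'x) protocol" where
  "swap_roles (Answer b) = Answer b"
| "swap_roles (Alice f P Q) = Bob f (swap_roles P) (swap_roles Q)"
| "swap_roles (Bob g P Q) = Alice g (swap_roles P) (swap_roles Q)"

lemma run_swap_roles: "run (swap_roles P) y x = run P x y"
  by (induction P) auto

lemma cost_swap_roles: "cost (swap_roles P) = cost P"
  by (induction P) auto

lemma Bob_select:
  assumes "finite S" "card S \<le> 2 ^ k"
    and "\<And>m. m \<in> S \<Longrightarrow> \<exists>P. cost P \<le> c \<and> (\<forall>x y. run P x y = F m x y)"
  shows "\<exists>P. cost P \<le> c + k \<and> (\<forall>x y. b y \<in> S \<longrightarrow> run P x y = F (b y) x y)"
proof -
  have "\<exists>P. cost P \<le> c \<and> (\<forall>y x. run P y x = F m x y)" if "m \<in> S" for m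
    using assms(3)[OF that] by (metis run_swap_roles cost_swap_roles)
  from Alice_select[where a = b and F = "\<lambda>m y x. F m x y", OF assms(1,2) this] show ?thesis
    by (metis run_swap_roles cost_swap_roles)
qed

type_synonym history = "(bool list \<times> bool list) list"

text \<open>Both messages of a round are functions of the history before it, as in a synchronous
  round.\<close>

fun exchange :: "(history \<Rightarrow> 'x \<Rightarrow> bool list) \<Rightarrow> (history \<Rightarrow> 'y \<Rightarrow> bool list) \<Rightarrow> nat \<Rightarrow> history
    \<Rightarrow> 'x \<Rightarrow> 'y \<Rightarrow> history" where
  "exchange am bm 0 H x y = H"
| "exchange am bm (Suc r) H x y = exchange am bm r (H @ [(am H x, bm H y)]) x y"

text \<open>Bob's message does not depend on Alice's of the same round, so sending them one after
  the other is faithful. There are at most \<open>2 ^ Suc b\<close> messages, hence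
  \<open>Suc b\<close> bits for each. The last 2 bits tell which party decides, and its
  decision.\<close>

lemma exchange_protocol:
  assumes len: "\<And>H x. length (am H x) \<le> b" "\<And>H y. length (bm H y) \<le> b"
  shows "\<exists>P. cost P \<le> r * (2 * Suc b) + 2 \<and> (\<forall>x y. run P x y =
      (let H' = exchange am bm r H x y in if f H' x then g H' x else k H' y))"
proof (induction r arbitrary: H)
  case 0
  show ?case
    by (rule exI[of _ "Alice (f H) (Alice (g H) (Answer True) (Answer False)) (Bob (k H) (Answer True) (Answer False))"])
       (auto simp: Let_def)
next
  case (Suc r)
  let ?out = "\<lambda>H x y. let H' = exchange am bm r H x y in if f H' x then g H' x else k H' y"
  let ?S = "{xs :: bool list. length xs \<le> b}"
  let ?c = "r * (2 * Suc b) + 2"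
  have inner: "\<exists>P. cost P \<le> ?c + Suc b \<and> (\<forall>x y. run P x y = ?out (H @ [(m, bm H y)]) x y)" for m
    using Bob_select[OF finite_bool_lists_le card_bool_lists_le, of b ?c "\<lambda>m' x y. ?out (H @ [(m, m')]) x y" "bm H"]
      Suc.IH len by auto
  have "\<exists>P. cost P \<le> ?c + Suc b + Suc b \<and> (\<forall>x y. run P x y = ?out (H @ [(am H x, bm H y)]) x y)"
    using Alice_select[OF finite_bool_lists_le card_bool_lists_le, of b "?c + Suc b" "\<lambda>m x y. ?out (H @ [(m, bm H y)]) x y" "am H"]
      inner len by auto
  then show ?case by (simp add: algebra_simps)
qed

section \<open>From CONGEST algorithms to protocols for Gap-Hamming-Distance\<close>

definition bit_enc :: "bool list \<Rightarrow> nat \<Rightarrow> nat" where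
  "bit_enc x i = Suc (2 * i + (if x ! i then 1 else 0))"

definition ghd_val :: "nat \<Rightarrow> nat \<Rightarrow> bool list \<Rightarrow> bool list \<Rightarrow> vals" where
  "ghd_val n M x y = pair_val n M (bit_enc x) (bit_enc y)"

lemma bit_enc_range: "i < M \<Longrightarrow> 2 * M \<le> N \<Longrightarrow> bit_enc x i \<in> {1..N}"
  by (auto simp: bit_enc_def)

lemma bit_enc_eqD: "bit_enc x i = bit_enc y j \<Longrightarrow> i = j \<and> x ! i = y ! j"
  by (simp add: bit_enc_def split: if_splits) presburger+

lemma moment_ghd_val:
  assumes "M \<le> n div 2" "2 * M \<le> N" "length x = M"
  shows "moment p n N (ghd_val n M x y)
       = 2 powr p * (real M - real (hamming x y)) + 2 * real (hamming x y)"
proof -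
  have "moment p n N (ghd_val n M x y) = (\<Sum>i<M. if bit_enc x i = bit_enc y i then 2 powr p else 2)"
    unfolding ghd_val_def
    by (rule moment_pair_val[OF assms(1)])
       (use bit_enc_range[OF _ assms(2)] bit_enc_eqD in \<open>blast intro: inj_onI\<close>)+
  also have "\<dots> = (\<Sum>i<M. if x ! i = y ! i then 2 powr p else 2)"
    by (intro sum.cong refl if_cong) (auto simp: bit_enc_def)
  also have "\<dots> = (\<Sum>i<M. 2 powr p + (if x ! i \<noteq> y ! i then 2 - 2 powr p else 0))"
    by (rule sum.cong) auto
  also have "\<dots> = real M * 2 powr p + real (hamming x y) * (2 - 2 powr p)"
  proof -
    have "{..<M} \<inter> {i. x ! i \<noteq> y ! i} = {i. i < length x \<and> x ! i \<noteq> y ! i}" using assms(3) by auto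
    then show ?thesis by (simp only: sum.distrib sum.If_cases finite_lessThan hamming_def) simp
  qed
  finally show ?thesis by (simp add: algebra_simps)
qed

lemma hamming_le_length: "hamming x y \<le> length x"
proof -
  have "hamming x y \<le> card {..<length x}" unfolding hamming_def by (intro card_mono) auto
  then show ?thesis by simp
qed

lemma congest_imp_GHD_protocol:
  assumes D: "3 \<le> D" "D < n" and M: "M \<le> n div 2" "2 * M \<le> N"
    and b: "\<And>s u. length (message A s u) \<le> b"
    and solves: "congest_solves B q n N D correct T A"
    and far: "\<And>x y a. length x = M \<Longrightarrow> length y = M \<Longrightarrow> real (hamming x y) \<ge> real M / 2 + sqrt (real M) \<Longrightarrow>
        correct (ghd_val n M x y) a \<Longrightarrow> high a"
    and near: "\<And>x y a. length x = M \<Longrightarrow> length y = M \<Longrightarrow> real (hamming x y) \<le> real M / 2 - sqrt (real M) \<Longrightarrow>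
        correct (ghd_val n M x y) a \<Longrightarrow> \<not> high a"
  shows "\<exists>R. solves_GHD q M R \<and> (\<forall>P\<in>set_pmf R. cost P \<le> T * (2 * Suc b) + 2)"
proof -
  let ?E = "broom n D" and ?cls = "broom_side n" and ?m = "broom_mid n"
  let ?P = "Pi_pmf {..<n} 0 (coins A)"
  \<comment> \<open>Entry \<open>s\<close> of the history holds the two messages of round
    \<open>s\<close> on the middle edge, the one sent by the left half first.\<close>
  define \<mu> where "\<mu> H s e = (if fst e < ?m then fst (H ! s) else snd (H ! s))"
    for H :: history and s :: nat and e :: "nat \<times> nat"
  \<comment> \<open>A party puts \<open>[]\<close> for the input it does not know; by
    \<open>lv_A\<close> and \<open>lv_B\<close> this does not affect the views of its own
    nodes.\<close>
  define lv where "lv \<omega> H x y = local_view A ?E ?cls (\<mu> H) (ghd_val n M x y) \<omega> (length H)" for \<omega> H x y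
  define am where "am \<omega> H x = message A (lv \<omega> H x [] 0) ?m" for \<omega> H x
  define bm where "bm \<omega> H y = message A (lv \<omega> H [] y ?m) 0" for \<omega> H y
  \<comment> \<open>All answers may come from one half. Alice reports whether hers gives any, and
    otherwise Bob decides.\<close>
  define fin where "fin \<omega> H x \<longleftrightarrow> (\<exists>v<n. ?cls v = 0 \<and> answer A (lv \<omega> H x [] v) \<noteq> None)" for \<omega> H x
  define ao where "ao \<omega> H x \<longleftrightarrow> (\<exists>v<n. ?cls v = 0 \<and> (\<exists>a. answer A (lv \<omega> H x [] v) = Some a \<and> high a))" for \<omega> H x
  define bo where "bo \<omega> H y \<longleftrightarrow> (\<exists>v<n. ?cls v = 1 \<and> (\<exists>a. answer A (lv \<omega> H [] y v) = Some a \<and> high a))" for \<omega> H y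
  \<comment> \<open>One deterministic protocol per choice of all seeds: the private seeds of the
    nodes become public coins.\<close>
  define Q where "Q \<omega> = (SOME P. cost P \<le> T * (2 * Suc b) + 2 \<and> (\<forall>x y. run P x y =
      (let H' = exchange (am \<omega>) (bm \<omega>) T [] x y in if fin \<omega> H' x then ao \<omega> H' x else bo \<omega> H' y)))" for \<omega>
  have Q: "cost (Q \<omega>) \<le> T * (2 * Suc b) + 2 \<and> (\<forall>x y. run (Q \<omega>) x y =
      (let H' = exchange (am \<omega>) (bm \<omega>) T [] x y in if fin \<omega> H' x then ao \<omega> H' x else bo \<omega> H' y))" for \<omega>
    unfolding Q_def by (rule someI_ex, rule exchange_protocol) (simp_all add: am_def bm_def b)
  define va where "va \<omega> x y = view_after A ?E (ghd_val n M x y) \<omega>" for \<omega> x y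
  define pre where "pre \<omega> x y s = map (\<lambda>s. (message A (va \<omega> x y s 0) ?m, message A (va \<omega> x y s ?m) 0)) [0..<s]" for \<omega> x y s
  have Mm: "M \<le> ?m" "?m < n" "0 < ?m" using M D by (auto simp: broom_mid_def)
  have lv_pre: "lv \<omega> (pre \<omega> x y s) x y v = va \<omega> x y s v" for \<omega> x y s v
    unfolding lv_def va_def
  proof -
    have "local_view A ?E ?cls (\<mu> (pre \<omega> x y s)) (ghd_val n M x y) \<omega> s v = view_after A ?E (ghd_val n M x y) \<omega> s v"
    proof (rule local_view_eq_view_after)
      fix s' u w assume "s' < s" "(u, w) \<in> ?E" "?cls u \<noteq> ?cls w"
      moreover from this have "(u, w) = (0, ?m) \<or> (u, w) = (?m, 0)"
        using cross_broom[OF D(1), of n] by (auto simp: cross_def)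
      ultimately show "\<mu> (pre \<omega> x y s) s' (u, w) = message A (view_after A ?E (ghd_val n M x y) \<omega> s' u) w"
        using Mm by (auto simp: \<mu>_def pre_def va_def)
    qed
    then show "local_view A ?E ?cls (\<mu> (pre \<omega> x y s)) (ghd_val n M x y) \<omega> (length (pre \<omega> x y s)) v
        = view_after A ?E (ghd_val n M x y) \<omega> s v"
      by (simp add: pre_def)
  qed
  have val_A: "ghd_val n M x [] u = ghd_val n M x y u" if "?cls u = 0" for x y u
  proof -
    have "u < ?m" using that by (simp add: broom_side_def split: if_splits)
    then show ?thesis by (simp add: ghd_val_def pair_val_def)
  qed
  have val_B: "ghd_val n M [] y u = ghd_val n M x y u" if "?cls u = 1" for x y u
  proof -
    have "?m \<le> u" using that by (simp add: broom_side_def split: if_splits)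
    then show ?thesis using Mm by (simp add: ghd_val_def pair_val_def)
  qed
  have lv_A: "lv \<omega> H x [] v = lv \<omega> H x y v" if "v < n" "?cls v = 0" for \<omega> H x y v
    unfolding lv_def by (rule local_view_cong[OF broom_subset, where c = 0]) (simp_all add: val_A that)
  have lv_B: "lv \<omega> H [] y v = lv \<omega> H x y v" if "v < n" "?cls v = 1" for \<omega> H x y v
    unfolding lv_def by (rule local_view_cong[OF broom_subset, where c = 1]) (assumption | rule val_B refl that)+
  have cls0: "?cls 0 = 0" "?cls ?m = 1" "0 < n" using Mm by (auto simp: broom_side_def)
  have step: "pre \<omega> x y s @ [(am \<omega> (pre \<omega> x y s) x, bm \<omega> (pre \<omega> x y s) y)] = pre \<omega> x y (Suc s)" for \<omega> x y s
    unfolding am_def bm_def lv_A[OF cls0(3,1), of _ _ _ y] lv_B[OF Mm(2) cls0(2), of _ _ _ x] lv_pre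
    by (simp add: pre_def)
  have ex: "exchange (am \<omega>) (bm \<omega>) r (pre \<omega> x y s) x y = pre \<omega> x y (s + r)" for \<omega> x y r s
    by (induction r arbitrary: s) (simp_all add: step)
  have ex0: "exchange (am \<omega>) (bm \<omega>) T [] x y = pre \<omega> x y T" for \<omega> x y
    using ex[of \<omega> T x y 0] by (simp add: pre_def)
  have run_Q: "run (Q \<omega>) x y =
      (if \<exists>v<n. ?cls v = 0 \<and> answer A (va \<omega> x y T v) \<noteq> None
       then \<exists>v<n. ?cls v = 0 \<and> (\<exists>a. answer A (va \<omega> x y T v) = Some a \<and> high a)
       else \<exists>v<n. ?cls v = 1 \<and> (\<exists>a. answer A (va \<omega> x y T v) = Some a \<and> high a))" for \<omega> x y
  proof -
    have A: "lv \<omega> (pre \<omega> x y T) x [] v = va \<omega> x y T v" if "v < n" "?cls v = 0" for v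
      using lv_A[OF that, of _ _ _ y] lv_pre by simp
    have B: "lv \<omega> (pre \<omega> x y T) [] y v = va \<omega> x y T v" if "v < n" "?cls v = 1" for v
      using lv_B[OF that, of _ _ _ x] lv_pre by simp
    have "fin \<omega> (pre \<omega> x y T) x \<longleftrightarrow> (\<exists>v<n. ?cls v = 0 \<and> answer A (va \<omega> x y T v) \<noteq> None)"
      unfolding fin_def by (intro ex_cong1 conj_cong refl) (simp only: A)
    moreover have "ao \<omega> (pre \<omega> x y T) x \<longleftrightarrow> (\<exists>v<n. ?cls v = 0 \<and> (\<exists>a. answer A (va \<omega> x y T v) = Some a \<and> high a))"
      unfolding ao_def by (intro ex_cong1 conj_cong refl) (simp only: A)
    moreover have "bo \<omega> (pre \<omega> x y T) y \<longleftrightarrow> (\<exists>v<n. ?cls v = 1 \<and> (\<exists>a. answer A (va \<omega> x y T v) = Some a \<and> high a))"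
      unfolding bo_def by (intro ex_cong1 conj_cong refl) (simp only: B)
    moreover have "run (Q \<omega>) x y = (let H' = exchange (am \<omega>) (bm \<omega>) T [] x y
        in if fin \<omega> H' x then ao \<omega> H' x else bo \<omega> H' y)"
      using Q[of \<omega>] by blast
    ultimately show ?thesis by (simp only: ex0 Let_def)
  qed
  define S where "S x y = {\<omega>. (\<exists>v<n. answer A (va \<omega> x y T v) \<noteq> None) \<and>
      (\<forall>v<n. \<forall>a. answer A (va \<omega> x y T v) = Some a \<longrightarrow> correct (ghd_val n M x y) a)}" for x y
  have S: "q \<le> measure_pmf.prob ?P (S x y)" for x y
  proof -
    have "valid_vals n N (ghd_val n M x y)"
      unfolding ghd_val_def by (rule valid_pair_val) (rule bit_enc_range[OF _ M(2)], assumption)+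
    then show ?thesis
      using solves simple_graph_broom diameter_broom[OF D] connected_broom[OF D]
      unfolding congest_solves_def success_prob_def S_def va_def by blast
  qed
  have cls01: "?cls v = 0 \<or> ?cls v = 1" for v by (auto simp: broom_side_def)
  have yes: "run (Q \<omega>) x y" if in_S: "\<omega> \<in> S x y" and high: "\<And>a. correct (ghd_val n M x y) a \<Longrightarrow> high a" for \<omega> x y
  proof (cases "\<exists>v<n. ?cls v = 0 \<and> answer A (va \<omega> x y T v) \<noteq> None")
    case True
    then obtain v a where "v < n" "?cls v = 0" "answer A (va \<omega> x y T v) = Some a" by auto
    moreover from this have "high a" using in_S by (intro high) (auto simp: S_def)
    ultimately have "\<exists>v<n. ?cls v = 0 \<and> (\<exists>a. answer A (va \<omega> x y T v) = Some a \<and> high a)" by blast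
    then show ?thesis unfolding run_Q if_P[OF True] .
  next
    case False
    obtain v a where v: "v < n" "answer A (va \<omega> x y T v) = Some a" using in_S by (auto simp: S_def)
    then have "?cls v = 1" using False cls01[of v] by auto
    moreover from v have "high a" using in_S by (intro high) (auto simp: S_def)
    ultimately have "\<exists>v<n. ?cls v = 1 \<and> (\<exists>a. answer A (va \<omega> x y T v) = Some a \<and> high a)" using v by blast
    then show ?thesis unfolding run_Q if_not_P[OF False] .
  qed
  have no: "\<not> run (Q \<omega>) x y" if "\<omega> \<in> S x y" and low: "\<And>a. correct (ghd_val n M x y) a \<Longrightarrow> \<not> high a" for \<omega> x y
  proof -
    have "\<not> high a" if "v < n" "answer A (va \<omega> x y T v) = Some a" for v a
      using \<open>\<omega> \<in> S x y\<close> that by (intro low) (auto simp: S_def)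
    then show ?thesis unfolding run_Q by auto
  qed
  have "solves_GHD q M (map_pmf Q ?P)"
    unfolding solves_GHD_def
  proof (intro allI impI conjI)
    fix x y :: "bool list" assume len: "length x = M \<and> length y = M"
    {
      assume h: "real (hamming x y) \<ge> real M / 2 + sqrt (real M)"
      have "measure_pmf.prob ?P (S x y) \<le> measure_pmf.prob ?P {\<omega>. run (Q \<omega>) x y}"
        by (rule measure_pmf.finite_measure_mono) (use yes far len h in auto)
      then show "q \<le> measure_pmf.prob (map_pmf Q ?P) {P. run P x y}"
        using S[of x y] by (simp add: vimage_def)
    next
      assume h: "real (hamming x y) \<le> real M / 2 - sqrt (real M)"
      have "measure_pmf.prob ?P (S x y) \<le> measure_pmf.prob ?P {\<omega>. \<not> run (Q \<omega>) x y}"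
        by (rule measure_pmf.finite_measure_mono) (use no near len h in auto)
      then show "q \<le> measure_pmf.prob (map_pmf Q ?P) {P. \<not> run P x y}"
        using S[of x y] by (simp add: vimage_def)
    }
  qed
  moreover have "\<forall>P\<in>set_pmf (map_pmf Q ?P). cost P \<le> T * (2 * Suc b) + 2" using Q by auto
  ultimately show ?thesis by blast
qed

text \<open>The moment is affine in the Hamming distance with slope \<open>2 - 2 powr p\<close>, so
  the promise keeps it at least \<open>\<delta>\<close> away from \<open>mid\<close>, its value at
  distance \<open>M / 2\<close>. As the moment is at most \<open>(2 powr p + 2) * M\<close>, the
  second condition on \<open>\<epsilon>\<close> says that the approximation error is below
  \<open>\<delta>\<close>.\<close>

lemma congest_approx_imp_GHD_protocol:
  assumes D: "3 \<le> D" "D < n" and M: "1 \<le> M" "M \<le> n div 2" "2 * M \<le> N"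
    and \<epsilon>: "0 < \<epsilon>" "\<epsilon> * (2 powr p + 2) * sqrt (real M) < \<bar>2 - 2 powr p\<bar>"
    and b: "\<And>s u. length (message A s u) \<le> b"
    and solves: "congest_solves B q n N D (approx_moment p \<epsilon> n N) T A"
  shows "\<exists>R. solves_GHD q M R \<and> (\<forall>P\<in>set_pmf R. cost P \<le> T * (2 * Suc b) + 2)"
proof -
  define d where "d = 2 - (2 :: real) powr p"
  define \<delta> where "\<delta> = \<bar>d\<bar> * sqrt (real M)"
  define mid where "mid = (2 powr p + 2) * real M / 2"
  have err: "\<bar>a - moment p n N (ghd_val n M x y)\<bar> < \<delta>"
    and mom: "moment p n N (ghd_val n M x y) - mid = d * (real (hamming x y) - real M / 2)"
    if len: "length x = M" and app: "approx_moment p \<epsilon> n N (ghd_val n M x y) a" for x y a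
  proof -
    let ?F = "moment p n N (ghd_val n M x y)"
    have F: "?F = 2 powr p * (real M - real (hamming x y)) + 2 * real (hamming x y)"
      by (rule moment_ghd_val[OF M(2,3) len])
    have h: "real (hamming x y) \<le> real M" using hamming_le_length[of x y] len by simp
    have "2 powr p * (real M - real (hamming x y)) \<le> 2 powr p * real M" by (intro mult_left_mono) auto
    then have "?F \<le> (2 powr p + 2) * real M" using F h unfolding distrib_right by linarith
    then have "\<epsilon> * ?F \<le> \<epsilon> * ((2 powr p + 2) * real M)" using \<epsilon>(1) by (intro mult_left_mono) auto
    also have "\<dots> = \<epsilon> * (2 powr p + 2) * sqrt (real M) * sqrt (real M)" by simp
    also have "\<dots> < \<delta>"
      unfolding \<delta>_def d_def using \<epsilon>(2) M(1) by (intro mult_strict_right_mono) auto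
    finally have "\<epsilon> * ?F < \<delta>" .
    then show "\<bar>a - ?F\<bar> < \<delta>"
      using app by (simp add: approx_moment_def algebra_simps abs_less_iff)
    show "?F - mid = d * (real (hamming x y) - real M / 2)"
      unfolding F mid_def d_def by (simp add: field_simps)
  qed
  have d: "d \<noteq> 0" using \<epsilon> by (auto simp: d_def mult_less_0_iff not_less)
  show ?thesis
  \<comment> \<open>The slope \<open>d\<close> is positive for \<open>p < 1\<close> and negative for
    \<open>p > 1\<close>; the factor \<open>d\<close> makes large distances the high side in both
    cases.\<close>
  proof (rule congest_imp_GHD_protocol[where high = "\<lambda>a. d * (a - mid) > 0", OF D M(2,3) b solves])
    fix x y a assume len: "length x = M" "length y = M" and app: "approx_moment p \<epsilon> n N (ghd_val n M x y) a"
    let ?F = "moment p n N (ghd_val n M x y)"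
    have split: "d * (a - mid) = d * (a - ?F) + d\<^sup>2 * (real (hamming x y) - real M / 2)"
    proof -
      have "d * (a - mid) = d * (a - ?F) + d * (?F - mid)" by (simp add: algebra_simps)
      then show ?thesis unfolding mom[OF len(1) app] power2_eq_square by (simp only: mult.assoc)
    qed
    have "\<bar>d * (a - ?F)\<bar> < \<bar>d\<bar> * \<delta>"
      using err[OF len(1) app] d by (simp add: abs_mult)
    also have "\<bar>d\<bar> * \<delta> = d\<^sup>2 * sqrt (real M)" by (simp add: \<delta>_def power2_eq_square flip: mult.assoc abs_mult)
    finally have e: "\<bar>d * (a - ?F)\<bar> < d\<^sup>2 * sqrt (real M)" .
    {
      assume "real (hamming x y) \<ge> real M / 2 + sqrt (real M)"
      then have "d\<^sup>2 * sqrt (real M) \<le> d\<^sup>2 * (real (hamming x y) - real M / 2)" by (intro mult_left_mono) auto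
      then show "0 < d * (a - mid)" using e split by linarith
    next
      assume "real (hamming x y) \<le> real M / 2 - sqrt (real M)"
      then have "d\<^sup>2 * (real (hamming x y) - real M / 2) \<le> d\<^sup>2 * (- sqrt (real M))" by (intro mult_left_mono) auto
      then show "\<not> 0 < d * (a - mid)" using e split by linarith
    }
  qed
qed

section \<open>Round lower bounds\<close>

lemma log_ge_1:
  assumes "2 \<le> n"
  shows "1 \<le> log 2 (real n)"
  using log_mono[of 2 2 "real n"] assms by simp

lemma bandwidth_bound:
  assumes "bandwidth_le A (B * log 2 (real n))" "B > 0" "2 \<le> n"
  obtains b where "\<And>s u. length (message A s u) \<le> b" "real (Suc b) \<le> (B + 1) * log 2 (real n)"
proof
  let ?l = "log 2 (real n)"
  have l: "1 \<le> ?l" using log_ge_1[OF assms(3)] .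
  show "length (message A s u) \<le> nat \<lfloor>B * ?l\<rfloor>" for s u
    using assms(1) by (simp add: bandwidth_le_def le_nat_floor)
  have "real (nat \<lfloor>B * ?l\<rfloor>) \<le> B * ?l" using assms(2) l by simp
  then show "real (Suc (nat \<lfloor>B * ?l\<rfloor>)) \<le> (B + 1) * ?l" using l by (simp add: algebra_simps)
qed

text \<open>Adds the diameter bound to a bandwidth bound \<open>X / l \<le> K' * T\<close>.
  Weakening \<open>K\<close> to \<open>K'\<close> lets several estimates share one constant.\<close>

lemma rounds_lower_bound:
  assumes "real D \<le> 2 * T" "X \<le> K * l * T" "K \<le> K'" "0 \<le> K'" "1 \<le> l" "0 \<le> T"
  shows "T \<ge> 1 / (2 + K') * (real D + X / l)"
proof -
  have "K * l * T \<le> K' * l * T" using assms by (intro mult_right_mono) auto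
  then have "X / l \<le> K' * T" using assms by (simp add: field_simps)
  then have "real D + X / l \<le> (2 + K') * T" using assms by (simp add: algebra_simps)
  moreover have "0 < 2 + K'" using assms(4) by simp
  ultimately show ?thesis
    unfolding times_divide_eq_left mult_1_left by (subst pos_divide_le_eq) (simp_all only: mult.commute)
qed

lemma approx_diameter_le_twice_rounds:
  assumes "3 \<le> D" "D < n" "1 \<le> N" "2 / 3 < q" "\<epsilon> < 1"
    and "congest_solves B q n N D (approx_moment p \<epsilon> n N) T A"
  shows "D \<le> 2 * T"
  by (rule diameter_le_twice_rounds[OF assms(1-4,6)])
     (use assms(3,5) in \<open>auto simp: approx_moment_def moment_None moment_single\<close>)

lemma exact_diameter_le_twice_rounds:
  assumes "3 \<le> D" "D < n" "1 \<le> N" "2 / 3 < q"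
    and "congest_solves B q n N D (exact_moment p n N) T A"
  shows "D \<le> 2 * T"
  by (rule diameter_le_twice_rounds[OF assms])
     (use assms(3) in \<open>auto simp: exact_moment_def moment_None moment_single\<close>)

lemma success_gap: "9 / 10 \<le> q \<Longrightarrow> 1 / 2 \<le> (2 * q - 1)\<^sup>2" for q :: real
  using power_mono[of "4 / 5" "2 * q - 1" 2] by (simp add: power2_eq_square)

lemma exact_moment_rounds:
  fixes p B \<kappa> :: real
  assumes p: "p \<noteq> 1" and B: "B > 0" and \<kappa>: "\<kappa> > 0" and q: "9 / 10 \<le> q"
  shows "\<exists>c>0. \<forall>n N D T A. 3 \<le> D \<and> D < n \<and> \<kappa> * real n \<le> real N \<and>
     congest_solves B q n N D (exact_moment p n N) T A \<longrightarrow>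
     real T \<ge> c * (real D + real n / log 2 (real n))"
proof -
  \<comment> \<open>The first bound fits \<open>M\<close> nodes into either half of the broom, the
    second the \<open>3 * M\<close> values of \<open>pad_enc\<close> into the range. In
    \<open>C\<close> the summand 1 pays for rounding \<open>M\<close> down.\<close>
  define \<gamma> where "\<gamma> = min (1 / 3) (\<kappa> / 3)"
  define C where "C = 256 * (2 * B + 5) + 1"
  have \<gamma>: "0 < \<gamma>" "\<gamma> \<le> 1 / 3" "\<gamma> \<le> \<kappa> / 3" using \<kappa> by (auto simp: \<gamma>_def)
  have C: "0 < C" using B by (simp add: C_def)
  have main: "real T \<ge> 1 / (2 + C / \<gamma>) * (real D + real n / log 2 (real n))"
    if D: "3 \<le> D" "D < n" and N: "\<kappa> * real n \<le> real N"
      and solves: "congest_solves B q n N D (exact_moment p n N) T A" for n N D T A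
  proof -
    let ?l = "log 2 (real n)"
    have l: "1 \<le> ?l" using D by (intro log_ge_1) simp
    have "0 < \<kappa> * real n" using \<kappa> D by simp
    then have N1: "1 \<le> N" using N by (cases N) auto
    have DT: "D \<le> 2 * T"
      by (rule exact_diameter_le_twice_rounds[OF D N1 _ solves]) (use q in simp)
    then have T: "1 \<le> real T" using D by simp
    have lT: "1 \<le> ?l * real T" using mult_mono[OF l T] l by simp
    obtain b where b: "\<And>s u. length (message A s u) \<le> b" "real (Suc b) \<le> (B + 1) * ?l"
      using bandwidth_bound[of A B n] solves B D by (auto simp: congest_solves_def)
    define M where "M = nat \<lfloor>\<gamma> * real n\<rfloor>"
    have M: "real M \<le> \<gamma> * real n" "\<gamma> * real n \<le> real M + 1"
      using \<gamma>(1) by (simp_all add: M_def)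
    have "\<gamma> * real n \<le> 1 / 3 * real n" "\<gamma> * real n \<le> \<kappa> / 3 * real n"
      using \<gamma> by (intro mult_right_mono; simp)+
    then have M2: "M \<le> n div 2" "3 * M \<le> N" using M(1) N by linarith+
    have "real M * (1 / 2) \<le> real M * (2 * q - 1)\<^sup>2"
      using success_gap[OF q] by (intro mult_left_mono) auto
    also have "\<dots> \<le> 128 * (real (Suc b) * (real T * 2) + 3)"
      by (rule congest_exact_bound[OF D M2 p _ b(1) solves]) (use q in simp)
    also have "\<dots> \<le> 128 * ((B + 1) * ?l * (real T * 2) + 3 * (?l * real T))"
      using b(2) lT by (intro mult_left_mono add_mono mult_right_mono) auto
    finally have "real M \<le> 256 * (2 * B + 5) * (?l * real T)" by (simp add: algebra_simps)
    then have "\<gamma> * real n \<le> C * (?l * real T)"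
      using M(2) lT unfolding C_def distrib_right[of _ 1] by linarith
    then have "real n \<le> C / \<gamma> * ?l * real T" using \<gamma>(1) by (simp add: field_simps)
    then show ?thesis
      using DT l C \<gamma>(1) by (intro rounds_lower_bound[where K = "C / \<gamma>"]) auto
  qed
  have "0 < 1 / (2 + C / \<gamma>)" using C \<gamma> by (simp add: add_pos_pos)
  with main show ?thesis by blast
qed

lemma approx_moment_rounds_of_GHD:
  fixes p B \<kappa> :: real
  assumes p: "p \<noteq> 1" and B: "B > 0" and \<kappa>: "\<kappa> > 0" and q: "9 / 10 \<le> q" and c0: "c0 > 0"
    and GHD: "\<And>N R k. N \<ge> N\<^sub>0 \<Longrightarrow> solves_GHD q N R \<Longrightarrow> (\<forall>P\<in>set_pmf R. cost P \<le> k) \<Longrightarrow> real k \<ge> c0 * real N"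
  shows "\<exists>c>0. \<forall>n N D \<epsilon> T A.
     3 \<le> D \<and> D < n \<and> 0 < \<epsilon> \<and> \<epsilon> < 1 \<and>
     \<kappa> * \<epsilon> powr (- 2) \<le> real n \<and> \<kappa> * \<epsilon> powr (- 2) \<le> real N \<and>
     congest_solves B q n N D (approx_moment p \<epsilon> n N) T A \<longrightarrow>
     real T \<ge> c * (real D + \<epsilon> powr (- 2) / log 2 (real n))"
proof -
  define a where "a = (2 :: real) powr p"
  have a: "a > 0" "a \<noteq> 2"
    using p powr_inj[of 2 p 1] by (auto simp: a_def)
  \<comment> \<open>With \<open>\<kappa> / 4\<close> the instance fits into nodes and values. The
    other bound keeps the error \<open>\<epsilon> * (a + 2) * sqrt M\<close> below the slope, its
    factor 1/2 making the inequality strict.\<close>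
  define \<gamma> where "\<gamma> = min (\<kappa> / 4) (((2 - a) / (a + 2))\<^sup>2 / 2)"
  \<comment> \<open>The first summand is the protocol cost divided by \<open>c0\<close>; the rest
    covers instances below the threshold of the conjecture and the rounding of
    \<open>M\<close>.\<close>
  define C where "C = (2 * B + 4) / c0 + real N\<^sub>0 + 2"
  have \<gamma>: "0 < \<gamma>" "\<gamma> \<le> \<kappa> / 4" "\<gamma> \<le> ((2 - a) / (a + 2))\<^sup>2 / 2" using \<kappa> a by (auto simp: \<gamma>_def)
  have C: "0 < C" using B c0 by (simp add: C_def add_pos_nonneg)
  have main: "real T \<ge> 1 / (2 + C / \<gamma>) * (real D + \<epsilon> powr (- 2) / log 2 (real n))"
    if D: "3 \<le> D" "D < n" and \<epsilon>: "0 < \<epsilon>" "\<epsilon> < 1"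
      and nN: "\<kappa> * \<epsilon> powr (- 2) \<le> real n" "\<kappa> * \<epsilon> powr (- 2) \<le> real N"
      and solves: "congest_solves B q n N D (approx_moment p \<epsilon> n N) T A" for n N D \<epsilon> T A
  proof -
    let ?l = "log 2 (real n)"
    define e where "e = \<epsilon> powr (- 2)"
    have e: "e > 0" "\<epsilon>\<^sup>2 * e = 1"
      using \<epsilon>(1) by (simp_all add: e_def powr_minus powr_numeral)
    have l: "1 \<le> ?l" using D by (intro log_ge_1) simp
    have "0 < \<kappa> * e" using \<kappa> e by simp
    then have N1: "1 \<le> N" using nN(2) by (cases N) (auto simp: e_def)
    have DT: "D \<le> 2 * T"
      by (rule approx_diameter_le_twice_rounds[OF D N1 _ \<epsilon>(2) solves]) (use q in simp)
    then have T: "1 \<le> real T" using D by simp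
    have lT: "1 \<le> ?l * real T" using mult_mono[OF l T] l by simp
    obtain b where b: "\<And>s u. length (message A s u) \<le> b" "real (Suc b) \<le> (B + 1) * ?l"
      using bandwidth_bound[of A B n] solves B D by (auto simp: congest_solves_def)
    define M where "M = nat \<lfloor>\<gamma> * e\<rfloor>"
    have M: "real M \<le> \<gamma> * e" "\<gamma> * e \<le> real M + 1"
      using \<gamma>(1) e(1) by (simp_all add: M_def)
    have "\<gamma> * e \<le> \<kappa> / 4 * e" using \<gamma> e by (intro mult_right_mono) auto
    then have M2: "M \<le> n div 2" "2 * M \<le> N" using M(1) nN unfolding e_def[symmetric] by linarith+
    have "\<gamma> * e \<le> C * (?l * real T)"
    proof (cases "N\<^sub>0 \<le> M \<and> 1 \<le> M")
      case False
      then have "real M \<le> real N\<^sub>0 + 1" by auto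
      then have "\<gamma> * e \<le> (real N\<^sub>0 + 2) * 1" using M(2) by simp
      also have "\<dots> \<le> C * (?l * real T)"
        using lT B c0 by (intro mult_mono) (auto simp: C_def)
      finally show ?thesis .
    next
      case True
      have "(\<epsilon> * (a + 2) * sqrt (real M))\<^sup>2 = \<epsilon>\<^sup>2 * (a + 2)\<^sup>2 * real M" by (simp add: power_mult_distrib)
      also have "\<dots> \<le> \<epsilon>\<^sup>2 * (a + 2)\<^sup>2 * (((2 - a) / (a + 2))\<^sup>2 / 2 * e)"
      proof (rule mult_left_mono)
        show "real M \<le> ((2 - a) / (a + 2))\<^sup>2 / 2 * e"
          by (rule order_trans[OF M(1)], rule mult_right_mono[OF \<gamma>(3)]) (use e in simp)
      qed simp
      also have "\<dots> = (\<epsilon>\<^sup>2 * e) * ((2 - a)\<^sup>2 / 2)"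
        using a(1) by (simp add: power_divide field_simps)
      also have "\<dots> < (2 - a)\<^sup>2" using a(2) by (simp add: e(2))
      also have "\<dots> = \<bar>2 - a\<bar>\<^sup>2" by simp
      finally have small: "\<epsilon> * (2 powr p + 2) * sqrt (real M) < \<bar>2 - 2 powr p\<bar>"
        unfolding a_def[symmetric] by (rule power_less_imp_less_base) simp
      have "\<exists>R. solves_GHD q M R \<and> (\<forall>P\<in>set_pmf R. cost P \<le> T * (2 * Suc b) + 2)"
        using True by (intro congest_approx_imp_GHD_protocol[OF D _ M2 \<epsilon>(1) small b(1) solves]) simp
      then have "c0 * real M \<le> real (T * (2 * Suc b) + 2)" using GHD True by blast
      also have "\<dots> = real T * (2 * real (Suc b)) + 2" by (simp add: algebra_simps)
      also have "\<dots> \<le> real T * (2 * ((B + 1) * ?l)) + 2 * (?l * real T)"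
        using b(2) lT by (intro add_mono mult_left_mono) auto
      also have "\<dots> = (2 * B + 4) * (?l * real T)" by (simp add: algebra_simps)
      finally have "real M \<le> (2 * B + 4) / c0 * (?l * real T)" using c0 by (simp add: field_simps)
      moreover have "1 \<le> (real N\<^sub>0 + 2) * (?l * real T)"
        using mult_mono[of 1 "real N\<^sub>0 + 2" 1 "?l * real T"] lT by simp
      ultimately show ?thesis using M(2) unfolding C_def distrib_right by linarith
    qed
    then have "e \<le> C / \<gamma> * ?l * real T" using \<gamma>(1) by (simp add: field_simps)
    then show ?thesis unfolding e_def[symmetric]
      using DT l C \<gamma>(1) by (intro rounds_lower_bound[where K = "C / \<gamma>"]) auto
  qed
  have "0 < 1 / (2 + C / \<gamma>)" using C \<gamma> by (simp add: add_pos_pos)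
  with main show ?thesis by blast
qed

section \<open>Large moments: choice of the number of players\<close>

lemma ex_power2_between:
  fixes a :: real
  assumes "1 \<le> a"
  obtains k :: nat where "a \<le> 2 ^ k" "2 ^ k \<le> 2 * a"
proof
  define k where "k = nat \<lceil>log 2 a\<rceil>"
  have "0 \<le> log 2 a" using assms by simp
  then have k: "log 2 a \<le> real k" "real k \<le> log 2 a + 1" by (auto simp: k_def)
  have "a = 2 powr (log 2 a)" using assms by simp
  also have "\<dots> \<le> 2 powr real k" using k by simp
  finally show "a \<le> 2 ^ k" by (simp add: powr_realpow)
  have "2 powr real k \<le> 2 powr (log 2 a + 1)" using k by simp
  also have "\<dots> = 2 * a" using assms by (simp add: powr_add)
  finally show "2 ^ k \<le> 2 * a" by (simp add: powr_realpow)
qed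

lemma powr_le_self_ge_1: "1 \<le> x \<Longrightarrow> s \<le> 1 \<Longrightarrow> x powr s \<le> x" for x s :: real
  using powr_mono[of s 1 x] by simp

lemma approx_moment_min_bound:
  fixes p B :: real
  assumes p: "p > 2" and B: "B > 0" and q: "9 / 10 \<le> q"
    and D: "4 \<le> D" "D < n" and N: "1 \<le> N"
    and solves: "congest_solves B q n N D (approx_moment p (1 / 10) n N) T A"
  shows "real (min N n) powr (1 - 2 / p) \<le> (36 * 4096 * (2 * B + 4)) * log 2 (real n) * real T"
proof -
  let ?l = "log 2 (real n)"
  define s where "s = 1 - 2 / p"
  have s: "0 < s" "s < 1" using p by (auto simp: s_def)
  define m where "m = min N n"
  have m: "1 \<le> m" "m \<le> N" "m \<le> n" using N D by (auto simp: m_def)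
  have l: "1 \<le> ?l" using D by (intro log_ge_1) simp
  have DT: "D \<le> 2 * T"
    by (rule approx_diameter_le_twice_rounds[OF _ D(2) N _ _ solves]) (use q D in auto)
  then have T: "1 \<le> real T" using D by simp
  have lT: "real T \<le> ?l * real T" using mult_right_mono[OF l, of "real T"] by simp
  have ms: "real m powr s \<le> real m" using m s by (intro powr_le_self_ge_1) auto
  have easy: "real m powr s \<le> (36 * 4096 * (2 * B + 4)) * ?l * real T" if "real m \<le> 36 * real T"
  proof -
    have "real m powr s \<le> 36 * (?l * real T)" using ms that lT by linarith
    also have "\<dots> \<le> (36 * 4096 * (2 * B + 4)) * (?l * real T)"
      using lT T B by (intro mult_right_mono) auto
    finally show ?thesis by (simp add: mult.assoc)
  qed
  show ?thesis
  proof (cases "m < 36 \<or> n \<le> 2 * D")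
    \<comment> \<open>Here the diameter bound is enough: \<open>m < 36\<close> is covered by
      \<open>1 \<le> T\<close>, and \<open>n \<le> 2 * D\<close> gives
      \<open>m \<le> 4 * T\<close>.\<close>
    case True
    then have "real m \<le> 36 * real T" using m DT T by auto
    then show ?thesis using easy by (simp add: m_def s_def)
  next
    case False
    \<comment> \<open>By \<open>t * w \<le> 2 * M + 2 * t\<close> and \<open>t \<le> 8 * M\<close>
      the blocks take at most \<open>18 * M \<le> n / 2\<close> nodes; \<open>2 * D < n\<close>
      leaves room for the path.\<close>
    define M where "M = m div 36"
    have "m = 36 * M + m mod 36" "m mod 36 < 36" by (simp_all add: M_def)
    moreover from this have "1 \<le> M" using False by linarith
    ultimately have M: "1 \<le> M" "M \<le> N" "36 * M \<le> n" "m \<le> 72 * M" using m by linarith+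
    \<comment> \<open>Makes \<open>(t / 2) powr p \<ge> 2 * M\<close> for \<open>t \<ge> a\<close>,
      since half of the players may hold nothing. Jayram's doubling wants a power of two, so
      \<open>t\<close> can be as large as \<open>2 * a\<close>.\<close>
    define a where "a = 2 * (2 * real M) powr (1 / p)"
    have a1: "1 \<le> (2 * real M) powr (1 / p)" using M p by (intro ge_one_powr_ge_zero) auto
    then obtain k where k: "a \<le> 2 ^ k" "2 ^ k \<le> 2 * a"
      using ex_power2_between[of a] by (auto simp: a_def)
    define t :: nat where "t = 2 ^ k"
    have t: "a \<le> real t" "real t \<le> 2 * a" using k by (simp_all add: t_def)
    \<comment> \<open>One unit rounds the quotient up, giving the blocks total capacity
      \<open>2 * M\<close>; the other ensures \<open>2 \<le> w\<close>.\<close>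
    define w where "w = 2 * M div t + 2"
    have t0: "t > 0" by (simp add: t_def)
    have tw: "2 * M \<le> t * w" "t * w \<le> 2 * M + 2 * t"
    proof -
      have "2 * M = t * (2 * M div t) + 2 * M mod t" by simp
      moreover have "2 * M mod t < t" using t0 by simp
      ultimately show "2 * M \<le> t * w" "t * w \<le> 2 * M + 2 * t"
        unfolding w_def distrib_left by linarith+
    qed
    have "(2 * real M) powr (1 / p) \<le> 2 * real M" using M p by (intro powr_le_self_ge_1) auto
    then have "real t \<le> 8 * real M" using t by (simp add: a_def)
    then have t8: "t \<le> 8 * M" by linarith
    have room: "t * w + D \<le> n + 1" using tw(2) t8 M(3) False by linarith
    have big: "2 * real M \<le> (real t / 2) powr p"
    proof -
      have "2 * real M = ((2 * real M) powr (1 / p)) powr p" using p M by (simp add: powr_powr)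
      also have "\<dots> \<le> (real t / 2) powr p" using t p by (intro powr_mono2) (auto simp: a_def)
      finally show ?thesis .
    qed
    obtain b where b: "\<And>s u. length (message A s u) \<le> b" "real (Suc b) \<le> (B + 1) * ?l"
      using bandwidth_bound[of A B n] solves B D by (auto simp: congest_solves_def)
    have t1: "1 \<le> real t" using t0 by simp
    have "real M * (1 / 2) \<le> real M * (2 * q - 1)\<^sup>2"
      using success_gap[OF q] by (intro mult_left_mono) auto
    also have "\<dots> \<le> 64 * real t * (real (Suc b) * (real T * (2 * real t)) + real t + 1)"
      by (rule congest_star_bound[OF D(1) _ t_def room M(1,2) tw(1) _ big _ b(1) solves])
         (use p q in \<open>auto simp: w_def\<close>)
    also have "\<dots> \<le> 64 * real t * ((B + 1) * ?l * (real T * (2 * real t)) + 2 * (?l * real T * real t))"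
    proof -
      have "1 \<le> ?l * real T" using lT T by linarith
      then have "1 * real t \<le> ?l * real T * real t" by (rule mult_right_mono) simp
      then have "real t + 1 \<le> 2 * (?l * real T * real t)" using t1 by linarith
      moreover have "real (Suc b) * (real T * (2 * real t)) \<le> (B + 1) * ?l * (real T * (2 * real t))"
        using b(2) by (intro mult_right_mono) auto
      ultimately have "real (Suc b) * (real T * (2 * real t)) + real t + 1
          \<le> (B + 1) * ?l * (real T * (2 * real t)) + 2 * (?l * real T * real t)" by linarith
      then show ?thesis by (rule mult_left_mono) simp
    qed
    also have "\<dots> = 64 * (2 * B + 4) * (?l * real T) * (real t)\<^sup>2"
      by (simp add: power2_eq_square algebra_simps)
    also have "\<dots> \<le> 64 * (2 * B + 4) * (?l * real T) * (16 * (2 * real M) powr (2 / p))"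
    proof (rule mult_left_mono)
      have "(real t)\<^sup>2 \<le> (4 * (2 * real M) powr (1 / p))\<^sup>2" using t t1 by (intro power_mono) (auto simp: a_def)
      also have "\<dots> = 16 * ((2 * real M) powr (1 / p) * (2 * real M) powr (1 / p))"
        by (simp add: power2_eq_square)
      also have "\<dots> = 16 * (2 * real M) powr (2 / p)" by (simp flip: powr_add add: add_divide_distrib[symmetric])
      finally show "(real t)\<^sup>2 \<le> 16 * (2 * real M) powr (2 / p)" .
    qed (use B l in auto)
    \<comment> \<open>The constant is \<open>4 * 64 * 16\<close>: a factor 2 from the success gap, 2
      from passing to \<open>2 * M\<close>, and 16 from \<open>t^2\<close>.\<close>
    finally have "2 * real M \<le> 4096 * (2 * B + 4) * (?l * real T) * (2 * real M) powr (2 / p)"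
      by (simp add: algebra_simps)
    moreover have "2 * real M = (2 * real M) powr s * (2 * real M) powr (2 / p)"
      using M by (simp add: s_def flip: powr_add)
    moreover have "0 < (2 * real M) powr (2 / p)" using M by simp
    ultimately have key: "(2 * real M) powr s \<le> 4096 * (2 * B + 4) * (?l * real T)"
      by (metis mult_le_cancel_right_pos)
    have "real m powr s \<le> (36 * (2 * real M)) powr s" using M s by (intro powr_mono2) auto
    also have "\<dots> = 36 powr s * (2 * real M) powr s" by (subst powr_mult) simp_all
    also have "\<dots> \<le> 36 * (4096 * (2 * B + 4) * (?l * real T))"
      using key s by (intro mult_mono powr_le_self_ge_1) auto
    finally show ?thesis unfolding m_def s_def by (simp only: mult.assoc)
  qed
qed

text \<open>In the first regime \<open>N\<close> is at most \<open>K1 * min N n\<close>. In the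
  second, \<open>n powr r\<close> is at most \<open>K2 * min N n\<close>: it never exceeds
  \<open>n\<close>, and raising the hypothesis to the power \<open>r\<close> compares it with
  \<open>N\<close>. As \<open>K1\<close> and \<open>K2\<close> are at least 1, the exponent
  \<open>1 - 2 / p < 1\<close> does not enlarge them.\<close>

lemma approx_moment_rounds_large_p:
  fixes p B \<kappa> :: real
  assumes p: "p > 2" and B: "B > 0" and \<kappa>: "\<kappa> > 0" and q: "9 / 10 \<le> q"
  shows "\<exists>c>0. \<forall>(n::nat) (N::nat) (D::nat) (T::nat) A.
     4 \<le> D \<and> D < n \<and> 1 \<le> N \<and>
     congest_solves B q n N D (approx_moment p (1 / 10) n N) T A \<longrightarrow>
     (\<kappa> * real N \<le> real n \<longrightarrow>
        real T \<ge> c * (real D + real N powr (1 - 2 / p) / log 2 (real n))) \<and>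
     (\<kappa> * real n \<le> real N powr (1 + 1 / p) \<longrightarrow>
        real T \<ge> c * (real D + real n powr ((1 - 2 / p) / (1 + 1 / p)) / log 2 (real n))) \<and>
     (\<kappa> * real N \<le> real n \<and> \<kappa> * real n \<le> real N powr (1 + 1 / p) \<longrightarrow>
        real T \<ge> c * (real D +
          (real N powr (1 - 2 / p) + real n powr ((1 - 2 / p) / (1 + 1 / p))) / log 2 (real n)))"
proof -
  define s r where "s = 1 - 2 / p" and "r = 1 / (1 + 1 / p)"
  have s: "0 < s" "s < 1" using p by (auto simp: s_def)
  have "0 < 1 / u \<and> 1 / u \<le> 1 \<and> u * (1 / u) = 1" if "1 < u" for u :: real using that by simp
  from this[of "1 + 1 / p"] have r: "0 < r" "r \<le> 1" "(1 + 1 / p) * r = 1"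
    unfolding r_def using p by auto
  define C K1 K2 where "C = 36 * 4096 * (2 * B + 4)" and "K1 = max 1 (1 / \<kappa>)" and "K2 = max 1 (\<kappa> powr (- r))"
  have C: "0 < C" using B by (simp add: C_def)
  have K: "1 \<le> K1" "1 \<le> K2" by (auto simp: K1_def K2_def)
  define c where "c = 1 / (2 + (K1 * C + K2 * C))"
  have main: "(\<kappa> * real N \<le> real n \<longrightarrow> real T \<ge> c * (real D + real N powr s / log 2 (real n))) \<and>
     (\<kappa> * real n \<le> real N powr (1 + 1 / p) \<longrightarrow>
        real T \<ge> c * (real D + real n powr (s / (1 + 1 / p)) / log 2 (real n))) \<and>
     (\<kappa> * real N \<le> real n \<and> \<kappa> * real n \<le> real N powr (1 + 1 / p) \<longrightarrow>
        real T \<ge> c * (real D + (real N powr s + real n powr (s / (1 + 1 / p))) / log 2 (real n)))"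
    if D: "4 \<le> D" "D < n" and N: "1 \<le> N"
      and solves: "congest_solves B q n N D (approx_moment p (1 / 10) n N) T A" for n N D T A
  proof -
    let ?l = "log 2 (real n)"
    define m where "m = real (min N n)"
    have m: "1 \<le> m" using N D by (simp add: m_def)
    have l: "1 \<le> ?l" using D by (intro log_ge_1) simp
    have DT: "D \<le> 2 * T"
      by (rule approx_diameter_le_twice_rounds[OF _ D(2) N _ _ solves]) (use q D in auto)
    have mC: "m powr s \<le> C * ?l * real T"
      unfolding m_def s_def C_def by (rule approx_moment_min_bound[OF p B q D N solves])
    have scale: "x powr s \<le> K * C * ?l * real T" if "0 \<le> x" "x \<le> K * m" "1 \<le> K" for x K :: real
    proof -
      have "x powr s \<le> (K * m) powr s" using that s by (intro powr_mono2) auto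
      also have "\<dots> = K powr s * m powr s" using that m by (simp add: powr_mult)
      also have "\<dots> \<le> K * (C * ?l * real T)"
        using mC that s by (intro mult_mono powr_le_self_ge_1) auto
      finally show ?thesis by (simp add: mult.assoc)
    qed
    have bN: "real N powr s \<le> K1 * C * ?l * real T" if "\<kappa> * real N \<le> real n"
    proof (rule scale)
      have "real N \<le> 1 / \<kappa> * real n" using that \<kappa> by (simp add: field_simps)
      also have "\<dots> \<le> K1 * real n" by (intro mult_right_mono) (auto simp: K1_def)
      finally have "real N \<le> K1 * real n" .
      moreover have "real N \<le> K1 * real N" using K(1) by (simp add: mult_le_cancel_right1)
      ultimately show "real N \<le> K1 * m" unfolding m_def by (simp add: min_def)
    qed (use K in auto)
    have bn: "real n powr (s / (1 + 1 / p)) \<le> K2 * C * ?l * real T" if "\<kappa> * real n \<le> real N powr (1 + 1 / p)"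
    proof -
      have "(real n powr r) powr s \<le> K2 * C * ?l * real T"
      proof (rule scale)
        have "real n powr r \<le> real n" using D r by (intro powr_le_self_ge_1) auto
        also have "\<dots> \<le> K2 * real n" using K(2) by (simp add: mult_le_cancel_right1)
        finally have 1: "real n powr r \<le> K2 * real n" .
        have "\<kappa> powr r * real n powr r = (\<kappa> * real n) powr r" using \<kappa> by (simp add: powr_mult)
        also have "\<dots> \<le> (real N powr (1 + 1 / p)) powr r" using that \<kappa> r by (intro powr_mono2) auto
        also have "\<dots> = real N" using r N by (simp add: powr_powr)
        finally have "real n powr r \<le> \<kappa> powr (- r) * real N"
          using \<kappa> by (simp add: powr_minus field_simps)
        also have "\<dots> \<le> K2 * real N" by (intro mult_right_mono) (auto simp: K2_def)
        finally show "real n powr r \<le> K2 * m" using 1 unfolding m_def by (simp add: min_def)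
      qed (use K in auto)
      then show ?thesis by (simp add: powr_powr r_def)
    qed
    have pos: "0 \<le> K1 * C" "0 \<le> K2 * C" using K C by auto
    show ?thesis unfolding c_def
    proof (intro conjI impI)
      assume "\<kappa> * real N \<le> real n"
      from bN[OF this] show "real T \<ge> 1 / (2 + (K1 * C + K2 * C)) * (real D + real N powr s / ?l)"
        using DT l pos by (intro rounds_lower_bound[where K = "K1 * C"]) auto
    next
      assume "\<kappa> * real n \<le> real N powr (1 + 1 / p)"
      from bn[OF this]
      show "real T \<ge> 1 / (2 + (K1 * C + K2 * C)) * (real D + real n powr (s / (1 + 1 / p)) / ?l)"
        using DT l pos by (intro rounds_lower_bound[where K = "K2 * C"]) auto
    next
      assume "\<kappa> * real N \<le> real n \<and> \<kappa> * real n \<le> real N powr (1 + 1 / p)"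
      then have "real N powr s + real n powr (s / (1 + 1 / p)) \<le> (K1 * C + K2 * C) * ?l * real T"
        using bN bn unfolding distrib_right by fastforce
      then show "real T \<ge> 1 / (2 + (K1 * C + K2 * C)) *
          (real D + (real N powr s + real n powr (s / (1 + 1 / p))) / ?l)"
        using DT l pos by (intro rounds_lower_bound[where K = "K1 * C + K2 * C"]) auto
    qed
  qed
  have "0 < c" unfolding c_def using K C by (intro divide_pos_pos add_pos_nonneg) auto
  with main show ?thesis unfolding s_def by blast
qed

lemma solves_GHD_mono:
  assumes "solves_GHD q' N R" "q \<le> q'"
  shows "solves_GHD q N R"
  unfolding solves_GHD_def
proof (intro allI impI conjI)
  fix x y :: "bool list" assume len: "length x = N \<and> length y = N"
  {
    assume "real (hamming x y) \<ge> real N / 2 + sqrt (real N)"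
    then have "q' \<le> measure_pmf.prob R {P. run P x y}"
      using assms(1) len unfolding solves_GHD_def by blast
    with assms(2) show "q \<le> measure_pmf.prob R {P. run P x y}" by simp
  next
    assume "real (hamming x y) \<le> real N / 2 - sqrt (real N)"
    then have "q' \<le> measure_pmf.prob R {P. \<not> run P x y}"
      using assms(1) len unfolding solves_GHD_def by blast
    with assms(2) show "q \<le> measure_pmf.prob R {P. \<not> run P x y}" by simp
  }
qed

theorem theorem6:
  shows "\<exists>q::real. 0 < q \<and> q < 1 \<and>
    (Brody_Chakrabarti \<longrightarrow>
      (\<forall>p B \<kappa> :: real. p \<ge> 0 \<and> p \<noteq> 1 \<and> B > 0 \<and> \<kappa> > 0 \<longrightarrow>
        (\<exists>c>0. \<forall>(n::nat) (N::nat) (D::nat) (\<epsilon>::real) (T::nat) A.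
           3 \<le> D \<and> D < n \<and> 0 < \<epsilon> \<and> \<epsilon> < 1 \<and>
           \<kappa> * \<epsilon> powr (- 2) \<le> real n \<and> \<kappa> * \<epsilon> powr (- 2) \<le> real N \<and>
           congest_solves B q n N D (approx_moment p \<epsilon> n N) T A \<longrightarrow>
           real T \<ge> c * (real D + \<epsilon> powr (- 2) / log 2 (real n))))) \<and>
    (\<forall>p B \<kappa> :: real. p > 2 \<and> B > 0 \<and> \<kappa> > 0 \<longrightarrow>
        (\<exists>c>0. \<forall>(n::nat) (N::nat) (D::nat) (T::nat) A.
           4 \<le> D \<and> D < n \<and> 1 \<le> N \<and>
           congest_solves B q n N D (approx_moment p (1 / 10) n N) T A \<longrightarrow>
           (\<kappa> * real N \<le> real n \<longrightarrow>
              real T \<ge> c * (real D + real N powr (1 - 2 / p) / log 2 (real n))) \<and>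
           (\<kappa> * real n \<le> real N powr (1 + 1 / p) \<longrightarrow>
              real T \<ge> c * (real D + real n powr ((1 - 2 / p) / (1 + 1 / p)) / log 2 (real n))) \<and>
           (\<kappa> * real N \<le> real n \<and> \<kappa> * real n \<le> real N powr (1 + 1 / p) \<longrightarrow>
              real T \<ge> c * (real D +
                (real N powr (1 - 2 / p) + real n powr ((1 - 2 / p) / (1 + 1 / p)))
                  / log 2 (real n))))) \<and>
    (\<forall>p B \<kappa> :: real. p \<ge> 0 \<and> p \<noteq> 1 \<and> B > 0 \<and> \<kappa> > 0 \<longrightarrow>
        (\<exists>c>0. \<forall>(n::nat) (N::nat) (D::nat) (T::nat) A.
           3 \<le> D \<and> D < n \<and> \<kappa> * real n \<le> real N \<and>
           congest_solves B q n N D (exact_moment p n N) T A \<longrightarrow>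
           real T \<ge> c * (real D + real n / log 2 (real n))))"
proof -
  \<comment> \<open>One success probability has to serve all three claims: at least 9/10 for the
    unconditional arguments, and at least the threshold of the conjecture if that holds. Raising the
    threshold is harmless, since a more reliable protocol also solves the problem for smaller
    \<open>q\<close>.\<close>
  obtain q where q: "9 / 10 \<le> q" "q < 1"
    and BC: "Brody_Chakrabarti \<longrightarrow> (\<exists>c>0. \<exists>N\<^sub>0. \<forall>N\<ge>N\<^sub>0. \<forall>R k.
        solves_GHD q N R \<and> (\<forall>P\<in>set_pmf R. cost P \<le> k) \<longrightarrow> real k \<ge> c * real N)"
  proof (cases Brody_Chakrabarti)
    case True
    then obtain q0 c N\<^sub>0 where q0: "q0 < 1" "c > 0"
      and lb: "\<And>N R k. N \<ge> N\<^sub>0 \<Longrightarrow> solves_GHD q0 N R \<Longrightarrow> \<forall>P\<in>set_pmf R. cost P \<le> k \<Longrightarrow> real k \<ge> c * real N"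
      unfolding Brody_Chakrabarti_def by blast
    have "\<forall>N\<ge>N\<^sub>0. \<forall>R k. solves_GHD (max q0 (9 / 10)) N R \<and> (\<forall>P\<in>set_pmf R. cost P \<le> k) \<longrightarrow> real k \<ge> c * real N"
      using lb solves_GHD_mono[OF _ max.cobounded1] by blast
    then show thesis using q0 by (intro that[of "max q0 (9 / 10)"]) auto
  qed (use that[of "9 / 10"] in simp)
  show ?thesis
  proof (rule exI[of _ q], intro conjI impI allI)
    fix p B \<kappa> :: real
    assume "Brody_Chakrabarti" and *: "p \<ge> 0 \<and> p \<noteq> 1 \<and> B > 0 \<and> \<kappa> > 0"
    then obtain c N\<^sub>0 where "c > 0" and lb: "\<And>N R k. N \<ge> N\<^sub>0 \<Longrightarrow> solves_GHD q N R \<Longrightarrow>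
        \<forall>P\<in>set_pmf R. cost P \<le> k \<Longrightarrow> real k \<ge> c * real N"
      using BC by blast
    then show "\<exists>c>0. \<forall>(n::nat) (N::nat) (D::nat) (\<epsilon>::real) (T::nat) A.
           3 \<le> D \<and> D < n \<and> 0 < \<epsilon> \<and> \<epsilon> < 1 \<and>
           \<kappa> * \<epsilon> powr (- 2) \<le> real n \<and> \<kappa> * \<epsilon> powr (- 2) \<le> real N \<and>
           congest_solves B q n N D (approx_moment p \<epsilon> n N) T A \<longrightarrow>
           real T \<ge> c * (real D + \<epsilon> powr (- 2) / log 2 (real n))"
      using * by (intro approx_moment_rounds_of_GHD[OF _ _ _ q(1) _ lb]) auto
  qed (use q approx_moment_rounds_large_p exact_moment_rounds in auto)
qed

end
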